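(* Assume $H_1:\Lambda_\star\neq O$, (A1)–(A5), (AH), (T1) (stated in the context) and $nh_n^2\to0$. Let $$Z_n:=\sqrt{\frac{2p_n}{3\sum_{j=1}^{k_n-2}(\bar{\mathscr S}_{j+1}-\bar{\mathscr S}_j)^4}}\left(\sum_{i=0}^{n-1}(\mathscr S_{(i+1)h_n}-\mathscr S_{ih_n})^2-\sum_{0\le2i\le n-2}(\mathscr S_{(2i+2)h_n}-\mathscr S_{2ih_n})^2\right)$$ and, for $\alpha\in(0,1)$, let $z_\alpha$ be the $(1-\alpha)$-quantile of $N(0,1)$. Then the test with rejection region $Z_n\ge z_\alpha$ is consistent, i.e. for all $\alpha\in(0,1)$, $P(Z_n\ge z_\alpha)\to1$ as $n\to\infty$.
   Context: Setting. Let $\Theta_1\subset\mathbb{R}^{m_1}$, $\Theta_2\subset\mathbb{R}^{m_2}$ be compact convex sets, $\Theta=\Theta_1\times\Theta_2$, and let $b:\mathbb{R}^d\times\Theta_2\to\mathbb{R}^d$, $a:\mathbb{R}^d\times\Theta_1\to\mathbb{R}^d\otimes\mathbb{R}^r$ ($d\times r$ matrices) be known functions. The true parameter is $\theta^\star=(\alpha^\star,\beta^\star)\in\mathrm{Int}(\Theta)$. Write $b(x)=b(x,\beta^\star)$, $a(x)=a(x,\alpha^\star)$, $A(x,\alpha)=a(x,\alpha)a(x,\alpha)^T$. The process $X$ is the $d$-dimensional solution of $dX_t=b(X_t,\beta^\star)dt+a(X_t,\alpha^\star)dw_t$, $X_0=x_0$, where $w$ is an $r$-dimensional standard Wiener process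 and $x_0$ is an $\mathbb{R}^d$-valued random variable independent of $w$. Observations: $Y_{ih_n}=X_{ih_n}+\Lambda_\star^{1/2}\epsilon_{ih_n}$, $i=0,\ldots,n$, where $h_n>0$, $\Lambda_\star$ is a (fixed) $d\times d$ positive semi-definite matrix, and $(\epsilon_{ih_n})_i$ are i.i.d. $\mathbb{R}^d$-valued with mean $0$ and covariance $I_d$, with components independent of each other and of $w$ and $x_0$. Notation. The observations are split into $k_n$ blocks of $p_n$ observations, $n=k_np_n$, $\Delta_n=p_nh_n$. $\mathscr S_{ih_n}=\sum_{l=1}^dY_{ih_n}^{(l)}$ is the sum of the components of $Y_{ih_n}$, and $\bar{\mathscr S}_j=\frac1{p_n}\sum_{i=0}^{p_n-1}\mathscr S_{j\Delta_n+ih_n}$, $j=0,\ldots,k_n-1$. A function $g$ on $\mathbb{R}^d\times\Theta$ has polynomial growth uniformly in $\theta$ if $\sup_{\theta}|g(x,\theta)|\le C(1+\|x\|)^C$ for all $x$, for some $C>0$. Assumptions (here the argument $\alpha$ of $a$, $A$ is the diffusion parameter, not the test level). (A1) $b$ and $a$ are 4 times continuously differentiable, and their components and those of their derivatives are of polynomial growth uniformly in $\theta\in\Theta$. Moreover there is $C>0$ such that for all $x$, $\|b(x)\|+\|b'(x)\|+\|b''(x)\|\le C(1+\|x\|)$ and $\|a(x)\|+\|a'(x)\|+\|a''(x)\|\le C(1+\|x\|)$ (derivatives in $x$). (A2) $X$ is ergodic and its invariant measure $\nu_0$ has finite $k$-th moment for all $k>0$. (A3) For all $k>0$, $\sup_{t\ge0}\mathbf{E}[\|X_t\|^k]<\infty$.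 (A4) For any $k>0$, $\epsilon_{ih_n}$ has finite $k$-th moment; the components of $\epsilon_{ih_n}$ are independent of the other components, of $w$ and of $x_0$; and the marginal distribution of each component is symmetric. (A5) $\inf_{x,\alpha}\det A(x,\alpha)>0$. (AH) $h_n=p_n^{-\tau}$ with $\tau\in(1,2]$, and $h_n\to0$, $p_n\to\infty$, $k_n\to\infty$, $\Delta_n=p_nh_n\to0$, $nh_n\to\infty$ as $n\to\infty$. (T1) If the index set $\mathcal K=\{i\in\{1,\ldots,d\}:\Lambda_\star^{(i,i)}>0\}$ is nonempty, then the submatrix $[\Lambda_\star^{(i_1,i_2)}]_{i_1,i_2\in\mathcal K}$ is positive definite. *)

theory Defs
  imports "HOL-Probability.Probability"
begin

section \<open>Regularity of the coefficients\<close>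

text \<open>
  \<open>pderivs S vs f\<close> is the iterated directional derivative of \<open>f\<close> along the vectors in \<open>vs\<close>
  (the last one is applied first), derivatives being taken within \<open>S\<close>. It is only used for convex
  \<open>S\<close> with nonempty interior, where derivatives within \<open>S\<close> are unique, also at boundary points.
\<close>

primrec pderivs ::
  "'a::euclidean_space set \<Rightarrow> 'a list \<Rightarrow> ('a \<Rightarrow> 'b::euclidean_space) \<Rightarrow> 'a \<Rightarrow> 'b" where
  "pderivs S [] f = f"
| "pderivs S (v # vs) f = (\<lambda>z. frechet_derivative (pderivs S vs f) (at z within S) v)"

definition Ck_on ::
  "nat \<Rightarrow> 'a::euclidean_space set \<Rightarrow> ('a \<Rightarrow> 'b::euclidean_space) \<Rightarrow> bool" where
  "Ck_on k S f \<longleftrightarrow>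
     (\<forall>vs. set vs \<subseteq> Basis \<and> length vs < k \<longrightarrow> pderivs S vs f differentiable_on S) \<and>
     (\<forall>vs. set vs \<subseteq> Basis \<and> length vs \<le> k \<longrightarrow> continuous_on S (pderivs S vs f))"

definition unif_poly_growth ::
  "'p set \<Rightarrow> ('a::real_normed_vector \<times> 'p \<Rightarrow> real) \<Rightarrow> bool" where
  "unif_poly_growth \<Theta> g \<longleftrightarrow>
     (\<exists>C>0. \<forall>x. \<forall>\<theta>\<in>\<Theta>. \<bar>g (x, \<theta>)\<bar> \<le> C * (1 + norm x) powr C)"

definition C4_poly_growth ::
  "'p::euclidean_space set \<Rightarrow> ('a::euclidean_space \<Rightarrow> 'p \<Rightarrow> 'b::euclidean_space) \<Rightarrow> bool" where
  "C4_poly_growth \<Theta> f \<longleftrightarrow>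
     Ck_on 4 (UNIV \<times> \<Theta>) (\<lambda>(x, \<theta>). f x \<theta>) \<and>
     (\<forall>vs. set vs \<subseteq> Basis \<and> length vs \<le> 4 \<longrightarrow>
       (\<forall>e\<in>Basis. unif_poly_growth \<Theta> (\<lambda>z. pderivs (UNIV \<times> \<Theta>) vs (\<lambda>(x, \<theta>). f x \<theta>) z \<bullet> e)))"

text \<open>Euclidean (Frobenius) norm of the tensor of all \<open>j\<close>-th order partial derivatives at \<open>x\<close>.\<close>

definition deriv_norm :: "nat \<Rightarrow> ('a::euclidean_space \<Rightarrow> 'b::euclidean_space) \<Rightarrow> 'a \<Rightarrow> real" where
  "deriv_norm j f x =
     sqrt (\<Sum>vs\<in>{vs. set vs \<subseteq> Basis \<and> length vs = j}. (norm (pderivs UNIV vs f x))\<^sup>2)"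

definition linear_growth_upto_2 :: "('a::euclidean_space \<Rightarrow> 'b::euclidean_space) \<Rightarrow> real \<Rightarrow> bool" where
  "linear_growth_upto_2 f C \<longleftrightarrow>
     (\<forall>x. deriv_norm 0 f x + deriv_norm 1 f x + deriv_norm 2 f x \<le> C * (1 + norm x))"


section \<open>Matrices\<close>

definition pos_semidef :: "real^'d^'d \<Rightarrow> bool" where
  "pos_semidef L \<longleftrightarrow> transpose L = L \<and> (\<forall>v. 0 \<le> v \<bullet> (L *v v))"

text \<open>The positive semi-definite square root is unique, hence a relation determines it.\<close>

definition is_psd_sqrt :: "real^'d^'d \<Rightarrow> real^'d^'d \<Rightarrow> bool" where
  "is_psd_sqrt R L \<longleftrightarrow> pos_semidef R \<and> R ** R = L"

definition pos_def_submatrix :: "'d::finite set \<Rightarrow> real^'d^'d \<Rightarrow> bool" where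
  "pos_def_submatrix K L \<longleftrightarrow>
     (\<forall>i\<in>K. \<forall>j\<in>K. L $ i $ j = L $ j $ i) \<and>
     (\<forall>u :: 'd \<Rightarrow> real. (\<exists>i\<in>K. u i \<noteq> 0) \<longrightarrow> 0 < (\<Sum>i\<in>K. \<Sum>j\<in>K. u i * L $ i $ j * u j))"


section \<open>Probability\<close>

definition tendsto_in_prob ::
  "'w measure \<Rightarrow> ('i \<Rightarrow> 'w \<Rightarrow> 'b::metric_space) \<Rightarrow> ('w \<Rightarrow> 'b) \<Rightarrow> 'i filter \<Rightarrow> bool" where
  "tendsto_in_prob M f g F \<longleftrightarrow>
     (\<forall>e>0. ((\<lambda>n. measure M {\<omega> \<in> space M. e < dist (f n \<omega>) (g \<omega>)}) \<longlongrightarrow> 0) F)"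

text \<open>The \<open>\<sigma>\<close>-algebra, as a set of events, generated by \<open>Z i\<close>, \<open>i \<in> I\<close>.\<close>

definition gen_events ::
  "'w measure \<Rightarrow> 'i set \<Rightarrow> ('i \<Rightarrow> 'w \<Rightarrow> 'b::topological_space) \<Rightarrow> 'w set set" where
  "gen_events M I Z = sigma_sets (space M) {Z i -` B \<inter> space M |i B. i \<in> I \<and> B \<in> sets borel}"

definition quantile :: "real measure \<Rightarrow> real \<Rightarrow> real" where
  "quantile \<mu> q = Inf {z. q \<le> cdf \<mu> z}"

definition finite_moments :: "'w measure \<Rightarrow> ('w \<Rightarrow> 'b::real_normed_vector) \<Rightarrow> bool" where
  "finite_moments M Z \<longleftrightarrow> (\<forall>k::real. k > 0 \<longrightarrow> (\<integral>\<^sup>+ \<omega>. ennreal (norm (Z \<omega>) powr k) \<partial>M) < \<infinity>)"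


section \<open>Stochastic integration and diffusion processes\<close>

text \<open>Only times \<open>t \<ge> 0\<close> are relevant for all processes.\<close>

definition wiener_process :: "'w measure \<Rightarrow> (real \<Rightarrow> 'w \<Rightarrow> real^'r) \<Rightarrow> bool" where
  "wiener_process M w \<longleftrightarrow>
     (\<forall>t\<ge>0. w t \<in> borel_measurable M) \<and>
     (AE \<omega> in M. w 0 \<omega> = 0) \<and>
     (\<forall>\<omega>\<in>space M. continuous_on {0..} (\<lambda>t. w t \<omega>)) \<and>
     (\<forall>s t. 0 \<le> s \<and> s < t \<longrightarrow>
        prob_space.indep_set M (gen_events M {0..s} w) (gen_events M {()} (\<lambda>_ \<omega>. w t \<omega> - w s \<omega>)) \<and>
        prob_space.indep_vars M (\<lambda>_. borel) (\<lambda>j \<omega>. (w t \<omega> - w s \<omega>) $ j) UNIV \<and>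
        (\<forall>j. distributed M lborel (\<lambda>\<omega>. (w t \<omega> - w s \<omega>) $ j) (normal_density 0 (sqrt (t - s)))))"

text \<open>Filtration generated by the initial value and the Wiener process, augmented by null sets.\<close>

definition driving_filtration ::
  "'w measure \<Rightarrow> ('w \<Rightarrow> real^'d) \<Rightarrow> (real \<Rightarrow> 'w \<Rightarrow> real^'r) \<Rightarrow> real \<Rightarrow> 'w measure" where
  "driving_filtration M x0 w t =
     sigma (space M) (null_sets M \<union> gen_events M {()} (\<lambda>_. x0) \<union> gen_events M {0..t} w)"

text \<open>
  Simple integrands \<open>\<Sum>i<N. \<xi>\<^sub>i 1\<^bsub>(\<tau>\<^sub>i, \<tau>\<^sub>i\<^sub>+\<^sub>1]\<^esub>\<close> with values in the \<open>d \<times> r\<close> matrices, and their integrals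
  against an \<open>r\<close>-dimensional process.
\<close>

definition simple_integrand ::
  "'w measure \<Rightarrow> (real \<Rightarrow> 'w measure) \<Rightarrow> nat \<Rightarrow> (nat \<Rightarrow> real) \<Rightarrow> (nat \<Rightarrow> 'w \<Rightarrow> real^'r^'d) \<Rightarrow> bool" where
  "simple_integrand M F N \<tau> \<xi> \<longleftrightarrow>
     0 \<le> \<tau> 0 \<and> (\<forall>i<N. \<tau> i < \<tau> (Suc i)) \<and>
     (\<forall>i<N. \<xi> i \<in> borel_measurable (F (\<tau> i)) \<and> (\<exists>C. \<forall>\<omega>\<in>space M. norm (\<xi> i \<omega>) \<le> C))"

definition simple_process ::
  "nat \<Rightarrow> (nat \<Rightarrow> real) \<Rightarrow> (nat \<Rightarrow> 'w \<Rightarrow> real^'r^'d) \<Rightarrow> real \<Rightarrow> 'w \<Rightarrow> real^'r^'d" where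
  "simple_process N \<tau> \<xi> t \<omega> = (\<Sum>i<N. indicator {\<tau> i<..\<tau> (Suc i)} t *\<^sub>R \<xi> i \<omega>)"

definition simple_integral ::
  "(real \<Rightarrow> 'w \<Rightarrow> real^'r) \<Rightarrow> nat \<Rightarrow> (nat \<Rightarrow> real) \<Rightarrow> (nat \<Rightarrow> 'w \<Rightarrow> real^'r^'d) \<Rightarrow> real \<Rightarrow> 'w \<Rightarrow> real^'d" where
  "simple_integral w N \<tau> \<xi> t \<omega> =
     (\<Sum>i<N. \<xi> i \<omega> *v (w (min t (\<tau> (Suc i))) \<omega> - w (min t (\<tau> i)) \<omega>))"

text \<open>
  \<open>I\<close> is (a continuous version of) the Ito integral process of the progressively measurable
  integrand \<open>H\<close> against \<open>w\<close>: the limit in probability of integrals of simple integrands \<open>H\<^sub>n\<close>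
  such that the integrals of \<open>\<parallel>H - H\<^sub>n\<parallel>\<^sup>2\<close> over \<open>[0, T]\<close> tend to 0 in probability for all \<open>T\<close>.
  The latter is stated with a nonnegative integral, so that non-integrability is not read as 0.
\<close>

definition has_ito_integral ::
  "'w measure \<Rightarrow> (real \<Rightarrow> 'w measure) \<Rightarrow> (real \<Rightarrow> 'w \<Rightarrow> real^'r) \<Rightarrow>
   (real \<Rightarrow> 'w \<Rightarrow> real^'r^'d) \<Rightarrow> (real \<Rightarrow> 'w \<Rightarrow> real^'d) \<Rightarrow> bool" where
  "has_ito_integral M F w H I \<longleftrightarrow>
     (\<forall>T\<ge>0. (\<lambda>(t, \<omega>). H t \<omega>) \<in> borel_measurable (restrict_space borel {0..T} \<Otimes>\<^sub>M F T)) \<and>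
     (\<forall>t\<ge>0. I t \<in> borel_measurable (F t)) \<and>
     (\<forall>\<omega>\<in>space M. continuous_on {0..} (\<lambda>t. I t \<omega>)) \<and>
     (\<exists>N \<tau> \<xi>.
        (\<forall>n::nat. simple_integrand M F (N n) (\<tau> n) (\<xi> n)) \<and>
        (\<forall>T\<ge>0. \<forall>e>0.
           (\<lambda>n. measure M {\<omega> \<in> space M. ennreal e <
              (\<integral>\<^sup>+ s\<in>{0..T}. ennreal ((norm (H s \<omega> - simple_process (N n) (\<tau> n) (\<xi> n) s \<omega>))\<^sup>2) \<partial>lborel)})
           \<longlonglongrightarrow> 0) \<and>
        (\<forall>t\<ge>0. tendsto_in_prob M (\<lambda>n. simple_integral w (N n) (\<tau> n) (\<xi> n) t) (I t) sequentially))"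

text \<open>\<open>X\<close> solves \<open>dX\<^sub>t = b(X\<^sub>t) dt + a(X\<^sub>t) dw\<^sub>t\<close>, \<open>X\<^sub>0 = x0\<close>.\<close>

definition sde_solution ::
  "'w measure \<Rightarrow> (real \<Rightarrow> 'w \<Rightarrow> real^'r) \<Rightarrow> (real^'d \<Rightarrow> real^'d) \<Rightarrow> (real^'d \<Rightarrow> real^'r^'d) \<Rightarrow>
   ('w \<Rightarrow> real^'d) \<Rightarrow> (real \<Rightarrow> 'w \<Rightarrow> real^'d) \<Rightarrow> bool" where
  "sde_solution M w b a x0 X \<longleftrightarrow>
     (\<forall>t\<ge>0. X t \<in> borel_measurable (driving_filtration M x0 w t)) \<and>
     (\<forall>\<omega>\<in>space M. continuous_on {0..} (\<lambda>t. X t \<omega>)) \<and>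
     (\<exists>I. has_ito_integral M (driving_filtration M x0 w) w (\<lambda>t \<omega>. a (X t \<omega>)) I \<and>
        (AE \<omega> in M. \<forall>t\<ge>0. X t \<omega> = x0 \<omega> + (LINT s:{0..t}|lborel. b (X s \<omega>)) + I t \<omega>))"

text \<open>
  Invariant probability measure of the diffusion with coefficients \<open>b\<close>, \<open>a\<close>: with \<open>\<phi> x\<close> the solution
  started at the point \<open>x\<close>, the transition probabilities \<open>P\<^sub>t(x, B) = P(\<phi> x t \<in> B)\<close> satisfy \<open>\<nu> P\<^sub>t = \<nu>\<close>.
\<close>

definition invariant_measure ::
  "'w measure \<Rightarrow> (real \<Rightarrow> 'w \<Rightarrow> real^'r) \<Rightarrow> (real^'d \<Rightarrow> real^'d) \<Rightarrow> (real^'d \<Rightarrow> real^'r^'d) \<Rightarrow>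
   (real^'d) measure \<Rightarrow> bool" where
  "invariant_measure M w b a \<nu> \<longleftrightarrow>
     prob_space \<nu> \<and> sets \<nu> = sets borel \<and>
     (\<exists>\<phi>. (\<forall>x. sde_solution M w b a (\<lambda>_. x) (\<phi> x)) \<and>
        (\<forall>t\<ge>0. \<forall>B\<in>sets borel.
           (\<lambda>x. emeasure M {\<omega> \<in> space M. \<phi> x t \<omega> \<in> B}) \<in> borel_measurable borel \<and>
           (\<integral>\<^sup>+ x. emeasure M {\<omega> \<in> space M. \<phi> x t \<omega> \<in> B} \<partial>\<nu>) = emeasure \<nu> B))"

text \<open>Ergodicity: time averages of bounded Borel functions converge in probability to \<open>\<nu>\<close>-averages.\<close>

definition ergodic_process ::
  "'w measure \<Rightarrow> (real \<Rightarrow> 'w \<Rightarrow> 'b::euclidean_space) \<Rightarrow> 'b measure \<Rightarrow> bool" where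
  "ergodic_process M X \<nu> \<longleftrightarrow>
     (\<forall>g :: 'b \<Rightarrow> real. g \<in> borel_measurable borel \<and> bounded (range g) \<longrightarrow>
        tendsto_in_prob M (\<lambda>T \<omega>. (1 / T) * (LINT t:{0..T}|lborel. g (X t \<omega>)))
          (\<lambda>_. LINT x|\<nu>. g x) at_top)"


section \<open>Noisy observations and the test statistic\<close>

text \<open>The noise is indexed by time; \<open>T\<close> is the set of observation times.\<close>

definition obs_times :: "nat \<Rightarrow> real \<Rightarrow> real set" where
  "obs_times n h = (\<lambda>i. real i * h) ` {0..n}"

definition iid_standardized ::
  "'w measure \<Rightarrow> real set \<Rightarrow> (real \<Rightarrow> 'w \<Rightarrow> real^'d) \<Rightarrow> bool" where
  "iid_standardized M T \<epsilon> \<longleftrightarrow>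
     prob_space.indep_vars M (\<lambda>_. borel) \<epsilon> T \<and>
     (\<forall>s\<in>T. \<forall>t\<in>T. distr M borel (\<epsilon> s) = distr M borel (\<epsilon> t)) \<and>
     (\<forall>t\<in>T. \<forall>i. integrable M (\<lambda>\<omega>. \<epsilon> t \<omega> $ i) \<and> prob_space.expectation M (\<lambda>\<omega>. \<epsilon> t \<omega> $ i) = 0) \<and>
     (\<forall>t\<in>T. \<forall>i j. integrable M (\<lambda>\<omega>. \<epsilon> t \<omega> $ i * \<epsilon> t \<omega> $ j) \<and>
        prob_space.expectation M (\<lambda>\<omega>. \<epsilon> t \<omega> $ i * \<epsilon> t \<omega> $ j) = (if i = j then 1 else 0))"

definition noise_independent ::
  "'w measure \<Rightarrow> real set \<Rightarrow> (real \<Rightarrow> 'w \<Rightarrow> real^'d) \<Rightarrow> ('w \<Rightarrow> real^'d) \<Rightarrow> (real \<Rightarrow> 'w \<Rightarrow> real^'r) \<Rightarrow> bool" where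
  "noise_independent M T \<epsilon> x0 w \<longleftrightarrow>
     prob_space.indep_vars M (\<lambda>_. borel) (\<lambda>(t, l) \<omega>. \<epsilon> t \<omega> $ l) (T \<times> UNIV) \<and>
     prob_space.indep_set M (gen_events M T \<epsilon>)
       (sigma_sets (space M) (gen_events M {()} (\<lambda>_. x0) \<union> gen_events M {0..} w))"

definition observation ::
  "(real \<Rightarrow> 'w \<Rightarrow> real^'d) \<Rightarrow> real^'d^'d \<Rightarrow> (real \<Rightarrow> 'w \<Rightarrow> real^'d) \<Rightarrow> real \<Rightarrow> 'w \<Rightarrow> real^'d" where
  "observation X R \<epsilon> t \<omega> = X t \<omega> + R *v \<epsilon> t \<omega>"

definition comp_sum :: "(real \<Rightarrow> 'w \<Rightarrow> real^'d) \<Rightarrow> 'w \<Rightarrow> real \<Rightarrow> real" where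
  "comp_sum Y \<omega> t = (\<Sum>l\<in>UNIV. Y t \<omega> $ l)"

definition block_mean :: "(real \<Rightarrow> real) \<Rightarrow> nat \<Rightarrow> real \<Rightarrow> nat \<Rightarrow> real" where
  "block_mean S p h j =
     (let \<Delta> = real p * h in (1 / real p) * (\<Sum>i<p. S (real j * \<Delta> + real i * h)))"

definition Z_stat :: "(real \<Rightarrow> real) \<Rightarrow> nat \<Rightarrow> nat \<Rightarrow> real \<Rightarrow> real" where
  "Z_stat S k p h =
     (let n = k * p in
      sqrt (2 * real p / (3 * (\<Sum>j=1..k-2. (block_mean S p h (j + 1) - block_mean S p h j) ^ 4))) *
      ((\<Sum>i<n. (S (real (i + 1) * h) - S (real i * h))\<^sup>2) -
       (\<Sum>i | 2 * i + 2 \<le> n. (S (real (2 * i + 2) * h) - S (real (2 * i) * h))\<^sup>2)))"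

end

theory Submission
  imports Defs
begin

text \<open>
  Put \<open>S = x + e\<close>, where \<open>x = 1 \<bullet> X\<close> and \<open>e = (1 R) \<bullet> \<epsilon>\<close> has variance \<open>v = 1 \<bullet> \<Lambda> 1\<close>, which is positive by (T1) and
  \<open>\<Lambda> \<noteq> 0\<close>. Up to \<open>o(n)\<close> in probability, the difference of the two sums of squares is that of the noise, about
  \<open>2 n v - n v = n v\<close>; for this it suffices that \<open>E(x\<^sub>t - x\<^sub>s)\<^sup>2\<close> is small uniformly in \<open>t - s \<le> 2 h\<close>. Since fourth
  moments are bounded (A3), smallness in probability of the increments is enough, and for the Ito integral it
  follows from Lenglart's truncation argument applied to the approximating simple integrals.

  No sharp estimate of the denominator \<open>V = \<Sum>(\<dots>)\<^sup>4\<close> is needed: its expectation is \<open>O(k)\<close>, so \<open>V \<le> k p\<close> with high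
  probability, which gives \<open>Z \<ge> c p v\<close>. The value of \<open>Z\<close> is \<open>0\<close> when \<open>V = 0\<close>, because of
  division by zero; but then all block means coincide, an event of probability at most \<open>q ^ (k - 2)\<close>, where \<open>q < 1\<close>
  bounds the atoms of \<open>e\<close>.
\<close>

section \<open>Independence and the driving filtration\<close>

text \<open>The Ito integral is available only as a limit in probability of simple integrals, so the
  isometry does not pass to it. What survives the limit is a tail inequality: it makes the
  increments of \<open>X\<close> small in probability, uniformly in time because the moments of
  \<open>X\<close> are bounded uniformly in time, and bounded fourth moments upgrade this to mean
  square. The level \<open>k p\<close> for \<open>V\<close> lies a factor of order \<open>p\<close>
  above the bound for its mean, so Markov's inequality costs only a multiple of
  \<open>1 / p\<close>. On this event the prefactor of the statistic is at least
  \<open>sqrt (2 / (3 k))\<close>, and a numerator of at least \<open>n v / 2\<close> gives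
  \<open>Z \<ge> sqrt (k / 6) p v\<close>. Independence of signal and noise enters only in the
  estimate of the event \<open>V = 0\<close>: there a noise value must be independent of all other
  noise values together with the whole augmented filtration. Besides the increments of
  \<open>w\<close>, this is what the enlargement of independent families of events serves.\<close>

lemma (in prob_space) indep_set_sigma_generator:
  assumes A: "A \<subseteq> events" and B: "B \<subseteq> events" "Int_stable B" "space M \<in> B"
    and C: "C \<subseteq> events" "Int_stable C" "space M \<in> C"
    and prod: "\<And>x y z. x \<in> A \<Longrightarrow> y \<in> B \<Longrightarrow> z \<in> C \<Longrightarrow> prob (x \<inter> (y \<inter> z)) = prob x * prob (y \<inter> z)"
  shows "indep_set A (sigma_sets (space M) (B \<union> C))"
proof -
  \<comment> \<open>\<open>B \<union> C\<close> need not be closed under intersections. The sets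
    \<open>y \<inter> z\<close> form a pi-system which, as both classes contain the whole space,
    generates the same sigma-algebra.\<close>
  define E where "E = {y \<inter> z | y z. y \<in> B \<and> z \<in> C}"
  have E_ev: "E \<subseteq> events" using B C by (auto simp: E_def)
  have E_stable: "Int_stable E"
  proof (rule Int_stableI)
    fix s t assume "s \<in> E" "t \<in> E"
    then obtain y z y' z' where *: "y \<in> B" "z \<in> C" "s = y \<inter> z" "y' \<in> B" "z' \<in> C" "t = y' \<inter> z'"
      by (auto simp: E_def)
    have "s \<inter> t = (y \<inter> y') \<inter> (z \<inter> z')" using * by auto
    moreover have "y \<inter> y' \<in> B" "z \<inter> z' \<in> C"
      using * B C by (auto simp: Int_stable_def)
    ultimately show "s \<inter> t \<in> E" unfolding E_def by blast
  qed
  have sub: "sigma_sets (space M) (B \<union> C) \<subseteq> sigma_sets (space M) E"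
  proof (rule sigma_sets_mono, safe)
    fix y assume "y \<in> B"
    then have "y = y \<inter> space M" using B(1) sets.sets_into_space by blast
    with \<open>y \<in> B\<close> C(3) have "y \<in> E" by (auto simp: E_def)
    then show "y \<in> sigma_sets (space M) E" by auto
  next
    fix z assume "z \<in> C"
    then have "z = space M \<inter> z" using C(1) sets.sets_into_space by blast
    with \<open>z \<in> C\<close> B(3) have "z \<in> E" unfolding E_def by blast
    then show "z \<in> sigma_sets (space M) E" by auto
  qed
  have ev: "sigma_sets (space M) (B \<union> C) \<subseteq> events"
    using B C by (intro sets.sigma_sets_subset) auto
  show ?thesis
  proof (rule indep_setI[OF A ev])
    fix x s assume x: "x \<in> A" and s: "s \<in> sigma_sets (space M) (B \<union> C)"
    \<comment> \<open>\<open>A\<close> is not assumed to be closed under intersections, so each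
      \<open>x\<close> is treated alone: a singleton is trivially a pi-system.\<close>
    have "indep_set {x} E"
      using A x E_ev prod by (intro indep_setI) (auto simp: E_def)
    then have "indep_set (sigma_sets (space M) {x}) (sigma_sets (space M) E)"
      by (rule indep_set_sigma_sets) (auto simp: Int_stable_def E_stable[unfolded Int_stable_def])
    moreover have "x \<in> sigma_sets (space M) {x}" by auto
    ultimately show "prob (x \<inter> s) = prob x * prob s"
      using s sub by (auto dest: indep_setD)
  qed
qed

text \<open>A chain rule: the two hypotheses factor \<open>P(x \<inter> y \<inter> z)\<close>
  completely, and regrouping the last two factors gives independence of \<open>x\<close> from
  \<open>y \<inter> z\<close>. It lets the family that \<open>A\<close> is independent of grow step
  by step.\<close>

lemma (in prob_space) indep_set_adjoin:
  assumes AB: "indep_set A B" and ABC: "indep_set (sigma_sets (space M) (A \<union> B)) C"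
    and B: "Int_stable B" "space M \<in> B" and C: "Int_stable C" "space M \<in> C"
  shows "indep_set A (sigma_sets (space M) (B \<union> C))"
proof (rule indep_set_sigma_generator)
  show "A \<subseteq> events" "B \<subseteq> events" "C \<subseteq> events"
    using indep_setD_ev1[OF AB] indep_setD_ev2[OF AB] indep_setD_ev2[OF ABC] by auto
  fix x y z assume x: "x \<in> A" and y: "y \<in> B" and z: "z \<in> C"
  interpret S: sigma_algebra "space M" "sigma_sets (space M) (A \<union> B)"
    using indep_setD_ev1[OF AB] indep_setD_ev2[OF AB] sets.space_closed
    by (intro sigma_algebra_sigma_sets) blast
  have xS: "x \<in> sigma_sets (space M) (A \<union> B)" and yS: "y \<in> sigma_sets (space M) (A \<union> B)"
    using x y by auto
  have "prob (x \<inter> (y \<inter> z)) = prob ((x \<inter> y) \<inter> z)" by (simp add: Int_assoc)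
  also have "\<dots> = prob (x \<inter> y) * prob z"
    using S.Int[OF xS yS] z ABC by (intro indep_setD) auto
  also have "\<dots> = prob x * (prob y * prob z)" using indep_setD[OF AB x y] by simp
  also have "prob y * prob z = prob (y \<inter> z)" using indep_setD[OF ABC yS z] by simp
  finally show "prob (x \<inter> (y \<inter> z)) = prob x * prob (y \<inter> z)" .
qed (use assms in auto)

lemma (in prob_space) indep_set_mono:
  assumes "indep_set A B" "A' \<subseteq> A" "B' \<subseteq> B"
  shows "indep_set A' B'"
  using assms indep_setD_ev1[OF assms(1)] indep_setD_ev2[OF assms(1)] indep_setD[OF assms(1)]
  by (intro indep_setI) blast+

lemma (in prob_space) indep_set_commute: "indep_set A B \<Longrightarrow> indep_set B A"
  using indep_setD_ev1[of A B] indep_setD_ev2[of A B] indep_setD[of A B]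
  by (intro indep_setI) (assumption | metis Int_commute mult.commute)+

lemma (in prob_space) indep_set_null_sets:
  assumes "A \<subseteq> events" shows "indep_set A (insert (space M) (null_sets M))"
proof (rule indep_setI[OF assms])
  fix a b assume a: "a \<in> A" and b: "b \<in> insert (space M) (null_sets M)"
  have a': "a \<in> events" using a assms by auto
  show "prob (a \<inter> b) = prob a * prob b"
  proof (cases "b = space M")
    case True then show ?thesis using a' sets.sets_into_space by (simp add: prob_space Int_absorb2)
  next
    case False
    then have b0: "b \<in> null_sets M" using b by auto
    then have "a \<inter> b \<in> null_sets M" using a' by (intro null_set_Int1)
    then show ?thesis using b0 by (simp add: measure_eq_0_null_sets)
  qed
qed auto

text \<open>The driving filtration is augmented by null sets, so independence has to survive the
  augmentation. Adding the whole space to the null sets yields a pi-system to which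
  \<open>indep_set_adjoin\<close> applies.\<close>

lemma (in prob_space) indep_set_adjoin_null_sets:
  assumes AB: "indep_set A B" and B: "Int_stable B" "space M \<in> B"
  shows "indep_set A (sigma_sets (space M) (B \<union> null_sets M))"
proof -
  have "indep_set A (sigma_sets (space M) (B \<union> insert (space M) (null_sets M)))"
  proof (rule indep_set_adjoin[OF AB])
    show "indep_set (sigma_sets (space M) (A \<union> B)) (insert (space M) (null_sets M))"
      using indep_setD_ev1[OF AB] indep_setD_ev2[OF AB]
      by (intro indep_set_null_sets sets.sigma_sets_subset) auto
    show "Int_stable (insert (space M) (null_sets M))"
    proof (rule Int_stableI)
      fix a b assume *: "a \<in> insert (space M) (null_sets M)" "b \<in> insert (space M) (null_sets M)"
      have "a \<in> events" "b \<in> events" using * by auto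
      then show "a \<inter> b \<in> insert (space M) (null_sets M)"
        using * sets.sets_into_space by (auto simp: Int_absorb1 Int_absorb2)
    qed
  qed (use B in auto)
  then show ?thesis
    by (rule indep_set_mono) (auto intro!: sigma_sets_mono' )
qed

section \<open>Generated sigma-algebras and the augmented driving filtration\<close>

lemma sigma_algebra_gen_events: "sigma_algebra (space M) (gen_events M I Z)"
  unfolding gen_events_def by (intro sigma_algebra_sigma_sets) auto

lemma Int_stable_gen_events: "Int_stable (gen_events M I Z)"
proof -
  interpret sigma_algebra "space M" "gen_events M I Z" by (rule sigma_algebra_gen_events)
  show ?thesis by (auto simp: Int_stable_def)
qed

lemma space_in_gen_events: "space M \<in> gen_events M I Z"
  using sigma_algebra.sigma_sets_eq[OF sigma_algebra_gen_events]
  by (auto simp: gen_events_def intro: sigma_sets_top)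

lemma gen_events_subset:
  assumes "\<And>i. i \<in> I \<Longrightarrow> Z i \<in> borel_measurable M" shows "gen_events M I Z \<subseteq> sets M"
  unfolding gen_events_def by (intro sets.sigma_sets_subset) (use assms in \<open>auto intro: measurable_sets\<close>)

lemma gen_events_mono: "I \<subseteq> J \<Longrightarrow> gen_events M I Z \<subseteq> gen_events M J Z"
  unfolding gen_events_def by (intro sigma_sets_mono') blast

lemma borel_measurable_gen_events:
  assumes "i \<in> I" "gen_events M I Z \<subseteq> sets G" "space G = space M"
  shows "Z i \<in> borel_measurable G"
proof (rule measurableI)
  fix A assume "A \<in> sets (borel :: 'c measure)"
  then have "Z i -` A \<inter> space M \<in> gen_events M I Z"
    unfolding gen_events_def using assms(1) by blast
  then show "Z i -` A \<inter> space G \<in> sets G" using assms by auto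
qed auto

lemma gen_events_subset_sets:
  assumes "\<And>i. i \<in> I \<Longrightarrow> Z i \<in> borel_measurable G" "space G = space M"
  shows "gen_events M I Z \<subseteq> sets G"
proof -
  have "gen_events M I Z = gen_events G I Z" by (simp add: gen_events_def assms(2))
  then show ?thesis using gen_events_subset[of I Z G] assms by auto
qed

lemma sets_driving_filtration:
  assumes "x0 \<in> borel_measurable M" "\<forall>s\<ge>0. w s \<in> borel_measurable M"
  shows "sets (driving_filtration M x0 w t) =
    sigma_sets (space M) (null_sets M \<union> gen_events M {()} (\<lambda>_. x0) \<union> gen_events M {0..t} w)"
proof -
  have "null_sets M \<union> gen_events M {()} (\<lambda>_. x0) \<union> gen_events M {0..t} w \<subseteq> sets M"
    using assms gen_events_subset[of "{()}" "\<lambda>_. x0" M] gen_events_subset[of "{0..t}" w M] by auto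
  also have "\<dots> \<subseteq> Pow (space M)" by (rule sets.space_closed)
  finally show ?thesis unfolding driving_filtration_def by (rule sets_measure_of)
qed

lemma space_driving_filtration [simp]: "space (driving_filtration M x0 w t) = space M"
  unfolding driving_filtration_def by (rule space_measure_of_conv)

lemma driving_filtration_subset:
  assumes "x0 \<in> borel_measurable M" "\<forall>s\<ge>0. w s \<in> borel_measurable M"
  shows "sets (driving_filtration M x0 w t) \<subseteq> sets M"
proof -
  have "null_sets M \<union> gen_events M {()} (\<lambda>_. x0) \<union> gen_events M {0..t} w \<subseteq> sets M"
    using assms gen_events_subset[of "{()}" "\<lambda>_. x0" M] gen_events_subset[of "{0..t}" w M] by auto
  then show ?thesis
    unfolding sets_driving_filtration[OF assms] by (rule sets.sigma_sets_subset)
qed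

lemma driving_filtration_mono:
  assumes "x0 \<in> borel_measurable M" "\<forall>s\<ge>0. w s \<in> borel_measurable M" "s \<le> t"
  shows "sets (driving_filtration M x0 w s) \<subseteq> sets (driving_filtration M x0 w t)"
  using gen_events_mono[of "{0..s}" "{0..t}" M w] assms(3)
  by (simp add: sets_driving_filtration[OF assms(1,2)]) (intro sigma_sets_mono', auto)

text \<open>The right-hand side is free of \<open>t\<close> and has the form that occurs in
  \<open>noise_value_indep\<close>: the sigma-algebra of \<open>x0\<close> and \<open>w\<close>
  joined with the null sets.\<close>

lemma driving_filtration_subset_all:
  assumes "x0 \<in> borel_measurable M" "\<forall>s\<ge>0. w s \<in> borel_measurable M"
  shows "sets (driving_filtration M x0 w t) \<subseteq>
    sigma_sets (space M) (sigma_sets (space M) (gen_events M {()} (\<lambda>_. x0) \<union> gen_events M {0..} w) \<union> null_sets M)"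
proof -
  have "null_sets M \<union> gen_events M {()} (\<lambda>_. x0) \<union> gen_events M {0..t} w \<subseteq>
    sigma_sets (space M) (sigma_sets (space M) (gen_events M {()} (\<lambda>_. x0) \<union> gen_events M {0..} w) \<union> null_sets M)"
    using gen_events_mono[of "{0..t}" "{0..}" M w] by auto
  then show ?thesis
    unfolding sets_driving_filtration[OF assms] by (rule sigma_sets_mono)
qed

lemma wiener_borel_measurable: "wiener_process M w \<Longrightarrow> 0 \<le> t \<Longrightarrow> w t \<in> borel_measurable M"
  by (auto simp: wiener_process_def)

text \<open>By definition an increment of a Wiener process is independent only of the past of
  \<open>w\<close>. The increment and that past both lie in the sigma-algebra of \<open>w\<close>,
  which is independent of \<open>x0\<close>, so \<open>x0\<close> can be adjoined to the past, and
  then the null sets.\<close>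

lemma (in prob_space) wiener_increment_indep:
  assumes w: "wiener_process M w" and x0: "x0 \<in> borel_measurable M"
    and ind: "indep_set (gen_events M {()} (\<lambda>_. x0)) (gen_events M {0..} w)"
    and st: "0 \<le> s" "s < t"
  shows "indep_set (gen_events M {()} (\<lambda>_ \<omega>. w t \<omega> - w s \<omega>)) (sets (driving_filtration M x0 w s))"
proof -
  let ?A = "gen_events M {()} (\<lambda>_ \<omega>. w t \<omega> - w s \<omega>)"
  let ?B = "gen_events M {0..s} w" and ?C = "gen_events M {()} (\<lambda>_. x0)"
  let ?W = "gen_events M {0..} w"
  have wm: "\<forall>u\<ge>0. w u \<in> borel_measurable M" using wiener_borel_measurable[OF w] by blast
  have "indep_set ?B ?A" using w st unfolding wiener_process_def by blast
  then have AB: "indep_set ?A ?B" by (rule indep_set_commute)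
  have W: "?W \<subseteq> events" using gen_events_subset[of "{0..}" w M] wm by auto
  \<comment> \<open>A measure space whose measurable sets are exactly \<open>?W\<close>, so that the
    closure properties of measurable functions show that the increment generates a subset of
    \<open>?W\<close>.\<close>
  let ?G = "sigma (space M) ?W"
  have "sets ?G = sigma_sets (space M) ?W"
    using W sets.space_closed by (intro sets_measure_of) blast
  then have G: "sets ?G = ?W" "space ?G = space M"
    by (simp_all add: sigma_algebra.sigma_sets_eq[OF sigma_algebra_gen_events] space_measure_of_conv)
  have wG: "w u \<in> borel_measurable ?G" if "0 \<le> u" for u
    by (rule borel_measurable_gen_events[where I="{0..}"]) (use that G in auto)
  have "?A \<subseteq> ?W"
    using gen_events_subset_sets[of "{()}" "\<lambda>_ \<omega>. w t \<omega> - w s \<omega>" ?G M] wG st G by auto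
  moreover have "?B \<subseteq> ?W" using st by (intro gen_events_mono) auto
  ultimately have "sigma_sets (space M) (?A \<union> ?B) \<subseteq> ?W"
    by (intro sigma_algebra.sigma_sets_subset[OF sigma_algebra_gen_events]) auto
  then have "indep_set (sigma_sets (space M) (?A \<union> ?B)) ?C"
    by (rule indep_set_mono[OF indep_set_commute[OF ind]]) auto
  then have "indep_set ?A (sigma_sets (space M) (?B \<union> ?C))"
    by (intro indep_set_adjoin AB Int_stable_gen_events space_in_gen_events)
  then have "indep_set ?A (sigma_sets (space M) (sigma_sets (space M) (?B \<union> ?C) \<union> null_sets M))"
  proof (rule indep_set_adjoin_null_sets)
    have "?B \<union> ?C \<subseteq> Pow (space M)"
      using indep_setD_ev2[OF AB] indep_setD_ev1[OF ind] sets.space_closed[of M] by blast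
    then interpret sigma_algebra "space M" "sigma_sets (space M) (?B \<union> ?C)"
      by (rule sigma_algebra_sigma_sets)
    show "Int_stable (sigma_sets (space M) (?B \<union> ?C))" by (auto simp: Int_stable_def)
  qed (auto intro: sigma_sets_top)
  then show ?thesis
    by (rule indep_set_mono)
       (auto simp: sets_driving_filtration[OF x0 wm] intro!: sigma_sets_mono)
qed

text \<open>One noise variable is separated from everything else: in the application
  \<open>D\<close> is the sigma-algebra of \<open>x0\<close> and \<open>w\<close>, to which the null
  sets and the other noise variables are adjoined.\<close>

lemma (in prob_space) noise_value_indep:
  fixes \<epsilon> :: "real \<Rightarrow> 'a \<Rightarrow> 'b::topological_space"
  assumes iv: "indep_vars (\<lambda>_. borel) \<epsilon> T" and t0: "t0 \<in> T"
    and ind: "indep_set (gen_events M T \<epsilon>) D"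
    and D: "sigma_algebra (space M) D"
  shows "indep_set (gen_events M {t0} \<epsilon>)
    (sigma_sets (space M) (gen_events M (T - {t0}) \<epsilon> \<union> sigma_sets (space M) (D \<union> null_sets M)))"
proof (rule indep_set_adjoin)
  \<comment> \<open>The index set is split into the groups \<open>{t0}\<close> and
    \<open>T - {t0}\<close>, encoded by \<open>case_bool\<close>; grouping an independent family
    keeps the generated sigma-algebras independent.\<close>
  have "indep_sets (\<lambda>i. {\<epsilon> i -` A \<inter> space M |A. A \<in> sets borel}) (\<Union>j\<in>UNIV. case_bool {t0} (T - {t0}) j)"
    using iv t0 unfolding indep_vars_def2 by (auto simp: UNIV_bool insert_absorb)
  then have "indep_sets (\<lambda>j. sigma_sets (space M)
     (\<Union>i\<in>case_bool {t0} (T - {t0}) j. {\<epsilon> i -` A \<inter> space M |A. A \<in> sets borel})) UNIV"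
  proof (rule indep_sets_collect_sigma)
    show "Int_stable {\<epsilon> i -` A \<inter> space M |A. A \<in> sets borel}" for i
    proof (rule Int_stableI, safe)
      fix A B :: "'b set" assume "A \<in> sets borel" "B \<in> sets borel"
      then show "\<exists>C. \<epsilon> i -` A \<inter> space M \<inter> (\<epsilon> i -` B \<inter> space M) = \<epsilon> i -` C \<inter> space M \<and> C \<in> sets borel"
        by (intro exI[of _ "A \<inter> B"]) auto
    qed
  qed (auto simp: disjoint_family_on_def split: bool.splits)
  moreover have "(\<Union>i\<in>J. {\<epsilon> i -` A \<inter> space M |A. A \<in> sets borel}) = {\<epsilon> i -` B \<inter> space M |i B. i \<in> J \<and> B \<in> sets borel}"
    for J by blast
  ultimately have "indep_sets (\<lambda>j. gen_events M (case_bool {t0} (T - {t0}) j) \<epsilon>) UNIV"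
    by (simp add: gen_events_def)
  moreover have "(\<lambda>j. gen_events M (case_bool {t0} (T - {t0}) j) \<epsilon>) =
      case_bool (gen_events M {t0} \<epsilon>) (gen_events M (T - {t0}) \<epsilon>)"
    by (rule ext) (simp split: bool.split)
  ultimately show "indep_set (gen_events M {t0} \<epsilon>) (gen_events M (T - {t0}) \<epsilon>)"
    unfolding indep_set_def by simp
  have "indep_set (gen_events M T \<epsilon>) (sigma_sets (space M) (D \<union> null_sets M))"
  proof (rule indep_set_adjoin_null_sets[OF ind])
    interpret sigma_algebra "space M" D by fact
    show "Int_stable D" "space M \<in> D" by (auto simp: Int_stable_def)
  qed
  then show "indep_set (sigma_sets (space M) (gen_events M {t0} \<epsilon> \<union> gen_events M (T - {t0}) \<epsilon>))
     (sigma_sets (space M) (D \<union> null_sets M))"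
  proof (rule indep_set_mono)
    show "sigma_sets (space M) (gen_events M {t0} \<epsilon> \<union> gen_events M (T - {t0}) \<epsilon>) \<subseteq> gen_events M T \<epsilon>"
      using gen_events_mono[of "{t0}" T M \<epsilon>] gen_events_mono[of "T - {t0}" T M \<epsilon>] t0
      by (intro sigma_algebra.sigma_sets_subset[OF sigma_algebra_gen_events]) auto
  qed auto
  have "D \<union> null_sets M \<subseteq> Pow (space M)"
    using indep_setD_ev2[OF ind] sets.space_closed[of M] by auto
  then interpret sigma_algebra "space M" "sigma_sets (space M) (D \<union> null_sets M)"
    by (rule sigma_algebra_sigma_sets)
  show "Int_stable (sigma_sets (space M) (D \<union> null_sets M))" "space M \<in> sigma_sets (space M) (D \<union> null_sets M)"
    by (auto simp: Int_stable_def)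
qed (rule Int_stable_gen_events space_in_gen_events)+

section \<open>Square integrability of discrete stochastic integrals\<close>

lemma borel_measurable_vec_component [measurable (raw)]:
  fixes f :: "'a \<Rightarrow> real^'n"
  shows "f \<in> borel_measurable M \<Longrightarrow> (\<lambda>s. f s $ j) \<in> borel_measurable M"
  by (rule measurable_compose[OF _ borel_measurable_continuous_onI]) (auto intro: continuous_intros)

text \<open>Passes from independence of event families to \<open>indep_var\<close>, for which
  product formulas are available. The function \<open>f\<close> brings \<open>D\<close> to the type
  of \<open>U\<close>, since \<open>indep_var\<close> asks both variables to take values in one
  type.\<close>

lemma (in prob_space) indep_var_of_indep_set:
  fixes D :: "'a \<Rightarrow> 'b::topological_space" and f :: "'b \<Rightarrow> 'c::topological_space" and U :: "'a \<Rightarrow> 'c"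
  assumes ind: "indep_set (gen_events M {()} (\<lambda>_. D)) (sets G)"
    and D: "D \<in> borel_measurable M" and f: "f \<in> borel_measurable borel"
    and U: "U \<in> borel_measurable G" and G: "space G = space M"
  shows "indep_var borel (\<lambda>s. f (D s)) borel U"
proof -
  have G_ev: "sets G \<subseteq> events" using indep_setD_ev2[OF ind] .
  have U': "U \<in> borel_measurable M"
    using measurable_mono[of borel borel G M] U G_ev G by auto
  have 1: "sigma_sets (space M) {(\<lambda>s. f (D s)) -` A \<inter> space M |A. A \<in> sets borel} \<subseteq>
      gen_events M {()} (\<lambda>_. D)"
    unfolding gen_events_def
  proof (intro sigma_sets_mono', safe)
    fix A :: "'c set" assume "A \<in> sets borel"
    then have "f -` A \<in> sets borel" using f by (auto dest: measurable_sets)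
    moreover have "(\<lambda>s. f (D s)) -` A = D -` (f -` A)" by auto
    ultimately show "\<exists>i B. (\<lambda>s. f (D s)) -` A \<inter> space M = D -` B \<inter> space M \<and> i \<in> {()} \<and> B \<in> sets borel"
      by auto
  qed
  have 2: "sigma_sets (space M) {U -` A \<inter> space M |A. A \<in> sets borel} \<subseteq> sets G"
    using U G measurable_sets[OF U] by (intro sets.sigma_sets_subset[of _ G, unfolded G]) auto
  show ?thesis
    unfolding indep_var_eq using indep_set_mono[OF ind 1 2] measurable_compose[OF D f] U' by auto
qed

lemma (in prob_space) expectation_indep_product:
  fixes f :: "'b::topological_space \<Rightarrow> real" and U :: "'a \<Rightarrow> real"
  assumes ind: "indep_set (gen_events M {()} (\<lambda>_. D)) (sets G)"
    and D: "D \<in> borel_measurable M" and f: "f \<in> borel_measurable borel" "integrable M (\<lambda>s. f (D s))"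
    and U: "U \<in> borel_measurable G" "integrable M U" and G: "space G = space M"
  shows "integrable M (\<lambda>s. U s * f (D s))"
    and "expectation (\<lambda>s. U s * f (D s)) = expectation U * expectation (\<lambda>s. f (D s))"
  using indep_var_integrable[OF indep_var_of_indep_set[OF ind D f(1) U(1) G] f(2) U(2)]
    indep_var_lebesgue_integral[OF indep_var_of_indep_set[OF ind D f(1) U(1) G] f(2) U(2)]
  by (simp_all add: mult.commute)

text \<open>The Ito isometry in discrete time.\<close>

lemma (in prob_space) martingale_transform_L2:
  fixes D \<eta> :: "nat \<Rightarrow> 'a \<Rightarrow> real^'r" and G :: "nat \<Rightarrow> 'a measure"
  assumes G: "\<And>i. space (G i) = space M" "\<And>i. sets (G i) \<subseteq> events"
      "\<And>i. i < N \<Longrightarrow> sets (G i) \<subseteq> sets (G (Suc i))"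
    and \<eta>: "\<And>i. i < N \<Longrightarrow> \<eta> i \<in> borel_measurable (G i)"
      "\<And>i. i < N \<Longrightarrow> \<exists>C. \<forall>s\<in>space M. norm (\<eta> i s) \<le> C"
    and D: "\<And>i. i < N \<Longrightarrow> D i \<in> borel_measurable (G (Suc i))"
    and ind: "\<And>i. i < N \<Longrightarrow> indep_set (gen_events M {()} (\<lambda>_. D i)) (sets (G i))"
    and mean: "\<And>i j. i < N \<Longrightarrow> integrable M (\<lambda>s. D i s $ j)"
      "\<And>i j. i < N \<Longrightarrow> expectation (\<lambda>s. D i s $ j) = 0"
    and cov: "\<And>i j l. i < N \<Longrightarrow> integrable M (\<lambda>s. D i s $ j * D i s $ l)"
      "\<And>i j l. i < N \<Longrightarrow> expectation (\<lambda>s. D i s $ j * D i s $ l) = (if j = l then len i else 0)"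
  shows "(\<lambda>s. \<Sum>i<N. \<eta> i s \<bullet> D i s) \<in> borel_measurable (G N) \<and>
    integrable M (\<lambda>s. (\<Sum>i<N. \<eta> i s \<bullet> D i s)^2) \<and>
    expectation (\<lambda>s. (\<Sum>i<N. \<eta> i s \<bullet> D i s)^2) = (\<Sum>i<N. len i * expectation (\<lambda>s. (norm (\<eta> i s))^2))"
  using assms
proof (induction N)
  case 0
  then show ?case by simp
next
  case (Suc N)
  define J where "J s = (\<Sum>i<N. \<eta> i s \<bullet> D i s)" for s
  have GM: "f \<in> borel_measurable (G i) \<Longrightarrow> f \<in> borel_measurable M" for i and f :: "'a \<Rightarrow> 'x::topological_space"
    using measurable_mono[of borel borel "G i" M] Suc.prems(1,2) by auto
  have GS: "f \<in> borel_measurable (G N) \<Longrightarrow> f \<in> borel_measurable (G (Suc N))" for f :: "'a \<Rightarrow> 'x::topological_space"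
    using measurable_mono[of borel borel "G N" "G (Suc N)"] Suc.prems(1) Suc.prems(3)[of N] by auto
  have IH: "J \<in> borel_measurable (G N)" "integrable M (\<lambda>s. (J s)^2)"
     "expectation (\<lambda>s. (J s)^2) = (\<Sum>i<N. len i * expectation (\<lambda>s. (norm (\<eta> i s))^2))"
    using Suc.IH Suc.prems unfolding J_def by (simp_all add: less_SucI)
  have DM: "D N \<in> borel_measurable M" using GM Suc.prems(6)[of N] by blast
  obtain C where C: "\<And>s. s \<in> space M \<Longrightarrow> norm (\<eta> N s) \<le> C" using Suc.prems(5)[of N] by auto
  have C0: "0 \<le> C"
    using C not_empty norm_ge_zero by (meson ex_in_conv order_trans)
  have \<eta>C: "\<bar>\<eta> N s $ j\<bar> \<le> C" if "s \<in> space M" for s j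
    using C[OF that] component_le_norm_cart[of "\<eta> N s" j] by linarith
  have \<eta>G: "(\<lambda>s. \<eta> N s $ j) \<in> borel_measurable (G N)" for j
    using Suc.prems(4)[of N] by measurable
  have JM: "J \<in> borel_measurable M" "(\<lambda>s. \<eta> N s $ j) \<in> borel_measurable M" for j
    using GM IH(1) \<eta>G by blast+
  have ind: "indep_set (gen_events M {()} (\<lambda>_. D N)) (sets (G N))" using Suc.prems(7) by simp
  have Jint: "integrable M J"
    using square_integrable_imp_integrable[OF JM(1) IH(2)] .
  have J\<eta>: "integrable M (\<lambda>s. J s * \<eta> N s $ j)" for j
  proof (rule Bochner_Integration.integrable_bound[of M "\<lambda>s. C * J s"])
    show "AE s in M. norm (J s * \<eta> N s $ j) \<le> norm (C * J s)"
      using \<eta>C C0 by (intro AE_I2) (simp add: abs_mult mult.commute[of "\<bar>J _\<bar>"] mult_right_mono)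
  qed (use Jint JM in auto)
  have \<eta>\<eta>: "integrable M (\<lambda>s. \<eta> N s $ j * \<eta> N s $ l)" for j l
  proof (rule integrable_const_bound[of _ "C * C"])
    show "AE s in M. norm (\<eta> N s $ j * \<eta> N s $ l) \<le> C * C"
      using \<eta>C C0 by (intro AE_I2) (simp add: abs_mult mult_mono)
  qed (use JM in auto)
  \<comment> \<open>All factors except \<open>D N\<close> are known at stage \<open>N\<close>, and
    \<open>D N\<close> is independent of that stage with mean zero, so the mixed term
    vanishes.\<close>
  have cross: "integrable M (\<lambda>s. J s * (\<eta> N s \<bullet> D N s))" "expectation (\<lambda>s. J s * (\<eta> N s \<bullet> D N s)) = 0"
  proof -
    have eq: "J s * (\<eta> N s \<bullet> D N s) = (\<Sum>j\<in>UNIV. (J s * \<eta> N s $ j) * D N s $ j)" for s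
      by (simp add: inner_vec_def sum_distrib_left mult.assoc)
    have U: "(\<lambda>s. J s * \<eta> N s $ j) \<in> borel_measurable (G N)" for j using IH(1) \<eta>G by measurable
    have p: "integrable M (\<lambda>s. (J s * \<eta> N s $ j) * D N s $ j)"
       "expectation (\<lambda>s. (J s * \<eta> N s $ j) * D N s $ j) = 0" for j
      using expectation_indep_product[OF ind DM _ _ U J\<eta>, of "\<lambda>v. v $ j" j] Suc.prems(1) Suc.prems(8,9)[of N j]
      by auto
    show "integrable M (\<lambda>s. J s * (\<eta> N s \<bullet> D N s))" unfolding eq using p by auto
    show "expectation (\<lambda>s. J s * (\<eta> N s \<bullet> D N s)) = 0" unfolding eq using p by simp
  qed
  have diag: "integrable M (\<lambda>s. (\<eta> N s \<bullet> D N s)^2)"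
     "expectation (\<lambda>s. (\<eta> N s \<bullet> D N s)^2) = len N * expectation (\<lambda>s. (norm (\<eta> N s))^2)"
  proof -
    have eq: "(\<eta> N s \<bullet> D N s)^2 = (\<Sum>j\<in>UNIV. \<Sum>l\<in>UNIV. (\<eta> N s $ j * \<eta> N s $ l) * (D N s $ j * D N s $ l))" for s
      by (simp add: inner_vec_def power2_eq_square sum_product algebra_simps)
    have U: "(\<lambda>s. \<eta> N s $ j * \<eta> N s $ l) \<in> borel_measurable (G N)" for j l using \<eta>G by measurable
    have p: "integrable M (\<lambda>s. (\<eta> N s $ j * \<eta> N s $ l) * (D N s $ j * D N s $ l))"
       "expectation (\<lambda>s. (\<eta> N s $ j * \<eta> N s $ l) * (D N s $ j * D N s $ l)) =
         expectation (\<lambda>s. \<eta> N s $ j * \<eta> N s $ l) * (if j = l then len N else 0)" for j l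
      using expectation_indep_product[OF ind DM _ _ U \<eta>\<eta>, of "\<lambda>v. v $ j * v $ l" j l] Suc.prems(1)
        Suc.prems(10,11)[of N j l] by auto
    show "integrable M (\<lambda>s. (\<eta> N s \<bullet> D N s)^2)" unfolding eq using p by auto
    have "expectation (\<lambda>s. (\<eta> N s \<bullet> D N s)^2) =
       (\<Sum>j\<in>UNIV. \<Sum>l\<in>UNIV. expectation (\<lambda>s. \<eta> N s $ j * \<eta> N s $ l) * (if j = l then len N else 0))"
      unfolding eq using p by (simp add: Bochner_Integration.integral_sum)
    also have "\<dots> = (\<Sum>j\<in>UNIV. expectation (\<lambda>s. \<eta> N s $ j * \<eta> N s $ j)) * len N"
      by (simp add: if_distrib sum.delta sum_distrib_right cong: if_cong)
    also have "(\<Sum>j\<in>UNIV. expectation (\<lambda>s. \<eta> N s $ j * \<eta> N s $ j)) = expectation (\<lambda>s. (norm (\<eta> N s))^2)"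
      using \<eta>\<eta> by (simp add: power2_norm_eq_inner inner_vec_def Bochner_Integration.integral_sum)
    finally show "expectation (\<lambda>s. (\<eta> N s \<bullet> D N s)^2) = len N * expectation (\<lambda>s. (norm (\<eta> N s))^2)"
      by simp
  qed
  have S: "(\<Sum>i<Suc N. \<eta> i s \<bullet> D i s) = J s + \<eta> N s \<bullet> D N s" for s by (simp add: J_def)
  have S2: "(J s + \<eta> N s \<bullet> D N s)^2 = (J s)^2 + 2 * (J s * (\<eta> N s \<bullet> D N s)) + (\<eta> N s \<bullet> D N s)^2" for s
    by (simp add: power2_sum algebra_simps)
  have "(\<lambda>s. J s + \<eta> N s \<bullet> D N s) \<in> borel_measurable (G (Suc N))"
    using GS[OF IH(1)] GS[OF Suc.prems(4)[OF lessI]] Suc.prems(6)[OF lessI] by measurable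
  then show ?case
    unfolding S unfolding S2 using IH cross diag by simp
qed

text \<open>Partial sums of nonnegative terms increase, so the retained terms form an initial
  segment up to zero terms, and their total is a partial sum that is at most
  \<open>K\<close>.\<close>

lemma sum_truncated_le:
  fixes a :: "nat \<Rightarrow> real"
  assumes "\<And>i. i < N \<Longrightarrow> 0 \<le> a i" "0 \<le> K"
  shows "(\<Sum>i<N. if (\<Sum>l\<le>i. a l) \<le> K then a i else 0) \<le> K"
  using assms
proof (induction N)
  case (Suc N)
  show ?case
  proof (cases "(\<Sum>l\<le>N. a l) \<le> K")
    case True
    have "(\<Sum>i<Suc N. if (\<Sum>l\<le>i. a l) \<le> K then a i else 0) \<le> (\<Sum>i<Suc N. a i)"
      using Suc.prems by (intro sum_mono) auto
    also have "\<dots> = (\<Sum>l\<le>N. a l)" by (simp add: lessThan_Suc_atMost)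
    finally show ?thesis using True by simp
  qed (use Suc in simp)
qed simp

text \<open>Lenglart's inequality for discrete transforms. The integrand is switched off once its
  quadratic variation exceeds \<open>K\<close>; the truncated transform has second moment at most
  \<open>K\<close> and agrees with the original one unless the full quadratic variation exceeds
  \<open>K\<close>. The quadratic variation enters the bound only through a probability, which is
  what survives limits in probability.\<close>

lemma (in prob_space) martingale_transform_prob_bound:
  fixes D \<eta> :: "nat \<Rightarrow> 'a \<Rightarrow> real^'r" and G :: "nat \<Rightarrow> 'a measure"
  assumes G: "\<And>i. space (G i) = space M" "\<And>i. sets (G i) \<subseteq> events"
      "\<And>l i. l \<le> i \<Longrightarrow> i \<le> N \<Longrightarrow> sets (G l) \<subseteq> sets (G i)"
    and \<eta>: "\<And>i. i < N \<Longrightarrow> \<eta> i \<in> borel_measurable (G i)"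
      "\<And>i. i < N \<Longrightarrow> \<exists>C. \<forall>s\<in>space M. norm (\<eta> i s) \<le> C"
    and D: "\<And>i. i < N \<Longrightarrow> D i \<in> borel_measurable (G (Suc i))"
    and ind: "\<And>i. i < N \<Longrightarrow> indep_set (gen_events M {()} (\<lambda>_. D i)) (sets (G i))"
    and mean: "\<And>i j. i < N \<Longrightarrow> integrable M (\<lambda>s. D i s $ j)"
      "\<And>i j. i < N \<Longrightarrow> expectation (\<lambda>s. D i s $ j) = 0"
    and cov: "\<And>i j l. i < N \<Longrightarrow> integrable M (\<lambda>s. D i s $ j * D i s $ l)"
      "\<And>i j l. i < N \<Longrightarrow> expectation (\<lambda>s. D i s $ j * D i s $ l) = (if j = l then len i else 0)"
    and len: "\<And>i. i < N \<Longrightarrow> 0 \<le> len i" and K: "0 \<le> K" and \<delta>: "0 < \<delta>"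
  shows "prob {s\<in>space M. \<delta> < \<bar>\<Sum>i<N. \<eta> i s \<bullet> D i s\<bar>} \<le>
    prob {s\<in>space M. K < (\<Sum>i<N. len i * (norm (\<eta> i s))^2)} + K / \<delta>^2"
proof -
  \<comment> \<open>The sum includes the term with index \<open>i\<close>: it is still
    \<open>G i\<close>-measurable because \<open>\<eta> i\<close> is, and with this choice the
    retained total cannot overshoot \<open>K\<close>.\<close>
  define Q where "Q i s = (\<Sum>l\<le>i. len l * (norm (\<eta> l s))^2)" for i s
  define \<eta>' where "\<eta>' i s = (if Q i s \<le> K then \<eta> i s else 0)" for i s
  define J where "J s = (\<Sum>i<N. \<eta>' i s \<bullet> D i s)" for s
  have GM: "f \<in> borel_measurable (G i) \<Longrightarrow> f \<in> borel_measurable M" for i and f :: "'a \<Rightarrow> 'x::topological_space"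
    using measurable_mono[of borel borel "G i" M] G by auto
  have Gle: "f \<in> borel_measurable (G l) \<Longrightarrow> l \<le> i \<Longrightarrow> i \<le> N \<Longrightarrow> f \<in> borel_measurable (G i)"
    for l i and f :: "'a \<Rightarrow> 'x::topological_space"
    using measurable_mono[of borel borel "G l" "G i"] G by auto
  have \<eta>l: "\<eta> l \<in> borel_measurable (G i)" if "l \<le> i" "i < N" for l i
    using Gle[OF \<eta>(1)[of l] that(1)] that by auto
  have Qm: "Q i \<in> borel_measurable (G i)" if "i < N" for i
    unfolding Q_def
  proof (rule borel_measurable_sum)
    fix l assume "l \<in> {..i}"
    then have [measurable]: "\<eta> l \<in> borel_measurable (G i)" using \<eta>l that by auto
    show "(\<lambda>s. len l * (norm (\<eta> l s))^2) \<in> borel_measurable (G i)" by measurable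
  qed
  have \<eta>'m: "\<eta>' i \<in> borel_measurable (G i)" if "i < N" for i
    unfolding \<eta>'_def using Qm[OF that] \<eta>(1)[OF that] by measurable
  have \<eta>M: "\<eta> i \<in> borel_measurable M" if "i < N" for i using GM \<eta>(1)[OF that] by blast
  have DM: "D i \<in> borel_measurable M" if "i < N" for i using GM D[OF that] by blast
  have main: "integrable M (\<lambda>s. (J s)^2) \<and>
    expectation (\<lambda>s. (J s)^2) = (\<Sum>i<N. len i * expectation (\<lambda>s. (norm (\<eta>' i s))^2))"
    unfolding J_def
  proof (rule martingale_transform_L2[THEN conjunct2])
    show "\<exists>C. \<forall>s\<in>space M. norm (\<eta>' i s) \<le> C" if i: "i < N" for i
    proof -
      obtain C where "\<forall>s\<in>space M. norm (\<eta> i s) \<le> C" using \<eta>(2)[OF i] by blast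
      then have "\<forall>s\<in>space M. norm (\<eta>' i s) \<le> max C 0" by (auto simp: \<eta>'_def)
      then show ?thesis by blast
    qed
    show "sets (G i) \<subseteq> sets (G (Suc i))" if "i < N" for i using G(3)[of i "Suc i"] that by auto
  qed (use assms \<eta>'m in auto)
  have \<eta>'i: "integrable M (\<lambda>s. (norm (\<eta>' i s))^2)" if i: "i < N" for i
  proof -
    obtain C where C: "\<forall>s\<in>space M. norm (\<eta> i s) \<le> C" using \<eta>(2)[OF i] by blast
    show ?thesis
    proof (rule integrable_const_bound[of _ "C^2"])
      show "AE s in M. norm ((norm (\<eta>' i s))^2) \<le> C^2"
        using C by (intro AE_I2) (auto simp: \<eta>'_def intro!: power_mono)
      show "(\<lambda>s. (norm (\<eta>' i s))^2) \<in> borel_measurable M"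
        using GM[OF \<eta>'m[OF i]] by measurable
    qed
  qed
  have "expectation (\<lambda>s. (J s)^2) = expectation (\<lambda>s. \<Sum>i<N. len i * (norm (\<eta>' i s))^2)"
    using main \<eta>'i by (subst Bochner_Integration.integral_sum) auto
  also have "\<dots> \<le> expectation (\<lambda>s. K)"
  proof (rule integral_mono)
    fix s
    have "(\<Sum>i<N. len i * (norm (\<eta>' i s))^2) =
       (\<Sum>i<N. if (\<Sum>l\<le>i. len l * (norm (\<eta> l s))^2) \<le> K then len i * (norm (\<eta> i s))^2 else 0)"
      by (intro sum.cong) (auto simp: \<eta>'_def Q_def)
    also have "\<dots> \<le> K" using len K by (intro sum_truncated_le) auto
    finally show "(\<Sum>i<N. len i * (norm (\<eta>' i s))^2) \<le> K" .
  qed (use \<eta>'i in auto)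
  finally have EJ: "expectation (\<lambda>s. (J s)^2) \<le> K" by (simp add: prob_space)
  have Jm: "J \<in> borel_measurable M"
    unfolding J_def using DM GM[OF \<eta>'m] by (intro borel_measurable_sum borel_measurable_inner) auto
  have Qs: "{s\<in>space M. K < (\<Sum>i<N. len i * (norm (\<eta> i s))^2)} \<in> events"
    using \<eta>M by (intro borel_measurable_less borel_measurable_sum borel_measurable_const) auto
  have Js: "{s\<in>space M. \<delta>^2 \<le> (J s)^2} \<in> events" using Jm by measurable
  have "prob {s\<in>space M. \<delta> < \<bar>\<Sum>i<N. \<eta> i s \<bullet> D i s\<bar>} \<le>
    prob ({s\<in>space M. K < (\<Sum>i<N. len i * (norm (\<eta> i s))^2)} \<union> {s\<in>space M. \<delta>^2 \<le> (J s)^2})"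
  proof (intro finite_measure_mono sets.Un Qs Js subsetI)
    fix s assume *: "s \<in> {s\<in>space M. \<delta> < \<bar>\<Sum>i<N. \<eta> i s \<bullet> D i s\<bar>}"
    show "s \<in> {s\<in>space M. K < (\<Sum>i<N. len i * (norm (\<eta> i s))^2)} \<union> {s\<in>space M. \<delta>^2 \<le> (J s)^2}"
    proof (cases "K < (\<Sum>i<N. len i * (norm (\<eta> i s))^2)")
      case False
      have "Q i s \<le> K" if "i < N" for i
      proof -
        have "Q i s \<le> (\<Sum>i<N. len i * (norm (\<eta> i s))^2)"
          unfolding Q_def using that len by (intro sum_mono2) auto
        then show ?thesis using False by simp
      qed
      then have "J s = (\<Sum>i<N. \<eta> i s \<bullet> D i s)" by (simp add: J_def \<eta>'_def)
      then have "\<delta>^2 \<le> (J s)^2" using * \<delta> by (intro abs_le_square_iff[THEN iffD1]) auto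
      then show ?thesis using * by auto
    qed (use * in auto)
  qed
  also have "\<dots> \<le> prob {s\<in>space M. K < (\<Sum>i<N. len i * (norm (\<eta> i s))^2)} + prob {s\<in>space M. \<delta>^2 \<le> (J s)^2}"
    by (intro measure_Un_le Qs Js)
  also have "prob {s\<in>space M. \<delta>^2 \<le> (J s)^2} \<le> expectation (\<lambda>s. (J s)^2) / \<delta>^2"
    using main \<delta> by (intro integral_Markov_inequality_measure[where A="{}"]) auto
  also have "\<dots> \<le> K / \<delta>^2" using EJ by (intro divide_right_mono) auto
  finally show ?thesis by simp
qed

lemma (in prob_space) wiener_increment_moments:
  fixes w :: "real \<Rightarrow> 'a \<Rightarrow> real^'r"
  assumes w: "wiener_process M w" and st: "0 \<le> s" "s < t"
  shows "integrable M (\<lambda>\<omega>. (w t \<omega> - w s \<omega>) $ j)" "expectation (\<lambda>\<omega>. (w t \<omega> - w s \<omega>) $ j) = 0"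
    "integrable M (\<lambda>\<omega>. (w t \<omega> - w s \<omega>) $ j * (w t \<omega> - w s \<omega>) $ l)"
    "expectation (\<lambda>\<omega>. (w t \<omega> - w s \<omega>) $ j * (w t \<omega> - w s \<omega>) $ l) = (if j = l then t - s else 0)"
proof -
  define Y where "Y j \<omega> = (w t \<omega> - w s \<omega>) $ j" for j \<omega>
  have d: "distributed M lborel (Y j) (normal_density 0 (sqrt (t - s)))" for j
    using w st unfolding wiener_process_def Y_def by blast
  have iv: "indep_vars (\<lambda>_. borel) Y UNIV"
    using w st unfolding wiener_process_def Y_def by blast
  have pos: "0 < sqrt (t - s)" using st by simp
  have i1: "integrable M (Y j)" for j
    using distributed_integrable[OF d[of j], of "\<lambda>x. x"] integrable_normal_moment_nz_1[OF pos, of 0] by simp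
  have e1: "expectation (Y j) = 0" for j using normal_distributed_expectation[OF pos d] .
  have i2: "integrable M (\<lambda>\<omega>. (Y j \<omega>)^2)" for j
    using distributed_integrable[OF d[of j], of "\<lambda>x. x^2"] integrable_normal_moment[OF pos, of 0 2] by simp
  have e2: "expectation (\<lambda>\<omega>. (Y j \<omega>)^2) = t - s" for j
    using normal_distributed_variance[OF pos d, of j] e1[of j] st by simp
  have sub: "indep_vars (\<lambda>_. borel) Y {j, l}" using iv by (rule indep_vars_subset) auto
  have p: "integrable M (\<lambda>\<omega>. Y j \<omega> * Y l \<omega>) \<and> expectation (\<lambda>\<omega>. Y j \<omega> * Y l \<omega>) = (if j = l then t - s else 0)"
  proof (cases "j = l")
    case True then show ?thesis using i2 e2 by (simp add: power2_eq_square)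
  next
    case False
    then show ?thesis
      using indep_vars_integrable[OF _ sub i1] indep_vars_lebesgue_integral[OF _ sub i1] e1 by simp
  qed
  show "integrable M (\<lambda>\<omega>. (w t \<omega> - w s \<omega>) $ j)" "expectation (\<lambda>\<omega>. (w t \<omega> - w s \<omega>) $ j) = 0"
    "integrable M (\<lambda>\<omega>. (w t \<omega> - w s \<omega>) $ j * (w t \<omega> - w s \<omega>) $ l)"
    "expectation (\<lambda>\<omega>. (w t \<omega> - w s \<omega>) $ j * (w t \<omega> - w s \<omega>) $ l) = (if j = l then t - s else 0)"
    using i1 e1 p unfolding Y_def by auto
qed

section \<open>Increments of the Ito integral and of the diffusion\<close>

text \<open>The norm of a matrix is here the Frobenius norm, so Cauchy-Schwarz applied to each
  column suffices.\<close>

lemma norm_vector_matrix_mult_le: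
  fixes A :: "real^'r^'d" and u :: "real^'d"
  shows "(norm (u v* A))^2 \<le> (norm u)^2 * (norm A)^2"
proof -
  have n2: "(norm v)^2 = (\<Sum>i\<in>UNIV. (v $ i)^2)" for v :: "real^'n"
    unfolding power2_norm_eq_inner by (simp add: inner_vec_def power2_eq_square)
  have "(norm (u v* A))^2 = (\<Sum>j\<in>UNIV. ((\<Sum>i\<in>UNIV. u $ i * A $ i $ j))^2)"
    by (simp add: n2 vector_matrix_mult_def mult.commute)
  also have "\<dots> \<le> (\<Sum>j\<in>UNIV. (\<Sum>i\<in>UNIV. (u $ i)^2) * (\<Sum>i\<in>UNIV. (A $ i $ j)^2))"
    by (intro sum_mono Cauchy_Schwarz_ineq_sum)
  also have "\<dots> = (norm u)^2 * (\<Sum>j\<in>UNIV. \<Sum>i\<in>UNIV. (A $ i $ j)^2)"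
    by (simp add: n2 sum_distrib_left)
  also have "(\<Sum>j\<in>UNIV. \<Sum>i\<in>UNIV. (A $ i $ j)^2) = (norm A)^2"
    unfolding power2_norm_eq_inner by (subst sum.swap) (simp add: inner_vec_def power2_eq_square)
  finally show ?thesis .
qed

section \<open>Markov bounds for time integrals, and joint measurability in time\<close>

lemma (in prob_space) nn_integral_markov:
  assumes [measurable]: "f \<in> borel_measurable M" and le: "(\<integral>\<^sup>+ \<omega>. f \<omega> \<partial>M) \<le> ennreal C" and C: "0 \<le> C" and c: "0 < c"
  shows "prob {\<omega>\<in>space M. ennreal c < f \<omega>} \<le> C / c"
proof -
  have "{\<omega>\<in>space M. ennreal c < f \<omega>} \<subseteq> {\<omega>\<in>space M. 1 \<le> ennreal (1 / c) * f \<omega>}"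
  proof safe
    fix \<omega> assume "ennreal c < f \<omega>"
    then have "ennreal (1 / c) * ennreal c \<le> ennreal (1 / c) * f \<omega>" by (intro mult_left_mono) auto
    moreover have "ennreal (1 / c) * ennreal c = 1" using c by (simp flip: ennreal_mult)
    ultimately show "1 \<le> ennreal (1 / c) * f \<omega>" by simp
  qed
  then have "emeasure M {\<omega>\<in>space M. ennreal c < f \<omega>} \<le> emeasure M {\<omega>\<in>space M. 1 \<le> ennreal (1 / c) * f \<omega>}"
    by (intro emeasure_mono) auto
  also have "\<dots> \<le> ennreal (1 / c) * (\<integral>\<^sup>+ \<omega>. f \<omega> * indicator (space M) \<omega> \<partial>M)"
    by (rule nn_integral_Markov_inequality) auto
  also have "(\<integral>\<^sup>+ \<omega>. f \<omega> * indicator (space M) \<omega> \<partial>M) = (\<integral>\<^sup>+ \<omega>. f \<omega> \<partial>M)"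
    by (intro nn_integral_cong) auto
  also have "ennreal (1 / c) * (\<integral>\<^sup>+ \<omega>. f \<omega> \<partial>M) \<le> ennreal (1 / c) * ennreal C"
    using le by (intro mult_left_mono) auto
  also have "\<dots> = ennreal (C / c)" using c C by (simp flip: ennreal_mult)
  finally show ?thesis using c C by (simp add: emeasure_eq_measure)
qed

text \<open>Tonelli and Markov: a bound on the mean at each fixed time controls the time integral,
  with a factor \<open>t - s\<close> that later makes short increments small.\<close>

lemma (in prob_space) time_integral_markov:
  fixes g :: "real \<Rightarrow> 'a \<Rightarrow> ennreal"
  assumes g[measurable]: "(\<lambda>(\<omega>, v). g v \<omega>) \<in> borel_measurable (M \<Otimes>\<^sub>M lborel)"
    and le: "\<And>v. s \<le> v \<Longrightarrow> v \<le> t \<Longrightarrow> (\<integral>\<^sup>+ \<omega>. g v \<omega> \<partial>M) \<le> ennreal B"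
    and B: "0 \<le> B" and st: "s \<le> t" and c: "0 < c"
  shows "prob {\<omega>\<in>space M. ennreal c < (\<integral>\<^sup>+ v\<in>{s..t}. g v \<omega> \<partial>lborel)} \<le> B * (t - s) / c"
proof (rule nn_integral_markov)
  interpret pair_sigma_finite M lborel ..
  have "(\<integral>\<^sup>+ \<omega>. (\<integral>\<^sup>+ v\<in>{s..t}. g v \<omega> \<partial>lborel) \<partial>M) = (\<integral>\<^sup>+ v. (\<integral>\<^sup>+ \<omega>. g v \<omega> * indicator {s..t} v \<partial>M) \<partial>lborel)"
    by (rule Fubini'[symmetric]) measurable
  also have "\<dots> \<le> (\<integral>\<^sup>+ v. ennreal B * indicator {s..t} v \<partial>lborel)"
    using le by (intro nn_integral_mono) (auto split: split_indicator)
  also have "\<dots> = ennreal (B * (t - s))"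
    using B st by (simp add: nn_integral_cmult_indicator ennreal_mult)
  finally show "(\<integral>\<^sup>+ \<omega>. (\<integral>\<^sup>+ v\<in>{s..t}. g v \<omega> \<partial>lborel) \<partial>M) \<le> ennreal (B * (t - s))" .
qed (use B st c in auto)

lemma joint_measurable_continuous_paths:
  fixes X :: "real \<Rightarrow> 'a \<Rightarrow> 'b::real_normed_vector"
  assumes X: "\<And>t. 0 \<le> t \<Longrightarrow> X t \<in> borel_measurable M"
    and cont: "\<And>\<omega>. \<omega> \<in> space M \<Longrightarrow> continuous_on {0..} (\<lambda>t. X t \<omega>)"
  shows "(\<lambda>(\<omega>, v). X (max 0 v) \<omega>) \<in> borel_measurable (M \<Otimes>\<^sub>M lborel)"
proof -
  \<comment> \<open>Time is rounded down to a multiple of \<open>1 / (n + 1)\<close>. The rounded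
    process uses countably many times, hence is jointly measurable, and continuity of the paths
    makes it converge pointwise; \<open>max 0\<close> keeps all times in the range where
    \<open>X\<close> is controlled.\<close>
  define r where "r n v = real_of_int \<lfloor>max 0 v * real (Suc n)\<rfloor> / real (Suc n)" for n v
  have r0: "0 \<le> r n v" for n v by (simp add: r_def)
  have meas: "(\<lambda>(\<omega>, v). X (r n v) \<omega>) \<in> borel_measurable (M \<Otimes>\<^sub>M lborel)" for n
  proof -
    have "(\<lambda>z. (\<lambda>i::int. \<lambda>z. X (max 0 (real_of_int i / real (Suc n))) (fst z)) (\<lfloor>max 0 (snd z) * real (Suc n)\<rfloor>) z)
       \<in> borel_measurable (M \<Otimes>\<^sub>M lborel)"
    proof (rule measurable_compose_countable[where f="\<lambda>i z. X (max 0 (real_of_int i / real (Suc n))) (fst z)"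
          and g="\<lambda>z. \<lfloor>max 0 (snd z) * real (Suc n)\<rfloor>"])
      fix i :: int
      have [measurable]: "X (max 0 (real_of_int i / real (Suc n))) \<in> borel_measurable M" by (rule X) simp
      show "(\<lambda>z. X (max 0 (real_of_int i / real (Suc n))) (fst z)) \<in> borel_measurable (M \<Otimes>\<^sub>M lborel)"
        by measurable
    qed measurable
    moreover have "max 0 (real_of_int \<lfloor>max 0 v * real (Suc n)\<rfloor> / real (Suc n)) = r n v" for v
      using r0[of n v] by (simp add: r_def)
    ultimately show ?thesis by (simp add: case_prod_beta')
  qed
  have "(\<lambda>n. (case z of (\<omega>, v) \<Rightarrow> X (r n v) \<omega>)) \<longlonglongrightarrow> (case z of (\<omega>, v) \<Rightarrow> X (max 0 v) \<omega>)"
    if z: "z \<in> space (M \<Otimes>\<^sub>M lborel)" for z :: "'a \<times> real"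
  proof -
    from z have \<omega>: "fst z \<in> space M" by (auto simp: space_pair_measure)
    have "(\<lambda>n. r n (snd z)) \<longlonglongrightarrow> max 0 (snd z)"
    proof (rule LIMSEQ_I)
      fix e :: real assume "0 < e"
      obtain N where N: "1 / e < real N" using reals_Archimedean2 by blast
      have "norm (r n (snd z) - max 0 (snd z)) < e" if "n \<ge> N" for n
      proof -
        have "\<bar>real_of_int \<lfloor>max 0 (snd z) * real (Suc n)\<rfloor> - max 0 (snd z) * real (Suc n)\<bar> \<le> 1" by linarith
        then have "\<bar>r n (snd z) - max 0 (snd z)\<bar> \<le> 1 / real (Suc n)"
          unfolding r_def by (simp add: divide_simps abs_if split: if_splits)
        also have "1 / real (Suc n) < e"
        proof -
          have "1 / e < real (Suc n)" using N that by linarith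
          then show ?thesis using \<open>0 < e\<close> by (simp add: field_simps)
        qed
        finally show ?thesis by simp
      qed
      then show "\<exists>N. \<forall>n\<ge>N. norm (r n (snd z) - max 0 (snd z)) < e" by blast
    qed
    then have "(\<lambda>n. X (r n (snd z)) (fst z)) \<longlonglongrightarrow> X (max 0 (snd z)) (fst z)"
      using r0 by (intro continuous_on_tendsto_compose[OF cont[OF \<omega>]]) auto
    then show "(\<lambda>n. (case z of (\<omega>, v) \<Rightarrow> X (r n v) \<omega>)) \<longlonglongrightarrow> (case z of (\<omega>, v) \<Rightarrow> X (max 0 v) \<omega>)"
      by (simp add: case_prod_beta')
  qed
  then show ?thesis
    by (rule borel_measurable_LIMSEQ_metric[where f="\<lambda>n (\<omega>, v). X (r n v) \<omega>", OF meas])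
qed

text \<open>Clipping a partition to \<open>[s, t]\<close> produces empty intervals, whose increments
  are constant; \<open>wiener_increment_indep\<close> covers only proper ones.\<close>

lemma (in prob_space) indep_set_gen_events_const:
  assumes "A \<subseteq> events" shows "indep_set (gen_events M {()} (\<lambda>_ _. c)) A"
proof -
  have "gen_events M {()} (\<lambda>_ _. c) \<subseteq> sigma_sets (space M) {}"
    unfolding gen_events_def by (rule sigma_sets_mono) (auto simp: vimage_def sigma_sets_empty_eq)
  then have *: "gen_events M {()} (\<lambda>_ _. c) \<subseteq> {{}, space M}" by (simp add: sigma_sets_empty_eq)
  show ?thesis
  proof (rule indep_setI)
    fix a b assume "a \<in> gen_events M {()} (\<lambda>_ _. c)" "b \<in> A"
    moreover have "space M \<inter> b = b" if "b \<in> A" using assms that sets.sets_into_space by blast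
    ultimately show "prob (a \<inter> b) = prob a * prob b" using * by (auto simp: prob_space)
  qed (use * assms in auto)
qed

section \<open>Tail bounds for increments of simple and Ito integrals\<close>

locale wiener_space = prob_space M for M :: "'w measure" +
  fixes w :: "real \<Rightarrow> 'w \<Rightarrow> real^'r" and x0 :: "'w \<Rightarrow> real^'d"
  assumes w: "wiener_process M w" and x0: "x0 \<in> borel_measurable M"
    and x0_indep: "indep_set (gen_events M {()} (\<lambda>_. x0)) (gen_events M {0..} w)"
begin

abbreviation \<F> :: "real \<Rightarrow> 'w measure" where "\<F> \<equiv> driving_filtration M x0 w"

lemma wM: "\<forall>t\<ge>0. w t \<in> borel_measurable M"
  using wiener_borel_measurable[OF w] by blast

lemma \<F>_measurable_mono:
  fixes f :: "'w \<Rightarrow> 'x::topological_space"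
  shows "f \<in> borel_measurable (\<F> s) \<Longrightarrow> s \<le> t \<Longrightarrow> f \<in> borel_measurable (\<F> t)"
  using measurable_mono[of borel borel "\<F> s" "\<F> t"] driving_filtration_mono[OF x0 wM] by auto

lemma \<F>_measurable:
  fixes f :: "'w \<Rightarrow> 'x::topological_space"
  shows "f \<in> borel_measurable (\<F> s) \<Longrightarrow> f \<in> borel_measurable M"
  using measurable_mono[of borel borel "\<F> s" M] driving_filtration_subset[OF x0 wM] by auto

lemma w_\<F>: "0 \<le> s \<Longrightarrow> s \<le> t \<Longrightarrow> w s \<in> borel_measurable (\<F> t)"
  by (rule borel_measurable_gen_events[where I="{0..t}" and M=M])
    (auto simp: sets_driving_filtration[OF x0 wM])

lemma simple_process_measurable:
  assumes S: "simple_integrand M \<F> N \<tau> \<xi>"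
  shows "(\<lambda>(\<omega>, v). simple_process N \<tau> \<xi> v \<omega>) \<in> borel_measurable (M \<Otimes>\<^sub>M lborel)"
  unfolding simple_process_def case_prod_beta'
proof (rule borel_measurable_sum)
  fix i assume "i \<in> {..<N}"
  then have [measurable]: "\<xi> i \<in> borel_measurable M"
    using S \<F>_measurable unfolding simple_integrand_def by blast
  show "(\<lambda>z. indicator {\<tau> i<..\<tau> (Suc i)} (snd z) *\<^sub>R \<xi> i (fst z)) \<in> borel_measurable (M \<Otimes>\<^sub>M lborel)"
    by measurable
qed

text \<open>After clipping the partition to \<open>[s, t]\<close>, the increment is a martingale
  transform, because \<open>u \<bullet> (\<xi> i *v y) = (u v* \<xi> i) \<bullet> y\<close>. Its
  discrete quadratic variation is at most \<open>(norm u)^2\<close> times the time integral, so the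
  threshold \<open>K\<close> for the integral becomes \<open>(norm u)^2 * K\<close> for the
  transform.\<close>

lemma simple_integral_increment_prob:
  fixes u :: "real^'d"
  assumes S: "simple_integrand M \<F> N \<tau> \<xi>" and st: "0 \<le> s" "s < t" and K: "0 \<le> K" and \<delta>: "0 < \<delta>"
  shows "prob {\<omega>\<in>space M. \<delta> < \<bar>u \<bullet> (simple_integral w N \<tau> \<xi> t \<omega> - simple_integral w N \<tau> \<xi> s \<omega>)\<bar>} \<le>
    prob {\<omega>\<in>space M. ennreal K < (\<integral>\<^sup>+ v\<in>{s..t}. ennreal ((norm (simple_process N \<tau> \<xi> v \<omega>))^2) \<partial>lborel)}
      + (norm u)^2 * K / \<delta>^2"
proof -
  let ?I = "\<lambda>\<omega>. \<integral>\<^sup>+ v\<in>{s..t}. ennreal ((norm (simple_process N \<tau> \<xi> v \<omega>))^2) \<partial>lborel"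
  define c where "c x = max s (min t x)" for x
  \<comment> \<open>\<open>min i N\<close> freezes the index at \<open>N\<close>, so that
    \<open>T\<close> is monotone on all natural numbers although \<open>\<tau>\<close> is controlled
    only up to \<open>N\<close>.\<close>
  define T where "T i = c (\<tau> (min i N))" for i
  define D where "D i \<omega> = w (T (Suc i)) \<omega> - w (T i) \<omega>" for i \<omega>
  \<comment> \<open>If \<open>\<tau> i\<close> lies at or beyond \<open>t\<close>, then
    \<open>T i = t\<close> and \<open>\<xi> i\<close> need not be known at time \<open>T i\<close>;
    but there \<open>D i\<close> vanishes, so the integrand may be replaced by zero.\<close>
  define \<eta> where "\<eta> i \<omega> = (if \<tau> i < t then u v* \<xi> i \<omega> else 0)" for i \<omega>
  define len where "len i = T (Suc i) - T i" for i
  have \<tau>_mono: "\<tau> l \<le> \<tau> i" if "l \<le> i" "i \<le> N" for l i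
    using that
  proof (induction i)
    case (Suc i)
    have "\<tau> i < \<tau> (Suc i)" using S Suc.prems unfolding simple_integrand_def by auto
    then show ?case using Suc by (cases "l = Suc i") auto
  qed simp
  have \<tau>0: "0 \<le> \<tau> i" if "i \<le> N" for i
    using \<tau>_mono[of 0 i] that S unfolding simple_integrand_def by auto
  have c_mono: "x \<le> y \<Longrightarrow> c x \<le> c y" for x y by (auto simp: c_def)
  have T_mono: "T l \<le> T i" if "l \<le> i" for l i
    unfolding T_def using that by (intro c_mono \<tau>_mono) auto
  have T0: "0 \<le> T i" for i using st by (auto simp: T_def c_def)
  have len0: "0 \<le> len i" for i using T_mono[of i "Suc i"] by (simp add: len_def)
  have \<tau>T: "\<tau> i \<le> T i" if "\<tau> i < t" "i < N" for i using that by (auto simp: T_def c_def)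
  have T_late: "T i = t" if "t \<le> \<tau> i" "i < N" for i using that st by (auto simp: T_def c_def)
  have T_le: "T i \<le> t" for i using st by (auto simp: T_def c_def)
  have \<xi>\<F>: "\<xi> i \<in> borel_measurable (\<F> (\<tau> i))" if "i < N" for i
    using S that unfolding simple_integrand_def by auto
  have \<eta>\<F>: "\<eta> i \<in> borel_measurable (\<F> (T i))" if "i < N" for i
  proof (cases "\<tau> i < t")
    case True
    have [measurable]: "\<xi> i \<in> borel_measurable (\<F> (T i))"
      using \<F>_measurable_mono[OF \<xi>\<F>[OF that] \<tau>T[OF True that]] .
    have "(\<lambda>\<omega>. u v* \<xi> i \<omega>) \<in> borel_measurable (\<F> (T i))"
      by (rule borel_measurable_continuous_on[OF _ \<open>\<xi> i \<in> borel_measurable (\<F> (T i))\<close>])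
         (auto simp: vector_matrix_mult_def intro!: continuous_on_vec_lambda continuous_intros)
    then show ?thesis using True by (simp add: \<eta>_def[abs_def])
  qed (simp add: \<eta>_def[abs_def])
  have \<eta>n: "(norm (\<eta> i \<omega>))^2 \<le> (norm u)^2 * (norm (\<xi> i \<omega>))^2" for i \<omega>
    using norm_vector_matrix_mult_le[of u "\<xi> i \<omega>"] by (auto simp: \<eta>_def)
  \<comment> \<open>The term \<open>w s\<close> is the same for both end points of an interval and
    cancels in their difference.\<close>
  have w_eq: "w (min t x) \<omega> - w (min s x) \<omega> = w (c x) \<omega> - w s \<omega>" for x \<omega>
    using st by (auto simp: c_def min_def max_def)
  have J_eq: "u \<bullet> (simple_integral w N \<tau> \<xi> t \<omega> - simple_integral w N \<tau> \<xi> s \<omega>) = (\<Sum>i<N. \<eta> i \<omega> \<bullet> D i \<omega>)" for \<omega>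
  proof -
    have "simple_integral w N \<tau> \<xi> t \<omega> - simple_integral w N \<tau> \<xi> s \<omega> =
      (\<Sum>i<N. \<xi> i \<omega> *v ((w (min t (\<tau> (Suc i))) \<omega> - w (min s (\<tau> (Suc i))) \<omega>) - (w (min t (\<tau> i)) \<omega> - w (min s (\<tau> i)) \<omega>)))"
      unfolding simple_integral_def sum_subtractf[symmetric]
      by (intro sum.cong) (simp_all add: matrix_vector_mult_diff_distrib)
    also have "\<dots> = (\<Sum>i<N. \<xi> i \<omega> *v D i \<omega>)"
      unfolding w_eq by (intro sum.cong) (auto simp: D_def T_def min_def)
    finally have "u \<bullet> (simple_integral w N \<tau> \<xi> t \<omega> - simple_integral w N \<tau> \<xi> s \<omega>) = (\<Sum>i<N. (u v* \<xi> i \<omega>) \<bullet> D i \<omega>)"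
      by (simp add: inner_sum_right dot_lmul_matrix)
    also have "\<dots> = (\<Sum>i<N. \<eta> i \<omega> \<bullet> D i \<omega>)"
    proof (intro sum.cong refl)
      fix i assume i: "i \<in> {..<N}"
      show "(u v* \<xi> i \<omega>) \<bullet> D i \<omega> = \<eta> i \<omega> \<bullet> D i \<omega>"
      proof (cases "\<tau> i < t")
        case False
        then have "T i = t" using T_late i by auto
        moreover then have "T (Suc i) = t" using T_mono[of i "Suc i"] T_le[of "Suc i"] by auto
        ultimately show ?thesis by (simp add: D_def)
      qed (simp add: \<eta>_def)
    qed
    finally show ?thesis .
  qed
  have D0: "D i = (\<lambda>_. 0)" if "\<not> T i < T (Suc i)" for i
    using T_mono[of i "Suc i"] that by (auto simp: D_def)
  have "prob {\<omega>\<in>space M. \<delta> < \<bar>\<Sum>i<N. \<eta> i \<omega> \<bullet> D i \<omega>\<bar>} \<le>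
    prob {\<omega>\<in>space M. (norm u)^2 * K < (\<Sum>i<N. len i * (norm (\<eta> i \<omega>))^2)} + (norm u)^2 * K / \<delta>^2"
  proof (rule martingale_transform_prob_bound[where G="\<lambda>i. \<F> (T i)"])
    show "sets (\<F> (T i)) \<subseteq> events" for i by (rule driving_filtration_subset[OF x0 wM])
    show "sets (\<F> (T l)) \<subseteq> sets (\<F> (T i))" if "l \<le> i" for l i
      using T_mono[OF that] by (rule driving_filtration_mono[OF x0 wM])
    show "\<exists>C. \<forall>\<omega>\<in>space M. norm (\<eta> i \<omega>) \<le> C" if i: "i < N" for i
    proof -
      obtain C where C: "\<forall>\<omega>\<in>space M. norm (\<xi> i \<omega>) \<le> C" using S i unfolding simple_integrand_def by blast
      have "norm (\<eta> i \<omega>) \<le> norm u * C" if "\<omega> \<in> space M" for \<omega>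
      proof -
        have "norm (\<eta> i \<omega>) \<le> norm u * norm (\<xi> i \<omega>)"
          using \<eta>n[of i \<omega>] by (auto simp flip: power_mult_distrib intro: power2_le_imp_le)
        also have "\<dots> \<le> norm u * C" using C that by (intro mult_left_mono) auto
        finally show ?thesis .
      qed
      then show ?thesis by blast
    qed
    show "D i \<in> borel_measurable (\<F> (T (Suc i)))" for i
      unfolding D_def[abs_def] using w_\<F>[OF T0] T_mono[of i "Suc i"] by (intro borel_measurable_diff) auto
    show "indep_set (gen_events M {()} (\<lambda>_. D i)) (sets (\<F> (T i)))" for i
    proof (cases "T i < T (Suc i)")
      case True
      show ?thesis unfolding D_def[abs_def] by (rule wiener_increment_indep[OF w x0 x0_indep T0 True])
    next
      case False
      show ?thesis unfolding D0[OF False]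
        by (rule indep_set_gen_events_const) (rule driving_filtration_subset[OF x0 wM])
    qed
    fix i j l
    have "integrable M (\<lambda>\<omega>. D i \<omega> $ j) \<and> expectation (\<lambda>\<omega>. D i \<omega> $ j) = 0 \<and>
      integrable M (\<lambda>\<omega>. D i \<omega> $ j * D i \<omega> $ l) \<and>
      expectation (\<lambda>\<omega>. D i \<omega> $ j * D i \<omega> $ l) = (if j = l then len i else 0)"
    proof (cases "T i < T (Suc i)")
      case True
      then show ?thesis unfolding D_def len_def using wiener_increment_moments[OF w T0 True] by auto
    next
      case False
      then show ?thesis using D0[OF False] len0[of i] by (simp add: len_def)
    qed
    then show "integrable M (\<lambda>\<omega>. D i \<omega> $ j)" "expectation (\<lambda>\<omega>. D i \<omega> $ j) = 0"
      "integrable M (\<lambda>\<omega>. D i \<omega> $ j * D i \<omega> $ l)"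
      "expectation (\<lambda>\<omega>. D i \<omega> $ j * D i \<omega> $ l) = (if j = l then len i else 0)" by auto
  qed (use \<eta>\<F> len0 K \<delta> in auto)
  moreover have "prob {\<omega>\<in>space M. (norm u)^2 * K < (\<Sum>i<N. len i * (norm (\<eta> i \<omega>))^2)} \<le>
     prob {\<omega>\<in>space M. ennreal K < ?I \<omega>}"
  proof (rule finite_measure_mono)
    have [measurable]: "\<xi> i \<in> borel_measurable M" if "i < N" for i using \<F>_measurable[OF \<xi>\<F>[OF that]] .
    show "{\<omega>\<in>space M. ennreal K < ?I \<omega>} \<in> events"
      using simple_process_measurable[OF S] by measurable
    show "{\<omega>\<in>space M. (norm u)^2 * K < (\<Sum>i<N. len i * (norm (\<eta> i \<omega>))^2)} \<subseteq>
      {\<omega>\<in>space M. ennreal K < ?I \<omega>}"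
    proof safe
      fix \<omega> assume \<omega>: "(norm u)^2 * K < (\<Sum>i<N. len i * (norm (\<eta> i \<omega>))^2)"
      define n where "n i = (norm (\<xi> i \<omega>))^2" for i
      have "(\<Sum>i<N. len i * (norm (\<eta> i \<omega>))^2) \<le> (\<Sum>i<N. len i * ((norm u)^2 * n i))"
        using \<eta>n len0 by (intro sum_mono mult_left_mono) (auto simp: n_def)
      also have "\<dots> = (norm u)^2 * (\<Sum>i<N. len i * n i)" by (simp add: sum_distrib_left mult_ac)
      finally have "(norm u)^2 * K < (norm u)^2 * (\<Sum>i<N. len i * n i)" using \<omega> by simp
      then have "K < (\<Sum>i<N. len i * n i)" by (rule mult_left_less_imp_less) simp
      then have "ennreal K < ennreal (\<Sum>i<N. len i * n i)" using K by (simp add: ennreal_less_iff)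
      also have "\<dots> = (\<Sum>i<N. ennreal (n i) * emeasure lborel {T i<..T (Suc i)})"
      proof -
        have "ennreal (n i) * emeasure lborel {T i<..T (Suc i)} = ennreal (len i * n i)" for i
          using T_mono[of i "Suc i"] len0[of i] by (simp add: n_def len_def ennreal_mult mult.commute)
        then show ?thesis using len0 by (simp add: n_def)
      qed
      also have "\<dots> = (\<Sum>i<N. \<integral>\<^sup>+ v. ennreal (n i) * indicator {T i<..T (Suc i)} v \<partial>lborel)"
        by (intro sum.cong refl nn_integral_cmult_indicator[symmetric]) auto
      also have "\<dots> = (\<integral>\<^sup>+ v. (\<Sum>i<N. ennreal (n i) * indicator {T i<..T (Suc i)} v) \<partial>lborel)"
        by (rule nn_integral_sum[symmetric]) auto
      also have "\<dots> \<le> ?I \<omega>"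
      proof (rule nn_integral_mono)
        fix v
        show "(\<Sum>i<N. ennreal (n i) * indicator {T i<..T (Suc i)} v) \<le>
          ennreal ((norm (simple_process N \<tau> \<xi> v \<omega>))^2) * indicator {s..t} v"
        proof (cases "\<exists>i<N. v \<in> {T i<..T (Suc i)}")
          case False
          then have "(\<Sum>i<N. ennreal (n i) * indicator {T i<..T (Suc i)} v) = 0"
            by (intro sum.neutral) (auto split: split_indicator)
          then show ?thesis by simp
        next
          case True
          \<comment> \<open>The clipped intervals are disjoint, and a point of one of them lies in
            the original interval with the same index; hence exactly one term of either sum
            survives, with index \<open>i\<close>.\<close>
          then obtain i where i: "i < N" "T i < v" "v \<le> T (Suc i)" by auto
          have out: "l < i \<Longrightarrow> T (Suc l) < v" "i < l \<Longrightarrow> v \<le> T l" for l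
            using T_mono[of "Suc l" i] T_mono[of "Suc i" l] i by auto
          have v: "s < v" "v \<le> t" using i T_le[of "Suc i"] by (auto simp: T_def c_def)
          have vi: "\<tau> i < v" "v \<le> \<tau> (Suc i)"
            using i v by (auto simp: T_def c_def min_def max_def split: if_splits)
          have 1: "ennreal (n l) * indicator {T l<..T (Suc l)} v = (if l = i then ennreal (n i) else 0)" for l
            using out[of l] i by (cases "l = i"; cases "l < i") (auto split: split_indicator)
          have 2: "indicator {\<tau> l<..\<tau> (Suc l)} v *\<^sub>R \<xi> l \<omega> = (if l = i then \<xi> i \<omega> else 0)" if "l < N" for l
            using \<tau>_mono[of "Suc l" i] \<tau>_mono[of "Suc i" l] i vi that
            by (cases "l = i"; cases "l < i") (auto split: split_indicator)
          have "simple_process N \<tau> \<xi> v \<omega> = \<xi> i \<omega>"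
            unfolding simple_process_def using 2 i(1) by (simp add: sum.delta)
          then show ?thesis unfolding 1 using i v by (simp add: n_def)
        qed
      qed
      finally show "ennreal K < ?I \<omega>" .
    qed
  qed
  ultimately show ?thesis unfolding J_eq by simp
qed

end

lemma borel_measurable_matrix_vector_mult:
  fixes A :: "'a \<Rightarrow> real^'r^'d" and v :: "'a \<Rightarrow> real^'r"
  assumes "A \<in> borel_measurable M" "v \<in> borel_measurable M"
  shows "(\<lambda>\<omega>. A \<omega> *v v \<omega>) \<in> borel_measurable M"
proof -
  have "continuous_on UNIV (\<lambda>z :: (real^'r^'d) \<times> (real^'r). fst z *v snd z)"
    by (auto simp: matrix_vector_mult_def intro!: continuous_on_vec_lambda continuous_intros)
  then show ?thesis using assms by (rule borel_measurable_continuous_Pair[rotated 2])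
qed

context wiener_space
begin

text \<open>Progressive measurability speaks only about times in \<open>[0, T]\<close>; clamping the
  time argument turns it into joint measurability on the whole line. The identity from
  \<open>M\<close> to \<open>\<F> T\<close> is measurable because the filtration consists of
  events.\<close>

lemma progressive_jointly_measurable:
  fixes H :: "real \<Rightarrow> 'w \<Rightarrow> 'x::topological_space"
  assumes H: "(\<lambda>(t, \<omega>). H t \<omega>) \<in> borel_measurable (restrict_space borel {0..T} \<Otimes>\<^sub>M \<F> T)" and T: "0 \<le> T"
  shows "(\<lambda>(\<omega>, v). H (max 0 (min T v)) \<omega>) \<in> borel_measurable (M \<Otimes>\<^sub>M lborel)"
proof -
  have sub: "id \<in> M \<rightarrow>\<^sub>M \<F> T"
    using driving_filtration_subset[OF x0 wM, of T] by (auto simp: measurable_def)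
  have 1: "(\<lambda>z. max 0 (min T (snd z))) \<in> (M \<Otimes>\<^sub>M lborel) \<rightarrow>\<^sub>M restrict_space borel {0..T}"
    using T by (intro measurable_restrict_space2) auto
  have 2: "(\<lambda>z. fst z) \<in> (M \<Otimes>\<^sub>M lborel) \<rightarrow>\<^sub>M \<F> T"
    using measurable_comp[OF measurable_fst sub] by (simp add: comp_def)
  show ?thesis
    using measurable_compose[OF measurable_Pair[OF 1 2] H] by (simp add: case_prod_beta')
qed

text \<open>The bound for simple integrals passes to the limit because it contains only
  probabilities. Half of \<open>2 * \<delta>\<close> is spent on the approximation of
  \<open>I t\<close> and \<open>I s\<close>, and \<open>K / 4\<close> arises from
  \<open>|P|^2 \<le> 2 |H|^2 + 2 |H - P|^2\<close>.\<close>

lemma ito_increment_prob: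
  fixes u :: "real^'d"
  assumes I: "has_ito_integral M \<F> w H I" and st: "0 \<le> s" "s < t" and K: "0 < K" and \<delta>: "0 < \<delta>"
  shows "prob {\<omega>\<in>space M. 2 * \<delta> < \<bar>u \<bullet> (I t \<omega> - I s \<omega>)\<bar>} \<le>
    prob {\<omega>\<in>space M. ennreal (K / 4) < (\<integral>\<^sup>+ v\<in>{s..t}. ennreal ((norm (H (max 0 (min t v)) \<omega>))^2) \<partial>lborel)}
      + (norm u)^2 * K / \<delta>^2"
proof -
  define E where "E = {\<omega>\<in>space M. 2 * \<delta> < \<bar>u \<bullet> (I t \<omega> - I s \<omega>)\<bar>}"
  have t0: "0 \<le> t" using st by simp
  obtain N \<tau> \<xi> where *: "\<forall>n::nat. simple_integrand M \<F> (N n) (\<tau> n) (\<xi> n)"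
    "\<forall>T\<ge>0. \<forall>e>0. (\<lambda>n. prob {\<omega> \<in> space M. ennreal e <
        (\<integral>\<^sup>+ s\<in>{0..T}. ennreal ((norm (H s \<omega> - simple_process (N n) (\<tau> n) (\<xi> n) s \<omega>))^2) \<partial>lborel)}) \<longlonglongrightarrow> 0"
    "\<forall>t\<ge>0. tendsto_in_prob M (\<lambda>n. simple_integral w (N n) (\<tau> n) (\<xi> n) t) (I t) sequentially"
  proof -
    from I have "\<exists>N \<tau> \<xi>. (\<forall>n::nat. simple_integrand M \<F> (N n) (\<tau> n) (\<xi> n)) \<and>
        (\<forall>T\<ge>0. \<forall>e>0. (\<lambda>n. prob {\<omega> \<in> space M. ennreal e <
          (\<integral>\<^sup>+ s\<in>{0..T}. ennreal ((norm (H s \<omega> - simple_process (N n) (\<tau> n) (\<xi> n) s \<omega>))^2) \<partial>lborel)}) \<longlonglongrightarrow> 0) \<and>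
        (\<forall>t\<ge>0. tendsto_in_prob M (\<lambda>n. simple_integral w (N n) (\<tau> n) (\<xi> n) t) (I t) sequentially)"
      unfolding has_ito_integral_def by (elim conjE)
    then show thesis by (elim exE conjE) (rule that)
  qed
  note S = *(1)[rule_format] and conv = *(2)[rule_format] and lim = *(3)[rule_format]
  have IM[measurable]: "I v \<in> borel_measurable M" if "0 \<le> v" for v
    using I \<F>_measurable that unfolding has_ito_integral_def by blast
  define SI where "SI n v = simple_integral w (N n) (\<tau> n) (\<xi> n) v" for n v
  have SIM: "SI n v \<in> borel_measurable M" if v: "0 \<le> v" for n v
    unfolding SI_def simple_integral_def[abs_def]
  proof (rule borel_measurable_sum)
    fix i assume i: "i \<in> {..<N n}"
    have m: "0 \<le> \<tau> n i" if "i \<le> N n" for i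
      using that
    proof (induction i)
      case 0 then show ?case using S[of n] unfolding simple_integrand_def by auto
    next
      case (Suc i)
      then have "\<tau> n i < \<tau> n (Suc i)" using S[of n] unfolding simple_integrand_def by auto
      then show ?case using Suc by auto
    qed
    have \<xi>[measurable]: "\<xi> n i \<in> borel_measurable M"
      using S[of n] i \<F>_measurable unfolding simple_integrand_def by blast
    have [measurable]: "w (min v (\<tau> n (Suc i))) \<in> borel_measurable M" "w (min v (\<tau> n i)) \<in> borel_measurable M"
      using wM v m[of i] m[of "Suc i"] i by auto
    show "(\<lambda>\<omega>. \<xi> n i \<omega> *v (w (min v (\<tau> n (Suc i))) \<omega> - w (min v (\<tau> n i)) \<omega>)) \<in> borel_measurable M"
      by (rule borel_measurable_matrix_vector_mult) measurable
  qed
  define P where "P n v \<omega> = simple_process (N n) (\<tau> n) (\<xi> n) v \<omega>" for n v \<omega>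
  have PM[measurable]: "(\<lambda>(\<omega>, v). P n v \<omega>) \<in> borel_measurable (M \<Otimes>\<^sub>M lborel)" for n
    unfolding P_def by (rule simple_process_measurable[OF S])
  define H' where "H' v \<omega> = H (max 0 (min t v)) \<omega>" for v \<omega>
  have HM[measurable]: "(\<lambda>(\<omega>, v). H' v \<omega>) \<in> borel_measurable (M \<Otimes>\<^sub>M lborel)"
    unfolding H'_def using I t0 unfolding has_ito_integral_def by (intro progressive_jointly_measurable) auto
  \<comment> \<open>An error of \<open>e\<close> at each of the two times changes the inner product
    with \<open>u\<close> by at most \<open>\<delta>\<close> in total; the summand 1 covers
    \<open>u = 0\<close>.\<close>
  define e where "e = \<delta> / (2 * (norm u + 1))"
  have e: "0 < e" "norm u * e \<le> \<delta> / 2"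
    using \<delta> norm_ge_zero[of u] by (auto simp: e_def divide_simps add_nonneg_pos intro!: add_pos_nonneg)
  define E1 where "E1 = {\<omega>\<in>space M. ennreal (K / 4) < (\<integral>\<^sup>+ v\<in>{s..t}. ennreal ((norm (H' v \<omega>))^2) \<partial>lborel)}"
  define E2 where "E2 n = {\<omega>\<in>space M. ennreal (K / 4) < (\<integral>\<^sup>+ v\<in>{0..t}. ennreal ((norm (H' v \<omega> - P n v \<omega>))^2) \<partial>lborel)}" for n
  define E3 where "E3 n v = {\<omega>\<in>space M. e < dist (SI n v \<omega>) (I v \<omega>)}" for n v
  define A where "A n = {\<omega>\<in>space M. ennreal K < (\<integral>\<^sup>+ v\<in>{s..t}. ennreal ((norm (P n v \<omega>))^2) \<partial>lborel)}" for n
  define B where "B n = {\<omega>\<in>space M. \<delta> < \<bar>u \<bullet> (SI n t \<omega> - SI n s \<omega>)\<bar>}" for n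
  have [measurable]: "E1 \<in> events" "E2 n \<in> events" for n
    unfolding E1_def E2_def by measurable
  have E3M: "E3 n v \<in> events" if "0 \<le> v" for n v
    unfolding E3_def using SIM[OF that] IM[OF that] by measurable
  have [measurable]: "E3 n t \<in> events" "E3 n s \<in> events" for n
    using E3M t0 st by auto
  have [measurable]: "B n \<in> events" for n
    unfolding B_def using SIM[OF t0, of n] SIM[OF st(1), of n] by measurable
  have A_sub: "A n \<subseteq> E1 \<union> E2 n" for n
  proof
    fix \<omega> assume \<omega>: "\<omega> \<in> A n"
    show "\<omega> \<in> E1 \<union> E2 n"
    proof (rule ccontr)
      assume "\<omega> \<notin> E1 \<union> E2 n"
      then have le: "(\<integral>\<^sup>+ v\<in>{s..t}. ennreal ((norm (H' v \<omega>))^2) \<partial>lborel) \<le> ennreal (K / 4)"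
        "(\<integral>\<^sup>+ v\<in>{0..t}. ennreal ((norm (H' v \<omega> - P n v \<omega>))^2) \<partial>lborel) \<le> ennreal (K / 4)"
        using \<omega> by (auto simp: E1_def E2_def A_def)
      have \<omega>M: "\<omega> \<in> space M" using \<omega> by (auto simp: A_def)
      have [measurable]: "(\<lambda>v. H' v \<omega>) \<in> borel_measurable lborel" "(\<lambda>v. P n v \<omega>) \<in> borel_measurable lborel"
        using measurable_compose[OF measurable_Pair1'[OF \<omega>M] HM] measurable_compose[OF measurable_Pair1'[OF \<omega>M] PM]
        by auto
      have "(\<integral>\<^sup>+ v\<in>{s..t}. ennreal ((norm (P n v \<omega>))^2) \<partial>lborel) \<le>
        (\<integral>\<^sup>+ v. 2 * (ennreal ((norm (H' v \<omega>))^2) * indicator {s..t} v)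
          + 2 * (ennreal ((norm (H' v \<omega> - P n v \<omega>))^2) * indicator {0..t} v) \<partial>lborel)"
      proof (rule nn_integral_mono)
        fix v
        have "(norm (P n v \<omega>))^2 \<le> (norm (H' v \<omega>) + norm (H' v \<omega> - P n v \<omega>))^2"
          using norm_triangle_ineq[of "H' v \<omega>" "P n v \<omega> - H' v \<omega>"]
          by (intro power_mono) (auto simp: norm_minus_commute)
        also have "\<dots> \<le> 2 * (norm (H' v \<omega>))^2 + 2 * (norm (H' v \<omega> - P n v \<omega>))^2"
          using sum_squares_bound[of "norm (H' v \<omega>)" "norm (H' v \<omega> - P n v \<omega>)"] by (simp add: power2_sum)
        finally have "ennreal ((norm (P n v \<omega>))^2) \<le> ennreal (2 * (norm (H' v \<omega>))^2 + 2 * (norm (H' v \<omega> - P n v \<omega>))^2)"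
          by (rule ennreal_leI)
        then have "ennreal ((norm (P n v \<omega>))^2) \<le> 2 * ennreal ((norm (H' v \<omega>))^2) + 2 * ennreal ((norm (H' v \<omega> - P n v \<omega>))^2)"
          by (simp add: ennreal_plus ennreal_mult')
        then show "ennreal ((norm (P n v \<omega>))^2) * indicator {s..t} v \<le>
           2 * (ennreal ((norm (H' v \<omega>))^2) * indicator {s..t} v)
          + 2 * (ennreal ((norm (H' v \<omega> - P n v \<omega>))^2) * indicator {0..t} v)"
          using st by (auto split: split_indicator)
      qed
      also have "\<dots> = 2 * (\<integral>\<^sup>+ v\<in>{s..t}. ennreal ((norm (H' v \<omega>))^2) \<partial>lborel)
        + 2 * (\<integral>\<^sup>+ v\<in>{0..t}. ennreal ((norm (H' v \<omega> - P n v \<omega>))^2) \<partial>lborel)"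
        by (simp add: nn_integral_add nn_integral_cmult)
      also have "\<dots> \<le> 2 * ennreal (K / 4) + 2 * ennreal (K / 4)"
        using le by (intro add_mono mult_left_mono) auto
      also have "\<dots> = ennreal K"
      proof -
        have "ennreal K = ennreal (2 * (K / 4) + 2 * (K / 4))" by simp
        also have "\<dots> = 2 * ennreal (K / 4) + 2 * ennreal (K / 4)"
          using K by (subst ennreal_plus) (auto simp: ennreal_mult' simp del: times_divide_eq_right)
        finally show ?thesis by simp
      qed
      finally show False using \<omega> by (auto simp: A_def)
    qed
  qed
  have bound: "prob E \<le>
     (prob E1 + (norm u)^2 * K / \<delta>^2) + (prob (E2 n) + prob (E3 n t) + prob (E3 n s))" for n
  proof -
    have "prob E \<le> prob (B n \<union> (E3 n t \<union> E3 n s))"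
    proof (rule finite_measure_mono)
      show "E \<subseteq> B n \<union> (E3 n t \<union> E3 n s)"
      proof
        fix \<omega> assume "\<omega> \<in> E"
        then have \<omega>: "\<omega> \<in> space M" "2 * \<delta> < \<bar>u \<bullet> (I t \<omega> - I s \<omega>)\<bar>" by (auto simp: E_def)
        show "\<omega> \<in> B n \<union> (E3 n t \<union> E3 n s)"
        proof (rule ccontr)
          assume "\<omega> \<notin> B n \<union> (E3 n t \<union> E3 n s)"
          then have *: "\<bar>u \<bullet> (SI n t \<omega> - SI n s \<omega>)\<bar> \<le> \<delta>" "norm (SI n t \<omega> - I t \<omega>) \<le> e" "norm (SI n s \<omega> - I s \<omega>) \<le> e"
            using \<omega> by (auto simp: B_def E3_def dist_norm)
          have c: "\<bar>u \<bullet> x\<bar> \<le> \<delta> / 2" if "norm x \<le> e" for x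
          proof -
            have "\<bar>u \<bullet> x\<bar> \<le> norm u * norm x" by (rule Cauchy_Schwarz_ineq2)
            also have "\<dots> \<le> norm u * e" using that by (intro mult_left_mono) auto
            finally show ?thesis using e by simp
          qed
          have "u \<bullet> (I t \<omega> - I s \<omega>) = u \<bullet> (SI n t \<omega> - SI n s \<omega>) - u \<bullet> (SI n t \<omega> - I t \<omega>) + u \<bullet> (SI n s \<omega> - I s \<omega>)"
            by (simp add: inner_diff_right)
          then show False using * c[OF *(2)] c[OF *(3)] \<omega> by auto
        qed
      qed
    qed measurable
    also have "\<dots> \<le> prob (B n) + prob (E3 n t \<union> E3 n s)" by (rule measure_Un_le) measurable
    also have "prob (E3 n t \<union> E3 n s) \<le> prob (E3 n t) + prob (E3 n s)" by (rule measure_Un_le) measurable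
    also have "prob (B n) \<le> prob (A n) + (norm u)^2 * K / \<delta>^2"
      unfolding B_def A_def SI_def P_def using K by (intro simple_integral_increment_prob[OF S st _ \<delta>]) auto
    also have "prob (A n) \<le> prob (E1 \<union> E2 n)" by (rule finite_measure_mono[OF A_sub]) measurable
    also have "\<dots> \<le> prob E1 + prob (E2 n)" by (rule measure_Un_le) measurable
    finally show ?thesis by simp
  qed
  have "(\<lambda>n. prob (E2 n)) \<longlonglongrightarrow> 0"
  proof -
    have "E2 n = {\<omega> \<in> space M. ennreal (K / 4) <
        (\<integral>\<^sup>+ s\<in>{0..t}. ennreal ((norm (H s \<omega> - simple_process (N n) (\<tau> n) (\<xi> n) s \<omega>))^2) \<partial>lborel)}" for n
    proof -
      have "(\<integral>\<^sup>+ v\<in>{0..t}. ennreal ((norm (H' v \<omega> - P n v \<omega>))^2) \<partial>lborel) =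
        (\<integral>\<^sup>+ s\<in>{0..t}. ennreal ((norm (H s \<omega> - simple_process (N n) (\<tau> n) (\<xi> n) s \<omega>))^2) \<partial>lborel)" for \<omega>
        by (intro nn_integral_cong) (auto simp: H'_def P_def split: split_indicator)
      then show ?thesis by (simp add: E2_def)
    qed
    then show ?thesis using conv[OF t0, of "K / 4"] K by simp
  qed
  moreover have "(\<lambda>n. prob (E3 n v)) \<longlonglongrightarrow> 0" if "0 \<le> v" for v
    using lim[OF that] e(1) unfolding tendsto_in_prob_def E3_def SI_def by blast
  ultimately have "(\<lambda>n. (prob E1 + (norm u)^2 * K / \<delta>^2) + (prob (E2 n) + prob (E3 n t) + prob (E3 n s)))
     \<longlonglongrightarrow> (prob E1 + (norm u)^2 * K / \<delta>^2) + (0 + 0 + 0)"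
    using t0 st by (intro tendsto_intros) auto
  \<comment> \<open>The left side does not depend on \<open>n\<close>, so the approximation errors
    disappear in the limit.\<close>
  then have "prob E \<le> (prob E1 + (norm u)^2 * K / \<delta>^2) + (0 + 0 + 0)"
    using bound by (intro LIMSEQ_le_const) auto
  then show ?thesis unfolding E_def E1_def H'_def by simp
qed

end

lemma integral_increment_norm_le:
  fixes g :: "real \<Rightarrow> 'b::euclidean_space"
  assumes g: "continuous_on {0..} g" and st: "0 \<le> s" "s \<le> t"
  shows "ennreal (norm ((LINT v:{0..t}|lborel. g v) - (LINT v:{0..s}|lborel. g v))) \<le>
    (\<integral>\<^sup>+ v\<in>{s..t}. ennreal (norm (g v)) \<partial>lborel)"
proof -
  have i: "set_integrable lborel {a..b} g" if "0 \<le> a" for a b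
    unfolding set_integrable_def using that
    by (intro borel_integrable_compact continuous_on_subset[OF g]) auto
  have i2: "set_integrable lborel {s<..t} g"
    by (rule set_integrable_subset[OF i[of s t]]) (use st in auto)
  have "{0..t} = {0..s} \<union> {s<..t}" using st by auto
  then have "(LINT v:{0..t}|lborel. g v) = (LINT v:{0..s}|lborel. g v) + (LINT v:{s<..t}|lborel. g v)"
    by (simp only:, intro set_integral_Un i i2) auto
  then have "ennreal (norm ((LINT v:{0..t}|lborel. g v) - (LINT v:{0..s}|lborel. g v))) =
    ennreal (norm (LINT v:{s<..t}|lborel. g v))" by simp
  also have "\<dots> \<le> (\<integral>\<^sup>+ v. norm (indicator {s<..t} v *\<^sub>R g v) \<partial>lborel)"
    unfolding set_lebesgue_integral_def
    using i2 unfolding set_integrable_def by (rule integral_norm_bound_ennreal)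
  also have "\<dots> \<le> (\<integral>\<^sup>+ v\<in>{s..t}. ennreal (norm (g v)) \<partial>lborel)"
    by (intro nn_integral_mono) (auto split: split_indicator)
  finally show ?thesis .
qed

text \<open>The increment is a drift integral plus an increment of the Ito integral. Both are
  controlled by time integrals over \<open>[s, t]\<close> whose means are at most
  \<open>t - s\<close> times a constant built from \<open>B\<close> and \<open>C\<close>, so
  \<open>d\<close> can be chosen independently of \<open>s\<close>.\<close>

lemma (in wiener_space) sde_increment_small_prob:
  fixes u :: "real^'d" and a :: "real^'d \<Rightarrow> real^'r^'d" and b :: "real^'d \<Rightarrow> real^'d"
  assumes X: "sde_solution M w b a x0 X" and b: "continuous_on UNIV b"
    and C: "0 < C" "\<And>x. norm (b x) \<le> C * (1 + norm x)" "\<And>x. norm (a x) \<le> C * (1 + norm x)"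
    and B: "0 \<le> B" "\<And>t. 0 \<le> t \<Longrightarrow> (\<integral>\<^sup>+ \<omega>. ennreal ((1 + norm (X t \<omega>))^2) \<partial>M) \<le> ennreal B"
    and \<kappa>: "0 < \<kappa>" and \<eta>: "0 < \<eta>"
  shows "\<exists>d>0. \<forall>s t. 0 \<le> s \<longrightarrow> s < t \<longrightarrow> t \<le> s + d \<longrightarrow> prob {\<omega>\<in>space M. \<kappa> < \<bar>u \<bullet> (X t \<omega> - X s \<omega>)\<bar>} \<le> \<eta>"
proof -
  obtain I where I: "has_ito_integral M \<F> w (\<lambda>t \<omega>. a (X t \<omega>)) I"
    and eq: "AE \<omega> in M. \<forall>t\<ge>0. X t \<omega> = x0 \<omega> + (LINT s:{0..t}|lborel. b (X s \<omega>)) + I t \<omega>"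
    using X unfolding sde_solution_def by blast
  have XM: "X t \<in> borel_measurable M" if "0 \<le> t" for t
    using X \<F>_measurable that unfolding sde_solution_def by blast
  have Xc: "continuous_on {0..} (\<lambda>t. X t \<omega>)" if "\<omega> \<in> space M" for \<omega>
    using X that unfolding sde_solution_def by blast
  have IM: "I t \<in> borel_measurable M" if "0 \<le> t" for t
    using I \<F>_measurable that unfolding has_ito_integral_def by blast
  \<comment> \<open>\<open>\<kappa>\<close> is shared as \<open>\<delta>\<close> for the drift and
    \<open>2 * \<delta>\<close> for the Ito increment. The probability \<open>\<eta>\<close> is
    split into thirds: \<open>K\<close> makes the variance term at most \<open>\<eta> / 3\<close>,
    and \<open>d\<close> does the same for each of the two Markov bounds.\<close>
  define \<delta> where "\<delta> = \<kappa> / 3"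
  define U where "U = norm u + 1"
  define K where "K = \<eta> * \<delta>^2 / (3 * U^2)"
  have \<delta>: "0 < \<delta>" and U: "0 < U" "norm u \<le> U" using \<kappa> by (auto simp: \<delta>_def U_def add_nonneg_pos)
  have K: "0 < K" using \<eta> \<delta> U by (simp add: K_def)
  have "(norm u)^2 * K / \<delta>^2 \<le> U^2 * K / \<delta>^2"
    using U K by (intro divide_right_mono mult_right_mono power_mono) auto
  also have "\<dots> = \<eta> / 3" using U \<delta> by (simp add: K_def)
  finally have Kb: "(norm u)^2 * K / \<delta>^2 \<le> \<eta> / 3" .
  define d where "d = min (\<eta> / 3 * (K / 4) / (C^2 * B + 1)) (\<eta> / 3 * (\<delta> / U) / (C * B + 1))"
  have CB: "0 \<le> C^2 * B" "0 \<le> C * B" using C B by auto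
  have d: "0 < d" using \<eta> K \<delta> U CB by (simp add: d_def add_nonneg_pos)
  show ?thesis
  proof (intro exI conjI allI impI)
    show "0 < d" by fact
    fix s t assume st: "0 \<le> s" "s < t" "t \<le> s + d"
    then have t0: "0 \<le> t" by simp
    let ?E = "{\<omega>\<in>space M. \<kappa> < \<bar>u \<bullet> (X t \<omega> - X s \<omega>)\<bar>}"
    define E1 where "E1 = {\<omega>\<in>space M. ennreal (K / 4) < (\<integral>\<^sup>+ v\<in>{s..t}. ennreal ((norm (a (X (max 0 (min t v)) \<omega>)))^2) \<partial>lborel)}"
    define E2 where "E2 = {\<omega>\<in>space M. ennreal (\<delta> / U) < (\<integral>\<^sup>+ v\<in>{s..t}. ennreal (norm (b (X (max 0 v) \<omega>))) \<partial>lborel)}"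
    define E3 where "E3 = {\<omega>\<in>space M. 2 * \<delta> < \<bar>u \<bullet> (I t \<omega> - I s \<omega>)\<bar>}"
    have aXM[measurable]: "(\<lambda>(\<omega>, v). a (X (max 0 (min t v)) \<omega>)) \<in> borel_measurable (M \<Otimes>\<^sub>M lborel)"
      using I t0 unfolding has_ito_integral_def by (intro progressive_jointly_measurable) auto
    have bXM[measurable]: "(\<lambda>(\<omega>, v). b (X (max 0 v) \<omega>)) \<in> borel_measurable (M \<Otimes>\<^sub>M lborel)"
      using measurable_compose[OF joint_measurable_continuous_paths[OF XM Xc] borel_measurable_continuous_onI[OF b]]
      by (simp add: case_prod_beta')
    have E2M: "E2 \<in> events" unfolding E2_def by measurable
    have E3M: "E3 \<in> events" unfolding E3_def using IM[OF t0] IM[OF st(1)] by measurable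
    have P1: "prob E1 \<le> (C^2 * B) * (t - s) / (K / 4)"
      unfolding E1_def
    proof (rule time_integral_markov)
      fix v assume v: "s \<le> v" "v \<le> t"
      then have "0 \<le> v" using st by simp
      have [measurable]: "X v \<in> borel_measurable M" by (rule XM) fact
      have "(\<integral>\<^sup>+ \<omega>. ennreal ((norm (a (X (max 0 (min t v)) \<omega>)))^2) \<partial>M) \<le>
        (\<integral>\<^sup>+ \<omega>. ennreal (C^2) * ennreal ((1 + norm (X v \<omega>))^2) \<partial>M)"
      proof (rule nn_integral_mono)
        fix \<omega>
        have "(norm (a (X v \<omega>)))^2 \<le> (C * (1 + norm (X v \<omega>)))^2" using C by (intro power_mono) auto
        then show "ennreal ((norm (a (X (max 0 (min t v)) \<omega>)))^2) \<le> ennreal (C^2) * ennreal ((1 + norm (X v \<omega>))^2)"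
          using v \<open>0 \<le> v\<close> by (simp add: power_mult_distrib min_def flip: ennreal_mult)
      qed
      also have "\<dots> = ennreal (C^2) * (\<integral>\<^sup>+ \<omega>. ennreal ((1 + norm (X v \<omega>))^2) \<partial>M)"
        by (rule nn_integral_cmult) measurable
      also have "\<dots> \<le> ennreal (C^2) * ennreal B" using B(2)[OF \<open>0 \<le> v\<close>] by (rule mult_left_mono) simp
      also have "\<dots> = ennreal (C^2 * B)" using B by (simp add: ennreal_mult)
      finally show "(\<integral>\<^sup>+ \<omega>. ennreal ((norm (a (X (max 0 (min t v)) \<omega>)))^2) \<partial>M) \<le> ennreal (C^2 * B)" .
    qed (use CB st K in \<open>auto simp: measurable_split_conv\<close>)
    have P2: "prob E2 \<le> (C * B) * (t - s) / (\<delta> / U)"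
      unfolding E2_def
    proof (rule time_integral_markov)
      fix v assume v: "s \<le> v" "v \<le> t"
      then have "0 \<le> v" using st by simp
      have [measurable]: "X v \<in> borel_measurable M" by (rule XM) fact
      have "(\<integral>\<^sup>+ \<omega>. ennreal (norm (b (X (max 0 v) \<omega>))) \<partial>M) \<le>
        (\<integral>\<^sup>+ \<omega>. ennreal C * ennreal ((1 + norm (X v \<omega>))^2) \<partial>M)"
      proof (rule nn_integral_mono)
        fix \<omega>
        \<comment> \<open>Squaring lets the drift use the same moment bound \<open>B\<close> as the
          diffusion coefficient.\<close>
        have "1 + norm (X v \<omega>) \<le> (1 + norm (X v \<omega>))^2" by (simp add: power2_eq_square algebra_simps)
        then have "C * (1 + norm (X v \<omega>)) \<le> C * (1 + norm (X v \<omega>))^2" using C(1) by (intro mult_left_mono) auto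
        then have "norm (b (X v \<omega>)) \<le> C * (1 + norm (X v \<omega>))^2" using C(2)[of "X v \<omega>"] by linarith
        then show "ennreal (norm (b (X (max 0 v) \<omega>))) \<le> ennreal C * ennreal ((1 + norm (X v \<omega>))^2)"
          using C(1) \<open>0 \<le> v\<close> by (simp flip: ennreal_mult)
      qed
      also have "\<dots> = ennreal C * (\<integral>\<^sup>+ \<omega>. ennreal ((1 + norm (X v \<omega>))^2) \<partial>M)"
        by (rule nn_integral_cmult) measurable
      also have "\<dots> \<le> ennreal C * ennreal B" using B(2)[OF \<open>0 \<le> v\<close>] by (rule mult_left_mono) simp
      also have "\<dots> = ennreal (C * B)" using B C by (simp add: ennreal_mult)
      finally show "(\<integral>\<^sup>+ \<omega>. ennreal (norm (b (X (max 0 v) \<omega>))) \<partial>M) \<le> ennreal (C * B)" .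
    qed (use CB st \<delta> U in \<open>auto simp: measurable_split_conv\<close>)
    have small: "x * (t - s) / y \<le> \<eta> / 3" if "0 \<le> x" "0 < y" "d \<le> \<eta> / 3 * y / (x + 1)" for x y
    proof -
      have "x * (t - s) \<le> (x + 1) * d" using st that d by (intro mult_mono) auto
      also have "\<dots> \<le> \<eta> / 3 * y" using that by (simp add: field_simps)
      finally show ?thesis using that by (simp add: divide_simps mult.commute)
    qed
    have P1': "prob E1 \<le> \<eta> / 3" using P1 small[OF CB(1), of "K / 4"] K by (simp add: d_def)
    have P2': "prob E2 \<le> \<eta> / 3"
      by (rule order_trans[OF P2 small[OF CB(2)]]) (use \<delta> U in \<open>auto simp: d_def\<close>)
    have P3: "prob E3 \<le> prob E1 + (norm u)^2 * K / \<delta>^2"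
      unfolding E1_def E3_def by (rule ito_increment_prob[OF I st(1,2) K \<delta>])
    have "prob ?E \<le> prob (E2 \<union> E3)"
    proof (rule finite_measure_mono_AE)
      show "AE \<omega> in M. \<omega> \<in> ?E \<longrightarrow> \<omega> \<in> E2 \<union> E3"
        using eq
      proof eventually_elim
        fix \<omega> assume eq: "\<forall>t\<ge>0. X t \<omega> = x0 \<omega> + (LINT s:{0..t}|lborel. b (X s \<omega>)) + I t \<omega>"
        show "\<omega> \<in> ?E \<longrightarrow> \<omega> \<in> E2 \<union> E3"
        proof (rule impI, rule ccontr)
          assume "\<omega> \<in> ?E" and n: "\<omega> \<notin> E2 \<union> E3"
          then have \<omega>: "\<omega> \<in> space M" "\<kappa> < \<bar>u \<bullet> (X t \<omega> - X s \<omega>)\<bar>" by auto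
          define J where "J = (LINT v:{0..t}|lborel. b (X v \<omega>)) - (LINT v:{0..s}|lborel. b (X v \<omega>))"
          have "X t \<omega> - X s \<omega> = J + (I t \<omega> - I s \<omega>)" using eq st t0 by (simp add: J_def)
          then have split: "u \<bullet> (X t \<omega> - X s \<omega>) = u \<bullet> J + u \<bullet> (I t \<omega> - I s \<omega>)" by (simp add: inner_add_right)
          have "continuous_on {0..} (\<lambda>v. b (X v \<omega>))"
            using continuous_on_compose2[OF b Xc[OF \<omega>(1)]] by auto
          then have "ennreal (norm J) \<le> (\<integral>\<^sup>+ v\<in>{s..t}. ennreal (norm (b (X v \<omega>))) \<partial>lborel)"
            unfolding J_def using st by (intro integral_increment_norm_le) auto
          also have "\<dots> = (\<integral>\<^sup>+ v\<in>{s..t}. ennreal (norm (b (X (max 0 v) \<omega>))) \<partial>lborel)"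
            using st by (intro nn_integral_cong) (auto split: split_indicator)
          also have "\<dots> \<le> ennreal (\<delta> / U)" using n \<omega> by (auto simp: E2_def)
          finally have "norm J \<le> \<delta> / U" using \<delta> U by simp
          then have "U * norm J \<le> \<delta>" using U by (simp add: field_simps)
          moreover have "\<bar>u \<bullet> J\<bar> \<le> U * norm J"
            using Cauchy_Schwarz_ineq2[of u J] mult_right_mono[OF U(2), of "norm J"] by simp
          moreover have "\<bar>u \<bullet> (I t \<omega> - I s \<omega>)\<bar> \<le> 2 * \<delta>" using n \<omega> by (auto simp: E3_def)
          ultimately show False using \<omega>(2) split by (simp add: \<delta>_def)
        qed
      qed
    qed (use E2M E3M in auto)
    also have "\<dots> \<le> prob E2 + prob E3" by (rule measure_Un_le[OF E2M E3M])
    also have "\<dots> \<le> \<eta>" using P1' P2' P3 Kb by linarith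
    finally show "prob {\<omega>\<in>space M. \<kappa> < \<bar>u \<bullet> (X t \<omega> - X s \<omega>)\<bar>} \<le> \<eta>" .
  qed
qed

section \<open>Quadratic variations of the noise\<close>

text \<open>Turns smallness in probability into smallness in mean square: where
  \<open>|Y| \<le> \<kappa>\<close> the square is at most \<open>\<kappa>^2\<close>, elsewhere
  \<open>y^2 \<le> l y^4 + 1 / (4 l)\<close>. A small \<open>l\<close> is to be chosen first, and
  then the probability is made small relative to it.\<close>

lemma (in prob_space) second_moment_split:
  assumes [measurable]: "Y \<in> borel_measurable M" and Y4: "integrable M (\<lambda>s. Y s ^ 4)" "expectation (\<lambda>s. Y s ^ 4) \<le> C"
    and l: "0 < l"
  shows "integrable M (\<lambda>s. (Y s)^2)"
    and "expectation (\<lambda>s. (Y s)^2) \<le> \<kappa>^2 + l * C + prob {s\<in>space M. \<kappa> < \<bar>Y s\<bar>} / (4 * l)"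
proof -
  let ?A = "{s\<in>space M. \<kappa> < \<bar>Y s\<bar>}"
  have sq: "y^2 \<le> l * y ^ 4 + 1 / (4 * l)" for y :: real
  proof -
    have "0 \<le> (2 * l * y^2 - 1)^2" by simp
    also have "\<dots> = 4 * l * (l * y ^ 4 + 1 / (4 * l) - y^2)" using l by (simp add: power2_eq_square field_simps eval_nat_numeral)
    finally show ?thesis using l by (simp add: zero_le_mult_iff)
  qed
  have Y2: "integrable M (\<lambda>s. l * Y s ^ 4 + 1 / (4 * l))" using Y4 by auto
  show i: "integrable M (\<lambda>s. (Y s)^2)"
    by (rule Bochner_Integration.integrable_bound[OF Y2]) (use sq in \<open>auto intro: order_trans[OF _ abs_ge_self]\<close>)
  have "expectation (\<lambda>s. (Y s)^2) \<le>
    expectation (\<lambda>s. \<kappa>^2 + l * Y s ^ 4 + indicator ?A s * (1 / (4 * l)))"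
  proof (rule integral_mono[OF i])
    show "integrable M (\<lambda>s. \<kappa>^2 + l * Y s ^ 4 + indicator ?A s * (1 / (4 * l)))"
      using Y4 by (intro Bochner_Integration.integrable_add integrable_mult_right integrable_mult_left
          integrable_real_indicator) (auto simp: emeasure_eq_measure)
    fix s assume s: "s \<in> space M"
    show "(Y s)^2 \<le> \<kappa>^2 + l * Y s ^ 4 + indicator ?A s * (1 / (4 * l))"
    proof (cases "\<kappa> < \<bar>Y s\<bar>")
      case True
      then have "indicator ?A s = (1::real)" using s by simp
      then show ?thesis using sq[of "Y s"] zero_le_power2[of \<kappa>] by (simp only: mult_1)
    next
      case False
      then have "(Y s)^2 \<le> \<kappa>^2" by (intro abs_le_square_iff[THEN iffD1]) auto
      then show ?thesis using False l by (simp add: add_increasing2)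
    qed
  qed
  also have "\<dots> = \<kappa>^2 + l * expectation (\<lambda>s. Y s ^ 4) + prob ?A / (4 * l)"
  proof -
    have A: "integrable M (\<lambda>s. indicator ?A s * (1 / (4 * l)))"
      by (intro integrable_mult_left integrable_real_indicator) (auto simp: emeasure_eq_measure)
    have E: "expectation (\<lambda>s. indicator ?A s * (1 / (4 * l))) = prob ?A / (4 * l)"
      by simp
    have B: "integrable M (\<lambda>s. \<kappa>^2 + l * Y s ^ 4)" using Y4 by auto
    have "expectation (\<lambda>s. \<kappa>^2 + l * Y s ^ 4) = \<kappa>^2 + l * expectation (\<lambda>s. Y s ^ 4)"
      using Y4 by (simp add: prob_space)
    then show ?thesis unfolding Bochner_Integration.integral_add[OF B A] E by simp
  qed
  also have "\<dots> \<le> \<kappa>^2 + l * C + prob ?A / (4 * l)"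
    using Y4 l by (auto intro: mult_left_mono)
  finally show "expectation (\<lambda>s. (Y s)^2) \<le> \<kappa>^2 + l * C + prob ?A / (4 * l)" .
qed

section \<open>Moments of the scalar noise and of orthogonal sums built from it\<close>

lemma (in prob_space) orthogonal_sum_L2:
  fixes f :: "'i \<Rightarrow> 'a \<Rightarrow> real" and C :: real
  assumes I: "finite I" and f2: "\<And>i j. i \<in> I \<Longrightarrow> j \<in> I \<Longrightarrow> integrable M (\<lambda>s. f i s * f j s)"
    and C: "\<And>i. i \<in> I \<Longrightarrow> expectation (\<lambda>s. (f i s)^2) \<le> C"
    and orth: "\<And>i j. i \<in> I \<Longrightarrow> j \<in> I \<Longrightarrow> i \<noteq> j \<Longrightarrow> expectation (\<lambda>s. f i s * f j s) = 0"
  shows "integrable M (\<lambda>s. (\<Sum>i\<in>I. f i s)^2)"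
    and "expectation (\<lambda>s. (\<Sum>i\<in>I. f i s)^2) \<le> card I * C"
proof -
  have eq: "(\<Sum>i\<in>I. f i s)^2 = (\<Sum>i\<in>I. \<Sum>j\<in>I. f i s * f j s)" for s
    by (simp add: power2_eq_square sum_product)
  show "integrable M (\<lambda>s. (\<Sum>i\<in>I. f i s)^2)"
    unfolding eq using f2 by (intro Bochner_Integration.integrable_sum) auto
  have "expectation (\<lambda>s. (\<Sum>i\<in>I. f i s)^2) = (\<Sum>i\<in>I. \<Sum>j\<in>I. expectation (\<lambda>s. f i s * f j s))"
    unfolding eq using f2 by (simp add: Bochner_Integration.integral_sum)
  also have "\<dots> = (\<Sum>i\<in>I. \<Sum>j\<in>I. if j = i then expectation (\<lambda>s. f i s * f i s) else 0)"
    using orth by (intro sum.cong) auto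
  also have "\<dots> = (\<Sum>i\<in>I. expectation (\<lambda>s. (f i s)^2))"
    using I by (simp add: power2_eq_square)
  also have "\<dots> \<le> (\<Sum>i\<in>I. C)" by (intro sum_mono C)
  finally show "expectation (\<lambda>s. (\<Sum>i\<in>I. f i s)^2) \<le> card I * C" by simp
qed

text \<open>In the application \<open>e i\<close> is the projected noise
  \<open>c \<bullet> \<epsilon>\<close> at the \<open>i\<close>-th observation time of one sampling
  design, while \<open>v\<close> and \<open>C\<close> are the same for all designs.\<close>

locale noise_sequence = prob_space M for M :: "'w measure" +
  fixes e :: "nat \<Rightarrow> 'w \<Rightarrow> real" and n :: nat and v C :: real
  assumes e_indep: "indep_vars (\<lambda>_. borel) e {..n}"
    and e4: "i \<le> n \<Longrightarrow> integrable M (\<lambda>s. e i s ^ 4)" "i \<le> n \<Longrightarrow> expectation (\<lambda>s. e i s ^ 4) \<le> C"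
    and e_mean: "i \<le> n \<Longrightarrow> expectation (e i) = 0"
    and e_var: "i \<le> n \<Longrightarrow> expectation (\<lambda>s. (e i s)^2) = v"
begin

lemma e_measurable [measurable (raw)]: "i \<le> n \<Longrightarrow> e i \<in> borel_measurable M"
  using e_indep unfolding indep_vars_def by auto

lemma e_power_integrable: "i \<le> n \<Longrightarrow> m \<le> 4 \<Longrightarrow> integrable M (\<lambda>s. e i s ^ m)"
proof (rule Bochner_Integration.integrable_bound[of _ "\<lambda>s. 1 + e i s ^ 4"])
  assume i: "i \<le> n" "m \<le> 4"
  show "integrable M (\<lambda>s. 1 + e i s ^ 4)" using e4(1)[OF i(1)] by auto
  show "(\<lambda>s. e i s ^ m) \<in> borel_measurable M" using e_measurable[OF i(1)] by measurable
  have "\<bar>x\<bar> ^ m \<le> 1 + \<bar>x\<bar> ^ 4" for x :: real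
  proof (cases "\<bar>x\<bar> \<le> 1")
    case True
    then have "\<bar>x\<bar> ^ m \<le> 1" by (intro power_le_one) auto
    then show ?thesis by (simp add: add_increasing2)
  next
    case False
    then have "\<bar>x\<bar> ^ m \<le> \<bar>x\<bar> ^ 4" using i by (intro power_increasing) auto
    then show ?thesis by simp
  qed
  then show "AE s in M. norm (e i s ^ m) \<le> norm (1 + e i s ^ 4)"
    by (intro AE_I2) (simp add: power_abs abs_of_nonneg[OF add_nonneg_nonneg])
qed

lemma expectation_prod_powers:
  assumes K: "finite K" "K \<subseteq> {..n}" and m: "\<And>i. i \<in> K \<Longrightarrow> m i \<le> 4"
  shows "integrable M (\<lambda>s. \<Prod>i\<in>K. e i s ^ m i)"
    and "expectation (\<lambda>s. \<Prod>i\<in>K. e i s ^ m i) = (\<Prod>i\<in>K. expectation (\<lambda>s. e i s ^ m i))"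
proof -
  have iv: "indep_vars (\<lambda>_. borel) (\<lambda>i s. e i s ^ m i) K"
    by (rule indep_vars_compose2[OF indep_vars_subset[OF e_indep K(2)]]) simp
  have int: "i \<in> K \<Longrightarrow> integrable M (\<lambda>s. e i s ^ m i)" for i
    using K m by (intro e_power_integrable) auto
  show "integrable M (\<lambda>s. \<Prod>i\<in>K. e i s ^ m i)"
    by (rule indep_vars_integrable[OF K(1) iv int])
  show "expectation (\<lambda>s. \<Prod>i\<in>K. e i s ^ m i) = (\<Prod>i\<in>K. expectation (\<lambda>s. e i s ^ m i))"
    by (rule indep_vars_lebesgue_integral[OF K(1) iv int])
qed

lemma expectation_powers2:
  assumes "i \<le> n" "j \<le> n" "i \<noteq> j" "p \<le> 4" "q \<le> 4"
  shows "integrable M (\<lambda>s. e i s ^ p * e j s ^ q)"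
    and "expectation (\<lambda>s. e i s ^ p * e j s ^ q) = expectation (\<lambda>s. e i s ^ p) * expectation (\<lambda>s. e j s ^ q)"
  using expectation_prod_powers[of "{i, j}" "\<lambda>l. if l = i then p else q"] assms by auto

text \<open>Indices may coincide, so the product is first rewritten as a product of powers over
  distinct indices. If \<open>i\<close> differs from the others, its exponent is 1 and its factor
  has mean zero.\<close>

lemma expectation_product4:
  assumes "i \<le> n" "a \<le> n" "b \<le> n" "c \<le> n"
  shows "integrable M (\<lambda>s. (e i s * e a s) * (e b s * e c s))"
    and "i \<notin> {a, b, c} \<Longrightarrow> expectation (\<lambda>s. (e i s * e a s) * (e b s * e c s)) = 0"
proof -
  define m :: "nat \<Rightarrow> nat" where "m k = of_bool (k = i) + of_bool (k = a) + of_bool (k = b) + of_bool (k = c)" for k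
  let ?K = "{i, a, b, c}"
  have d: "(\<Prod>k\<in>?K. y k ^ of_bool (k = l)) = (y l :: real)" if "l \<in> ?K" for l y
  proof -
    have "(\<Prod>k\<in>?K. y k ^ of_bool (k = l)) = (\<Prod>k\<in>?K. if k = l then y l else 1)"
      by (intro prod.cong) auto
    then show ?thesis using that by (simp add: prod.delta del: insert_iff prod.insert)
  qed
  have eq: "(\<Prod>k\<in>?K. y k ^ m k) = (y i * y a) * (y b * y c)" for y :: "nat \<Rightarrow> real"
    unfolding m_def power_add prod.distrib by (simp only: d insert_iff simp_thms mult.assoc)
  have m4: "m k \<le> 4" for k by (auto simp: m_def)
  note p = expectation_prod_powers[of ?K m, unfolded eq]
  show "integrable M (\<lambda>s. (e i s * e a s) * (e b s * e c s))" using p(1) assms m4 by auto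
  assume "i \<notin> {a, b, c}"
  then have "m i = 1" by (simp add: m_def)
  then have "(\<Prod>k\<in>?K. expectation (\<lambda>s. e k s ^ m k)) = 0"
    using e_mean[OF assms(1)] by (intro prod_zero) auto
  then show "expectation (\<lambda>s. (e i s * e a s) * (e b s * e c s)) = 0"
    using p(2) assms m4 by auto
qed

lemma variance_sq_le: "i \<le> n \<Longrightarrow> expectation (\<lambda>s. ((e i s)^2 - v)^2) = expectation (\<lambda>s. e i s ^ 4) - v^2"
proof -
  assume i: "i \<le> n"
  have "((e i s)^2 - v)^2 = e i s ^ 4 - 2 * v * (e i s)^2 + v^2" for s
    by (simp add: power2_eq_square eval_nat_numeral algebra_simps)
  then show ?thesis
    using e4(1)[OF i] e_power_integrable[OF i, of 2] e_var[OF i]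
    by (simp add: prob_space power2_eq_square)
qed

text \<open>Nonnegativity of the variance of \<open>(e 0)^2\<close>. It lets the second moment
  \<open>v^2\<close> of a product of two distinct noise variables share the bound \<open>C\<close>
  of the fourth moments.\<close>

lemma v2_le: "v^2 \<le> C"
proof -
  have "0 \<le> expectation (\<lambda>s. ((e 0 s)^2 - v)^2)" by simp
  then show ?thesis using variance_sq_le[of 0] e4(2)[of 0] by simp
qed

text \<open>The injection \<open>g\<close> covers at once the index patterns of both sums of
  squares: all indices or the even ones, each with or without a shift.\<close>

lemma sum_squares_L2:
  assumes g: "inj_on g {..<N}" "\<And>i. i < N \<Longrightarrow> g i \<le> n"
  shows "integrable M (\<lambda>s. (\<Sum>i<N. (e (g i) s)^2 - v)^2)"
    and "expectation (\<lambda>s. (\<Sum>i<N. (e (g i) s)^2 - v)^2) \<le> real N * C"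
proof -
  have eq: "((e i s)^2 - v) * ((e j s)^2 - v) = (e i s)^2 * (e j s)^2 - v * (e i s)^2 - v * (e j s)^2 + v^2" for i j s
    by (simp add: algebra_simps power2_eq_square)
  have int: "integrable M (\<lambda>s. ((e (g i) s)^2 - v) * ((e (g j) s)^2 - v))" if "i \<in> {..<N}" "j \<in> {..<N}" for i j
    using expectation_product4(1)[of "g i" "g i" "g j" "g j"] e_power_integrable[of "g i" 2] e_power_integrable[of "g j" 2]
      g(2)[of i] g(2)[of j] that unfolding eq by (auto simp: power2_eq_square)
  have C: "expectation (\<lambda>s. ((e (g i) s)^2 - v)^2) \<le> C" if "i \<in> {..<N}" for i
  proof -
    have "g i \<le> n" using g(2) that by simp
    then show ?thesis using variance_sq_le[of "g i"] e4(2)[of "g i"] zero_le_power2[of v] by linarith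
  qed
  have orth: "expectation (\<lambda>s. ((e (g i) s)^2 - v) * ((e (g j) s)^2 - v)) = 0"
    if ij: "i \<in> {..<N}" "j \<in> {..<N}" "i \<noteq> j" for i j
  proof -
    have "g i \<noteq> g j" using ij g(1) by (auto simp: inj_on_def)
    then show ?thesis
      using expectation_powers2[of "g i" "g j" 2 2] e_power_integrable[of "g i" 2] e_power_integrable[of "g j" 2]
        e_var[of "g i"] e_var[of "g j"] g(2)[of i] g(2)[of j] ij unfolding eq by (simp add: prob_space power2_eq_square)
  qed
  show "integrable M (\<lambda>s. (\<Sum>i<N. (e (g i) s)^2 - v)^2)"
    by (rule orthogonal_sum_L2(1)[OF _ int C orth]) auto
  show "expectation (\<lambda>s. (\<Sum>i<N. (e (g i) s)^2 - v)^2) \<le> real N * C"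
    using orthogonal_sum_L2(2)[of "{..<N}" "\<lambda>i s. (e (g i) s)^2 - v" C, OF _ int C orth] by simp
qed

text \<open>Neighbouring products share a variable and need not be independent, but they are
  orthogonal, since the smallest index occurs only once. The lag \<open>k\<close> is 1 for the first
  sum of squares and 2 for the second.\<close>

lemma sum_products_L2:
  assumes k: "0 < k" "\<And>i. i < N \<Longrightarrow> k * i + k \<le> n"
  shows "integrable M (\<lambda>s. (\<Sum>i<N. e (k * i) s * e (k * i + k) s)^2)"
    and "expectation (\<lambda>s. (\<Sum>i<N. e (k * i) s * e (k * i + k) s)^2) \<le> real N * C"
proof -
  have le: "k * i \<le> n" "k * i + k \<le> n" if "i \<in> {..<N}" for i using k(2)[of i] that by auto
  have int: "integrable M (\<lambda>s. (e (k * i) s * e (k * i + k) s) * (e (k * j) s * e (k * j + k) s))"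
    if "i \<in> {..<N}" "j \<in> {..<N}" for i j
    using le[OF that(1)] le[OF that(2)] by (intro expectation_product4(1))
  have C: "expectation (\<lambda>s. (e (k * i) s * e (k * i + k) s)^2) \<le> C" if "i \<in> {..<N}" for i
    using expectation_powers2(2)[of "k * i" "k * i + k" 2 2] le[OF that] k(1) e_var v2_le
    by (simp add: power_mult_distrib power2_eq_square[of v])
  have orth1: "expectation (\<lambda>s. (e (k * i) s * e (k * i + k) s) * (e (k * j) s * e (k * j + k) s)) = 0"
    if ij: "i \<in> {..<N}" "j \<in> {..<N}" "i < j" for i j
  proof (rule expectation_product4(2))
    have "k * i < k * j" using k ij by simp
    then have "k * i \<noteq> k * i + k" "k * i \<noteq> k * j" "k * i \<noteq> k * j + k" using k(1) by linarith+
    then show "k * i \<notin> {k * i + k, k * j, k * j + k}" by blast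
  qed (use le[OF ij(1)] le[OF ij(2)] in auto)
  have orth: "expectation (\<lambda>s. (e (k * i) s * e (k * i + k) s) * (e (k * j) s * e (k * j + k) s)) = 0"
    if ij: "i \<in> {..<N}" "j \<in> {..<N}" "i \<noteq> j" for i j
  proof (cases "i < j")
    case False
    then have "j < i" using ij by simp
    from orth1[OF ij(2,1) this] show ?thesis by (simp add: mult.commute mult.left_commute)
  qed (use orth1 ij in auto)
  show "integrable M (\<lambda>s. (\<Sum>i<N. e (k * i) s * e (k * i + k) s)^2)"
    by (rule orthogonal_sum_L2(1)[OF _ int C orth]) auto
  show "expectation (\<lambda>s. (\<Sum>i<N. e (k * i) s * e (k * i + k) s)^2) \<le> real N * C"
    using orthogonal_sum_L2(2)[of "{..<N}" "\<lambda>i s. e (k * i) s * e (k * i + k) s" C, OF _ int C orth] by simp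
qed

lemma noise_increment_L2:
  assumes "i \<le> n" "j \<le> n" "i \<noteq> j"
  shows "integrable M (\<lambda>s. (e j s - e i s)^2)" and "expectation (\<lambda>s. (e j s - e i s)^2) = 2 * v"
proof -
  have eq: "(e j s - e i s)^2 = (e j s)^2 - 2 * (e i s * e j s) + (e i s)^2" for s
    by (simp add: power2_diff)
  have int: "integrable M (\<lambda>s. (e i s)^2)" "integrable M (\<lambda>s. (e j s)^2)" "integrable M (\<lambda>s. e i s * e j s)"
    "expectation (\<lambda>s. e i s * e j s) = 0"
    using e_power_integrable[of _ 2] expectation_powers2[OF assms, of 1 1] e_mean assms by auto
  show "integrable M (\<lambda>s. (e j s - e i s)^2)" unfolding eq using int by auto
  show "expectation (\<lambda>s. (e j s - e i s)^2) = 2 * v" unfolding eq using int e_var assms by simp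
qed

text \<open>The noise contributes \<open>2 * n * v\<close> to the first sum and about \<open>n * v\<close> to the second one; cross
  terms with \<open>x\<close> are absorbed by \<open>2 * y * d \<le> y^2 / \<theta> + \<theta> * d^2\<close>.\<close>

lemma quadratic_variation_difference_prob:
  fixes x :: "nat \<Rightarrow> 'w \<Rightarrow> real"
  assumes n: "0 < n" and v: "0 < v" and \<theta>: "0 < \<theta>" and \<rho>: "0 \<le> \<rho>"
    and y1: "\<And>i. i < n \<Longrightarrow> integrable M (\<lambda>s. (x (i + 1) s - x i s)^2)"
      "\<And>i. i < n \<Longrightarrow> expectation (\<lambda>s. (x (i + 1) s - x i s)^2) \<le> \<rho>"
    and y2: "\<And>i. 2 * i + 2 \<le> n \<Longrightarrow> integrable M (\<lambda>s. (x (2 * i + 2) s - x (2 * i) s)^2)"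
      "\<And>i. 2 * i + 2 \<le> n \<Longrightarrow> expectation (\<lambda>s. (x (2 * i + 2) s - x (2 * i) s)^2) \<le> \<rho>"
    and S: "\<And>i s. i \<le> n \<Longrightarrow> s \<in> space M \<Longrightarrow> S s i = x i s + e i s"
  shows "prob {s\<in>space M. (\<Sum>i<n. (S s (i + 1) - S s i)^2) -
      (\<Sum>i<n div 2. (S s (2 * i + 2) - S s (2 * i))^2) < real n * v / 2}
    \<le> 1152 * C / (real n * v^2) + 8 * (\<rho> * (1 + 1 / \<theta>) + 2 * \<theta> * v) / v"
proof -
  define q where "q = n div 2"
  have q: "2 * q \<le> n" "i < q \<Longrightarrow> 2 * i + 2 \<le> n" for i by (auto simp: q_def)
  \<comment> \<open>Expanding the squared noise increments leaves
    \<open>2 * n * v - 2 * q * v\<close> plus centred sums: \<open>A1\<close> to \<open>A4\<close>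
    come from the squares, \<open>A5\<close> and \<open>A6\<close> from the products of neighbours.
    \<open>R\<close> collects them with their signs.\<close>
  define A1 where "A1 s = (\<Sum>i<n. (e i s)^2 - v)" for s
  define A2 where "A2 s = (\<Sum>i<n. (e (i + 1) s)^2 - v)" for s
  define A3 where "A3 s = (\<Sum>i<q. (e (2 * i) s)^2 - v)" for s
  define A4 where "A4 s = (\<Sum>i<q. (e (2 * i + 2) s)^2 - v)" for s
  define A5 where "A5 s = (\<Sum>i<n. e i s * e (i + 1) s)" for s
  define A6 where "A6 s = (\<Sum>i<q. e (2 * i) s * e (2 * i + 2) s)" for s
  define R where "R s = A1 s + A2 s - A3 s - A4 s - 2 * A5 s + 2 * A6 s" for s
  have C0: "0 \<le> C" using v2_le zero_le_power2[of v] by linarith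
  have qC: "real q * C \<le> real n * C" using q(1) C0 by (intro mult_right_mono) auto
  have A: "integrable M (\<lambda>s. (A1 s)^2) \<and> expectation (\<lambda>s. (A1 s)^2) \<le> real n * C"
    "integrable M (\<lambda>s. (A2 s)^2) \<and> expectation (\<lambda>s. (A2 s)^2) \<le> real n * C"
    "integrable M (\<lambda>s. (A3 s)^2) \<and> expectation (\<lambda>s. (A3 s)^2) \<le> real n * C"
    "integrable M (\<lambda>s. (A4 s)^2) \<and> expectation (\<lambda>s. (A4 s)^2) \<le> real n * C"
    "integrable M (\<lambda>s. (A5 s)^2) \<and> expectation (\<lambda>s. (A5 s)^2) \<le> real n * C"
    "integrable M (\<lambda>s. (A6 s)^2) \<and> expectation (\<lambda>s. (A6 s)^2) \<le> real n * C"
    unfolding A1_def A2_def A3_def A4_def A5_def A6_def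
    using sum_squares_L2[of "\<lambda>i. i" n] sum_squares_L2[of "\<lambda>i. i + 1" n] sum_squares_L2[of "\<lambda>i. 2 * i" q]
      sum_squares_L2[of "\<lambda>i. 2 * i + 2" q] sum_products_L2[of 1 n] sum_products_L2[of 2 q] q qC
    by (auto simp: inj_on_def intro: order_trans[OF _ qC])
  have eM: "i \<le> n \<Longrightarrow> e i \<in> borel_measurable M" for i by (rule e_measurable)
  have RM: "R \<in> borel_measurable M"
    unfolding R_def A1_def A2_def A3_def A4_def A5_def A6_def
    by (intro borel_measurable_add borel_measurable_diff borel_measurable_sum borel_measurable_times
        borel_measurable_const borel_measurable_power eM) (use q in auto)
  \<comment> \<open>Cauchy-Schwarz for six terms, two of which carry the factor 2: taking means
    gives \<open>6 * (4 + 4 + 4) * n * C = 72 * n * C\<close>, and Chebyshev at level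
    \<open>n * v / 4\<close> turns 72 into \<open>72 * 16 = 1152\<close>.\<close>
  have Rle: "(R s)^2 \<le> 6 * ((A1 s)^2 + (A2 s)^2 + (A3 s)^2 + (A4 s)^2 + 4 * (A5 s)^2 + 4 * (A6 s)^2)" for s
  proof -
    define f where "f = (\<lambda>i::nat. [A1 s, A2 s, - A3 s, - A4 s, - 2 * A5 s, 2 * A6 s] ! i)"
    have "(\<Sum>i<6. f i)^2 \<le> (\<Sum>i<6. (f i)^2) * card {..<6::nat}" by (rule sum_squared_le_sum_of_squares)
    then show ?thesis by (simp add: f_def R_def eval_nat_numeral power2_eq_square algebra_simps)
  qed
  have R2: "integrable M (\<lambda>s. (R s)^2)"
    by (rule Bochner_Integration.integrable_bound[where g="\<lambda>s. (R s)^2" and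
        f="\<lambda>s. 6 * ((A1 s)^2 + (A2 s)^2 + (A3 s)^2 + (A4 s)^2 + 4 * (A5 s)^2 + 4 * (A6 s)^2)"])
      (use A RM Rle in \<open>auto intro: order_trans[OF _ abs_ge_self]\<close>)
  have "expectation (\<lambda>s. (R s)^2) \<le>
    expectation (\<lambda>s. 6 * ((A1 s)^2 + (A2 s)^2 + (A3 s)^2 + (A4 s)^2 + 4 * (A5 s)^2 + 4 * (A6 s)^2))"
    using A R2 Rle by (intro integral_mono) auto
  also have "\<dots> \<le> 72 * (real n * C)" using A by simp
  finally have ER: "expectation (\<lambda>s. (R s)^2) \<le> 72 * (real n * C)" .
  have nv: "0 < real n * v / 4" using n v by simp
  have "prob {s\<in>space M. (real n * v / 4)^2 \<le> (R s)^2} \<le> expectation (\<lambda>s. (R s)^2) / (real n * v / 4)^2"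
    using R2 nv n v by (intro integral_Markov_inequality_measure[where A="{}"]) auto
  also have "\<dots> \<le> 72 * (real n * C) / (real n * v / 4)^2" by (rule divide_right_mono[OF ER]) simp
  also have "\<dots> = 1152 * C / (real n * v^2)" using n v by (simp add: power2_eq_square field_simps)
  finally have PR: "prob {s\<in>space M. (real n * v / 4)^2 \<le> (R s)^2} \<le> 1152 * C / (real n * v^2)" .
  \<comment> \<open>\<open>W\<close> gathers the losses due to \<open>x\<close>. In the first sum
    the squared increment of \<open>x\<close> has the favourable sign and is dropped, leaving the
    cross term; in the second sum it has to be kept, hence \<open>1 + 1 / \<theta>\<close>.\<close>
  define W where "W s = (\<Sum>i<n. (x (i + 1) s - x i s)^2 / \<theta> + \<theta> * (e (i + 1) s - e i s)^2) +
    (\<Sum>i<q. (x (2 * i + 2) s - x (2 * i) s)^2 * (1 + 1 / \<theta>) + \<theta> * (e (2 * i + 2) s - e (2 * i) s)^2)" for s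
  have d1: "i < n \<Longrightarrow> integrable M (\<lambda>s. (e (i + 1) s - e i s)^2) \<and> expectation (\<lambda>s. (e (i + 1) s - e i s)^2) = 2 * v" for i
    using noise_increment_L2[of i "i + 1"] by auto
  have d2: "i < q \<Longrightarrow> integrable M (\<lambda>s. (e (2 * i + 2) s - e (2 * i) s)^2) \<and> expectation (\<lambda>s. (e (2 * i + 2) s - e (2 * i) s)^2) = 2 * v" for i
    using noise_increment_L2[of "2 * i" "2 * i + 2"] q(2)[of i] by auto
  have i1: "integrable M (\<lambda>s. (x (i + 1) s - x i s)^2 / \<theta> + \<theta> * (e (i + 1) s - e i s)^2)" if "i < n" for i
    using d1[OF that] y1(1)[OF that] by auto
  have i2: "integrable M (\<lambda>s. (x (2 * i + 2) s - x (2 * i) s)^2 * (1 + 1 / \<theta>) + \<theta> * (e (2 * i + 2) s - e (2 * i) s)^2)" if "i < q" for i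
    using d2[OF that] y2(1)[OF q(2)[OF that]] by auto
  have isum: "integrable M (\<lambda>s. (\<Sum>i<n. F i s) + (\<Sum>i<q. G i s))"
    if "\<And>i. i < n \<Longrightarrow> integrable M (F i)" "\<And>i. i < q \<Longrightarrow> integrable M (G i)" for F G :: "nat \<Rightarrow> 'w \<Rightarrow> real"
    by (intro Bochner_Integration.integrable_add Bochner_Integration.integrable_sum that) auto
  have esum: "expectation (\<lambda>s. (\<Sum>i<n. F i s) + (\<Sum>i<q. G i s)) =
      (\<Sum>i<n. expectation (F i)) + (\<Sum>i<q. expectation (G i))"
    if FG: "\<And>i. i < n \<Longrightarrow> integrable M (F i)" "\<And>i. i < q \<Longrightarrow> integrable M (G i)" for F G :: "nat \<Rightarrow> 'w \<Rightarrow> real"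
  proof -
    have *: "integrable M (\<lambda>s. \<Sum>i<n. F i s)" "integrable M (\<lambda>s. \<Sum>i<q. G i s)"
      by (intro Bochner_Integration.integrable_sum FG; simp)+
    show ?thesis
      unfolding Bochner_Integration.integral_add[OF *]
      by (intro arg_cong2[where f="(+)"] Bochner_Integration.integral_sum FG) auto
  qed
  have Wi: "integrable M W"
    unfolding W_def
    by (rule isum) (erule i1, erule i2)
  \<comment> \<open>A common bound for the means of all summands of \<open>W\<close>. There are at
    most \<open>2 * n\<close> of them, so Markov at level \<open>n * v / 4\<close> gives
    \<open>8 * c / v\<close>.\<close>
  define c where "c = \<rho> * (1 + 1 / \<theta>) + 2 * \<theta> * v"
  have c0: "0 \<le> c" using \<rho> \<theta> v by (simp add: c_def)
  have b1: "expectation (\<lambda>s. (x (i + 1) s - x i s)^2 / \<theta> + \<theta> * (e (i + 1) s - e i s)^2) \<le> c" if "i < n" for i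
  proof -
    have "expectation (\<lambda>s. (x (i + 1) s - x i s)^2 / \<theta> + \<theta> * (e (i + 1) s - e i s)^2) =
       expectation (\<lambda>s. (x (i + 1) s - x i s)^2) / \<theta> + \<theta> * (2 * v)"
      using d1[OF that] y1(1)[OF that] by simp
    also have "\<dots> \<le> \<rho> / \<theta> + \<theta> * (2 * v)" using y1(2)[OF that] \<theta> by (intro add_right_mono divide_right_mono) auto
    also have "\<dots> \<le> c" using \<rho> by (simp add: c_def algebra_simps)
    finally show ?thesis .
  qed
  have b2: "expectation (\<lambda>s. (x (2 * i + 2) s - x (2 * i) s)^2 * (1 + 1 / \<theta>) + \<theta> * (e (2 * i + 2) s - e (2 * i) s)^2) \<le> c" if "i < q" for i
  proof -
    have "expectation (\<lambda>s. (x (2 * i + 2) s - x (2 * i) s)^2 * (1 + 1 / \<theta>) + \<theta> * (e (2 * i + 2) s - e (2 * i) s)^2) =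
       expectation (\<lambda>s. (x (2 * i + 2) s - x (2 * i) s)^2) * (1 + 1 / \<theta>) + \<theta> * (2 * v)"
      using d2[OF that] y2(1)[OF q(2)[OF that]] by simp
    also have "\<dots> \<le> \<rho> * (1 + 1 / \<theta>) + \<theta> * (2 * v)"
      using y2(2)[OF q(2)[OF that]] \<theta> by (intro add_right_mono mult_right_mono) auto
    finally show ?thesis by (simp add: c_def)
  qed

  have "expectation W = (\<Sum>i<n. expectation (\<lambda>s. (x (i + 1) s - x i s)^2 / \<theta> + \<theta> * (e (i + 1) s - e i s)^2)) +
    (\<Sum>i<q. expectation (\<lambda>s. (x (2 * i + 2) s - x (2 * i) s)^2 * (1 + 1 / \<theta>) + \<theta> * (e (2 * i + 2) s - e (2 * i) s)^2))"
    unfolding W_def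
    by (rule esum) (erule i1, erule i2)
  also have "\<dots> \<le> (\<Sum>i<n. c) + (\<Sum>i<q. c)"
    using b1 b2 by (intro add_mono sum_mono) auto
  also have "\<dots> \<le> 2 * real n * c"
    using mult_right_mono[of "real q" "real n" c] q(1) c0 by (simp add: mult.commute)
  finally have EW: "expectation W \<le> 2 * real n * c" .
  have W0: "0 \<le> W s" for s unfolding W_def using \<theta> by (intro add_nonneg_nonneg sum_nonneg) auto
  have "prob {s\<in>space M. real n * v / 4 \<le> W s} \<le> expectation W / (real n * v / 4)"
    using Wi nv W0 by (intro integral_Markov_inequality_measure[where A="{}"]) auto
  also have "\<dots> \<le> 2 * real n * c / (real n * v / 4)" using nv by (intro divide_right_mono[OF EW]) auto
  also have "\<dots> = 8 * c / v" using n v by (simp add: field_simps)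
  finally have PW: "prob {s\<in>space M. real n * v / 4 \<le> W s} \<le> 8 * c / v" .
  have am: "- (y^2 / \<theta> + \<theta> * d^2) \<le> 2 * y * d" "2 * y * d \<le> y^2 / \<theta> + \<theta> * d^2" for y d :: real
  proof -
    have "0 \<le> (y + \<theta> * d)^2 / \<theta>" "0 \<le> (y - \<theta> * d)^2 / \<theta>" using \<theta> by auto
    then show "- (y^2 / \<theta> + \<theta> * d^2) \<le> 2 * y * d" "2 * y * d \<le> y^2 / \<theta> + \<theta> * d^2"
      using \<theta> by (simp_all add: power2_sum power2_diff add_divide_distrib diff_divide_distrib power_mult_distrib power2_eq_square[of \<theta>])
  qed
  have lower: "real n * v + R s - W s \<le> (\<Sum>i<n. (S s (i + 1) - S s i)^2) - (\<Sum>i<q. (S s (2 * i + 2) - S s (2 * i))^2)"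
    if s: "s \<in> space M" for s
  proof -
    have "(\<Sum>i<n. (S s (i + 1) - S s i)^2) \<ge> (\<Sum>i<n. (e (i + 1) s - e i s)^2 - ((x (i + 1) s - x i s)^2 / \<theta> + \<theta> * (e (i + 1) s - e i s)^2))"
    proof (rule sum_mono)
      fix i assume "i \<in> {..<n}"
      then have "S s (i + 1) - S s i = (x (i + 1) s - x i s) + (e (i + 1) s - e i s)" using S s by simp
      then show "(e (i + 1) s - e i s)^2 - ((x (i + 1) s - x i s)^2 / \<theta> + \<theta> * (e (i + 1) s - e i s)^2) \<le> (S s (i + 1) - S s i)^2"
        using am(1)[of "x (i + 1) s - x i s" "e (i + 1) s - e i s"] zero_le_power2[of "x (i + 1) s - x i s"]
        by (simp only: power2_sum)
    qed
    moreover have "(\<Sum>i<q. (S s (2 * i + 2) - S s (2 * i))^2) \<le> (\<Sum>i<q. (e (2 * i + 2) s - e (2 * i) s)^2 +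
      ((x (2 * i + 2) s - x (2 * i) s)^2 * (1 + 1 / \<theta>) + \<theta> * (e (2 * i + 2) s - e (2 * i) s)^2))"
    proof (rule sum_mono)
      fix i assume "i \<in> {..<q}"
      then have "2 * i + 2 \<le> n" using q(2) by simp
      then have "S s (2 * i + 2) - S s (2 * i) = (x (2 * i + 2) s - x (2 * i) s) + (e (2 * i + 2) s - e (2 * i) s)" using S s by simp
      then show "(S s (2 * i + 2) - S s (2 * i))^2 \<le> (e (2 * i + 2) s - e (2 * i) s)^2 +
      ((x (2 * i + 2) s - x (2 * i) s)^2 * (1 + 1 / \<theta>) + \<theta> * (e (2 * i + 2) s - e (2 * i) s)^2)"
        using am(2)[of "x (2 * i + 2) s - x (2 * i) s" "e (2 * i + 2) s - e (2 * i) s"]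
        by (simp only: power2_sum distrib_left mult_1_right times_divide_eq_right)
    qed
    moreover have "(\<Sum>i<n. (e (i + 1) s - e i s)^2) = A1 s + A2 s - 2 * A5 s + 2 * (real n * v)"
      by (simp add: A1_def A2_def A5_def power2_diff sum.distrib sum_subtractf sum_distrib_left mult_ac)
    moreover have "(\<Sum>i<q. (e (2 * i + 2) s - e (2 * i) s)^2) = A3 s + A4 s - 2 * A6 s + 2 * (real q * v)"
      by (simp add: A3_def A4_def A6_def power2_diff sum.distrib sum_subtractf sum_distrib_left mult_ac)
    \<comment> \<open>Of the main term \<open>2 * n * v - 2 * q * v\<close> at least
      \<open>n * v\<close> remains, whatever the parity of \<open>n\<close>.\<close>
    moreover have "2 * (real q * v) \<le> real n * v"
    proof -
      have "real (2 * q) * v \<le> real n * v" using q(1) v by (intro mult_right_mono) (simp_all only: of_nat_le_iff)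
      then show ?thesis by simp
    qed
    ultimately show ?thesis unfolding R_def W_def sum.distrib sum_subtractf by linarith
  qed
  let ?D = "{s\<in>space M. (\<Sum>i<n. (S s (i + 1) - S s i)^2) - (\<Sum>i<n div 2. (S s (2 * i + 2) - S s (2 * i))^2) < real n * v / 2}"
  let ?P = "{s\<in>space M. (real n * v / 4)^2 \<le> (R s)^2}"
  let ?W = "{s\<in>space M. real n * v / 4 \<le> W s}"
  have sub: "?D
    \<subseteq> ?P \<union> ?W"
  proof
    fix s assume *: "s \<in> ?D"
    then have s: "s \<in> space M" by simp
    \<comment> \<open>Falling from \<open>n * v\<close> below \<open>n * v / 2\<close> is a loss of
      more than \<open>n * v / 2\<close>, so \<open>W\<close> or \<open>|R|\<close> must account for
      at least \<open>n * v / 4\<close> of it.\<close>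
    show "s \<in> ?P \<union> ?W"
    proof (cases "real n * v / 4 \<le> W s")
      case False
      have "real n * v + R s - W s < real n * v / 2" using lower[OF s] * unfolding q_def mem_Collect_eq by linarith
      then have "real n * v / 4 \<le> \<bar>R s\<bar>" using False by linarith
      then have "(real n * v / 4)^2 \<le> (R s)^2" using nv by (intro abs_le_square_iff[THEN iffD1]) auto
      then show ?thesis using s by simp
    qed (use s in simp)
  qed
  have ev: "?P \<in> events" "?W \<in> events"
    using RM borel_measurable_integrable[OF Wi] by measurable
  have "prob ?D
    \<le> prob (?P \<union> ?W)"
    by (rule finite_measure_mono[OF sub]) (use ev in auto)
  also have "\<dots> \<le> prob ?P + prob ?W"
    by (rule measure_Un_le[OF ev])
  finally show ?thesis using PR PW by (simp add: c_def)
qed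

end

section \<open>Block means\<close>

text \<open>Serves to replace observation times by their indices; there \<open>g\<close> is
  injective because the step \<open>h\<close> is positive.\<close>

lemma (in prob_space) indep_vars_reindex:
  assumes "indep_vars N X (g ` I)" "inj_on g I"
  shows "indep_vars (\<lambda>i. N (g i)) (\<lambda>i. X (g i)) I"
  unfolding indep_vars_def2
proof (intro conjI ballI)
  show "i \<in> I \<Longrightarrow> X (g i) \<in> M \<rightarrow>\<^sub>M N (g i)" for i
    using assms(1) unfolding indep_vars_def by auto
  show "indep_sets (\<lambda>i. {X (g i) -` A \<inter> space M |A. A \<in> sets (N (g i))}) I"
  proof (rule indep_setsI)
    have ivs: "indep_sets (\<lambda>i. {X i -` A \<inter> space M |A. A \<in> sets (N i)}) (g ` I)"
      using assms(1) unfolding indep_vars_def2 by auto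
    show "i \<in> I \<Longrightarrow> {X (g i) -` A \<inter> space M |A. A \<in> sets (N (g i))} \<subseteq> events" for i
      using ivs unfolding indep_sets_def by auto
    fix A J assume J: "J \<noteq> {}" "J \<subseteq> I" "finite J" and A: "\<forall>j\<in>J. A j \<in> {X (g j) -` A \<inter> space M |A. A \<in> sets (N (g j))}"
    have inj: "inj_on g J" using assms(2) J(2) by (rule inj_on_subset)
    define A' where "A' j = A (inv_into J g j)" for j
    have A': "A' (g j) = A j" if "j \<in> J" for j using inj that by (simp add: A'_def)
    have "prob (\<Inter>j\<in>g ` J. A' j) = (\<Prod>j\<in>g ` J. prob (A' j))"
      by (rule indep_setsD[OF ivs]) (use J A A' in auto)
    moreover have "(\<Inter>j\<in>g ` J. A' j) = (\<Inter>j\<in>J. A j)" using A' by auto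
    moreover have "(\<Prod>j\<in>g ` J. prob (A' j)) = (\<Prod>j\<in>J. prob (A j))" using A' by (simp add: prod.reindex[OF inj])
    ultimately show "prob (\<Inter>j\<in>J. A j) = (\<Prod>j\<in>J. prob (A j))" by simp
  qed
qed

text \<open>An atom of mass above 1/2 dominates all others, since two masses add up to at most 1.
  Its own mass is below 1, as otherwise \<open>g\<close> would be almost surely equal to its mean 0
  and its variance would vanish.\<close>

lemma (in prob_space) atoms_bounded_below_one:
  fixes g :: "'a \<Rightarrow> real"
  assumes g[measurable]: "g \<in> borel_measurable M" and mean: "expectation g = 0"
    and var: "expectation (\<lambda>s. (g s)^2) > 0"
  shows "\<exists>q<1. 0 \<le> q \<and> (\<forall>c. prob {s\<in>space M. g s = c} \<le> q)"
proof (cases "\<forall>c. prob {s\<in>space M. g s = c} \<le> 1 / 2")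
  case True
  then show ?thesis by (intro exI[of _ "1 / 2"]) auto
next
  case False
  then obtain c where c: "1 / 2 < prob {s\<in>space M. g s = c}" by (auto simp: not_le)
  have "prob {s\<in>space M. g s = c} \<noteq> 1"
  proof
    assume "prob {s\<in>space M. g s = c} = 1"
    then have ae: "AE s in M. g s = c" by (subst (asm) prob_Collect_eq_1) auto
    have "expectation g = expectation (\<lambda>_. c)" using ae by (intro integral_cong_AE) auto
    then have "c = 0" using mean by (simp add: prob_space)
    then have "expectation (\<lambda>s. (g s)^2) = expectation (\<lambda>_. 0)" using ae by (intro integral_cong_AE) auto
    then show False using var by simp
  qed
  then have c1: "prob {s\<in>space M. g s = c} < 1" using prob_le_1[of "{s\<in>space M. g s = c}"] by linarith
  have "prob {s\<in>space M. g s = c'} \<le> prob {s\<in>space M. g s = c}" for c'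
  proof (cases "c' = c")
    case False
    have "prob {s\<in>space M. g s = c'} + prob {s\<in>space M. g s = c} =
      prob ({s\<in>space M. g s = c'} \<union> {s\<in>space M. g s = c})"
      using False by (intro finite_measure_Union[symmetric]) auto
    also have "\<dots> \<le> 1" by simp
    finally show ?thesis using c by linarith
  qed simp
  then show ?thesis using c1 by (intro exI[of _ "prob {s\<in>space M. g s = c}"]) auto
qed

text \<open>Fubini for the joint law: once the value of \<open>U\<close> and membership in
  \<open>B\<close> are fixed, independence leaves \<open>g\<close> a single admissible value, of
  mass at most \<open>q\<close>.\<close>

lemma (in prob_space) prob_indep_atom_le:
  fixes g U :: "'a \<Rightarrow> real"
  assumes ind: "indep_set (gen_events M {()} (\<lambda>_. g)) (sets G)" and G: "space G = space M"
    and g[measurable]: "g \<in> borel_measurable M" and q: "\<And>c. prob {s\<in>space M. g s = c} \<le> q" "0 \<le> q"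
    and B: "B \<in> sets G" and U: "U \<in> borel_measurable G"
  shows "prob (B \<inter> {s\<in>space M. g s = U s}) \<le> q * prob B"
proof -
  \<comment> \<open>\<open>Q\<close> carries both the event \<open>B\<close> and the value
    \<open>U\<close>; the constant component of \<open>P\<close> gives the two variables the same
    type, as \<open>indep_var\<close> requires.\<close>
  define P where "P s = (g s, 0::real)" for s
  define Q where "Q s = (indicator B s :: real, U s)" for s
  have BM[measurable]: "B \<in> events" using B indep_setD_ev2[OF ind] by auto
  have [measurable]: "U \<in> borel_measurable M"
    using measurable_mono[of borel borel G M] U indep_setD_ev2[OF ind] G by auto
  have QG: "Q \<in> borel_measurable G"
    unfolding Q_def[abs_def] using U B by (intro borel_measurable_Pair) auto
  have iv: "indep_var borel P borel Q"
    unfolding P_def[abs_def]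
    by (rule indep_var_of_indep_set[OF ind g _ QG G, of "\<lambda>y. (y, 0)"]) simp
  have [measurable]: "P \<in> borel_measurable M" "Q \<in> borel_measurable M"
    using indep_var_rv1[OF iv] indep_var_rv2[OF iv] by auto
  have eq: "distr M borel P \<Otimes>\<^sub>M distr M borel Q = distr M (borel \<Otimes>\<^sub>M borel) (\<lambda>s. (P s, Q s))"
    using iv unfolding indep_var_distribution_eq by auto
  define S where "S = {z :: (real \<times> real) \<times> (real \<times> real). fst (snd z) = 1 \<and> fst (fst z) = snd (snd z)}"
  have "closed S"
    unfolding S_def by (intro closed_Collect_conj closed_Collect_eq continuous_intros)
  then have S[measurable]: "S \<in> sets (borel \<Otimes>\<^sub>M borel)" unfolding borel_prod by (rule borel_closed)
  interpret P: prob_space "distr M borel P" by (rule prob_space_distr) measurable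
  interpret Q: prob_space "distr M borel Q" by (rule prob_space_distr) measurable
  interpret pair_sigma_finite "distr M borel P" "distr M borel Q" ..
  have "emeasure M (B \<inter> {s\<in>space M. g s = U s}) = emeasure M ((\<lambda>s. (P s, Q s)) -` S \<inter> space M)"
    using sets.sets_into_space[OF BM]
    by (intro arg_cong[where f="emeasure M"]) (auto simp: S_def P_def Q_def split: split_indicator_asm)
  also have "\<dots> = emeasure (distr M borel P \<Otimes>\<^sub>M distr M borel Q) S"
    unfolding eq by (intro emeasure_distr[symmetric]) auto
  also have "\<dots> = (\<integral>\<^sup>+ y. emeasure (distr M borel P) ((\<lambda>x. (x, y)) -` S) \<partial>distr M borel Q)"
    by (rule emeasure_pair_measure_alt2) simp
  also have "\<dots> \<le> (\<integral>\<^sup>+ y. ennreal q * indicator {y. fst y = 1} y \<partial>distr M borel Q)"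
  proof (rule nn_integral_mono)
    fix y :: "real \<times> real"
    show "emeasure (distr M borel P) ((\<lambda>x. (x, y)) -` S) \<le> ennreal q * indicator {y. fst y = 1} y"
    proof (cases "fst y = 1")
      case True
      have "(\<lambda>x. (x, y)) -` S = {x. fst x = snd y}" using True by (auto simp: S_def)
      moreover have "emeasure (distr M borel P) {x. fst x = snd y} = emeasure M {s\<in>space M. g s = snd y}"
        by (subst emeasure_distr)
          (auto simp: P_def intro!: arg_cong[where f="emeasure M"] borel_closed closed_Collect_eq continuous_intros)
      ultimately show ?thesis using True q(1)[of "snd y"] by (simp add: emeasure_eq_measure ennreal_leI)
    next
      case False
      then have "(\<lambda>x. (x, y)) -` S = {}" by (auto simp: S_def)
      then show ?thesis by simp
    qed
  qed
  also have "\<dots> = ennreal q * emeasure (distr M borel Q) {y. fst y = 1}"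
    by (rule nn_integral_cmult_indicator) (auto intro!: borel_closed closed_Collect_eq continuous_intros)
  also have "emeasure (distr M borel Q) {y. fst y = 1} = emeasure M B"
    using sets.sets_into_space[OF BM]
    by (subst emeasure_distr)
      (auto simp: Q_def split: split_indicator_asm
        intro!: arg_cong[where f="emeasure M"] borel_closed closed_Collect_eq continuous_intros)
  finally show ?thesis using q(2) by (simp add: emeasure_eq_measure flip: ennreal_mult)
qed

text \<open>Conditionally on everything else, the first noise variable of a block must hit one prescribed
  value for the block sum to agree with the previous one.\<close>

lemma (in prob_space) equal_block_sums_prob:
  fixes e x :: "nat \<Rightarrow> 'a \<Rightarrow> real" and G :: "nat \<Rightarrow> 'a measure"
  assumes G: "\<And>i. i < k * p \<Longrightarrow> space (G i) = space M"
    and ind: "\<And>i. i < k * p \<Longrightarrow> indep_set (gen_events M {()} (\<lambda>_. e i)) (sets (G i))"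
    and x: "\<And>i l. i < k * p \<Longrightarrow> l < k * p \<Longrightarrow> x l \<in> borel_measurable (G i)"
    and e: "\<And>i l. i < k * p \<Longrightarrow> l < k * p \<Longrightarrow> l \<noteq> i \<Longrightarrow> e l \<in> borel_measurable (G i)"
    and eM: "\<And>i. i < k * p \<Longrightarrow> e i \<in> borel_measurable M"
    and q: "\<And>i c. i < k * p \<Longrightarrow> prob {s\<in>space M. e i s = c} \<le> q" "0 \<le> q" and p: "0 < p"
    and T: "\<And>j s. j < k \<Longrightarrow> s \<in> space M \<Longrightarrow> T s j = (\<Sum>i<p. x (j * p + i) s + e (j * p + i) s)"
  shows "prob {s\<in>space M. \<forall>j\<in>{1..k - 2}. T s (j + 1) = T s j} \<le> q ^ (k - 2)"
proof -
  define T' where "T' j s = (\<Sum>i<p. x (j * p + i) s + e (j * p + i) s)" for j s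
  define E where "E J = {s\<in>space M. \<forall>j\<in>{1..J}. T' (j + 1) s = T' j s}" for J
  have idx: "j * p + i < l * p" if "j < l" "i < p" for i j l
  proof -
    have "j * p + i < (j + 1) * p" using that by simp
    also have "\<dots> \<le> l * p" using that by (intro mult_right_mono) auto
    finally show ?thesis .
  qed
  have "prob (E J) \<le> q ^ J" if "J + 2 \<le> k" for J
    using that
  proof (induction J)
    case 0
    then show ?case by simp
  next
    case (Suc J)
    \<comment> \<open>\<open>E J\<close> involves only the blocks \<open>1\<close> to
      \<open>J + 1\<close>, so block \<open>J + 2\<close> is the next one; \<open>i0\<close> is its
      first index.\<close>
    define i0 where "i0 = (J + 2) * p"
    have i0: "i0 < k * p" using idx[of "J + 2" k 0] Suc.prems p by (simp add: i0_def)
    have TG: "T' j \<in> borel_measurable (G i0)" if j: "j \<le> J + 1" for j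
      unfolding T'_def
    proof (intro borel_measurable_sum borel_measurable_add)
      fix i assume "i \<in> {..<p}"
      then have "j * p + i < i0" using j unfolding i0_def by (intro idx) auto
      then show "x (j * p + i) \<in> borel_measurable (G i0)" "e (j * p + i) \<in> borel_measurable (G i0)"
        using i0 by (auto intro: x e)
    qed
    \<comment> \<open>Solves the equality of the sums of blocks \<open>J + 1\<close> and
      \<open>J + 2\<close> for \<open>e i0\<close>. Every term is measurable for
      \<open>G i0\<close>, as \<open>e i0\<close> itself does not occur.\<close>
    define U where "U s = T' (J + 1) s - (x i0 s + (\<Sum>i\<in>{..<p} - {0}. x (i0 + i) s + e (i0 + i) s))" for s
    have UG: "U \<in> borel_measurable (G i0)"
      unfolding U_def
    proof (intro borel_measurable_diff borel_measurable_sum borel_measurable_add TG x i0 order_refl)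
      fix i assume i: "i \<in> {..<p} - {0}"
      then have "i0 + i < k * p" using idx[of "J + 2" k i] Suc.prems by (simp add: i0_def)
      then show "i0 + i < k * p" "e (i0 + i) \<in> borel_measurable (G i0)"
        using i i0 by (auto intro!: e)
    qed
    have EG: "E J \<in> sets (G i0)"
    proof -
      have "{s\<in>space (G i0). \<forall>j\<in>{1..J}. T' (j + 1) s = T' j s} \<in> sets (G i0)"
        by (intro sets.sets_Collect_finite_All borel_measurable_eq TG) auto
      then show ?thesis by (simp add: E_def G[OF i0])
    qed
    have "T' (J + 2) s = (x i0 s + e i0 s) + (\<Sum>i\<in>{..<p} - {0}. x (i0 + i) s + e (i0 + i) s)" for s
      unfolding T'_def i0_def using p by (subst sum.remove[of _ 0]) auto
    then have "T' (J + 2) s = T' (J + 1) s \<longleftrightarrow> e i0 s = U s" for s by (auto simp: U_def)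
    moreover have "{1..Suc J} = insert (J + 1) {1..J}" by (rule set_eqI) (simp only: atLeastAtMost_iff insert_iff, arith)
    ultimately have "E (Suc J) = E J \<inter> {s\<in>space M. e i0 s = U s}"
      by (auto simp: E_def)
    then have "prob (E (Suc J)) \<le> q * prob (E J)"
      using prob_indep_atom_le[OF ind[OF i0] G[OF i0] eM[OF i0] q(1)[OF i0] q(2) EG UG] by simp
    also have "\<dots> \<le> q * q ^ J" using Suc q(2) by (intro mult_left_mono) auto
    finally show ?case by simp
  qed
  moreover have "{s\<in>space M. \<forall>j\<in>{1..k - 2}. T s (j + 1) = T s j} = E (k - 2)" if "2 \<le> k"
  proof -
    have "T s (j + 1) = T' (j + 1) s \<and> T s j = T' j s" if "s \<in> space M" "j \<in> {1..k - 2}" for s j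
      using T[OF _ that(1), of j] T[OF _ that(1), of "j + 1"] that \<open>2 \<le> k\<close> by (auto simp: T'_def)
    then show ?thesis by (auto simp: E_def)
  qed
  \<comment> \<open>For \<open>k < 2\<close> the truncated difference \<open>k - 2\<close> is 0, and
    the bound is trivial.\<close>
  ultimately show ?thesis by (cases "2 \<le> k") auto
qed

section \<open>Fourth moments of block means\<close>

lemma mean_power4_le:
  fixes s :: "nat \<Rightarrow> real"
  assumes "0 < p"
  shows "(1 / real p * (\<Sum>i<p. s i)) ^ 4 \<le> 1 / real p * (\<Sum>i<p. s i ^ 4)"
proof -
  \<comment> \<open>Jensen's inequality for the fourth power, from two applications of
    Cauchy-Schwarz: the first to the terms, the second to their squares.\<close>
  have "(\<Sum>i<p. s i) ^ 4 = ((\<Sum>i<p. s i)^2)^2" by (simp flip: power_mult)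
  also have "\<dots> \<le> ((\<Sum>i<p. (s i)^2) * real p)^2"
    using sum_squared_le_sum_of_squares[of s "{..<p}"] by (intro power_mono) auto
  also have "\<dots> \<le> ((\<Sum>i<p. ((s i)^2)^2) * real p) * (real p)^2"
    using sum_squared_le_sum_of_squares[of "\<lambda>i. (s i)^2" "{..<p}"]
    by (simp add: power_mult_distrib mult_right_mono)
  also have "\<dots> = (\<Sum>i<p. s i ^ 4) * real p ^ 3"
  proof -
    have "((s i)^2)^2 = s i ^ 4" for i by (simp flip: power_mult)
    then show ?thesis by (simp only:) (simp add: power2_eq_square power3_eq_cube)
  qed
  finally show ?thesis using assms by (simp add: power_mult_distrib power_divide field_simps eval_nat_numeral)
qed

lemma power4_add_le: "(x + y) ^ 4 \<le> 8 * (x ^ 4 + y ^ 4)" for x y :: real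
proof -
  have sq: "(a + b)^2 \<le> 2 * (a^2 + b^2)" for a b :: real
    using sum_squares_bound[of a b] by (simp add: power2_sum)
  have "(x + y) ^ 4 = ((x + y)^2)^2" by (simp flip: power_mult)
  also have "\<dots> \<le> (2 * (x^2 + y^2))^2" by (intro power_mono sq) simp
  also have "\<dots> = 4 * (x^2 + y^2)^2" by (subst power_mult_distrib) simp
  also have "\<dots> \<le> 4 * (2 * ((x^2)^2 + (y^2)^2))" using sq[of "x^2" "y^2"] by simp
  finally show ?thesis by (simp flip: power_mult)
qed

lemma (in prob_space) fourth_moment_add:
  assumes "f \<in> borel_measurable M" "integrable M (\<lambda>s. f s ^ 4)" "expectation (\<lambda>s. f s ^ 4) \<le> (A::real)"
    and "g \<in> borel_measurable M" "integrable M (\<lambda>s. g s ^ 4)" "expectation (\<lambda>s. g s ^ 4) \<le> B"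
  shows "integrable M (\<lambda>s. (f s + g s) ^ 4)" "expectation (\<lambda>s. (f s + g s) ^ 4) \<le> 8 * (A + B)"
proof -
  have i: "integrable M (\<lambda>s. 8 * (f s ^ 4 + g s ^ 4))" using assms by auto
  show 1: "integrable M (\<lambda>s. (f s + g s) ^ 4)"
    by (rule Bochner_Integration.integrable_bound[OF i])
      (use assms(1,4) power4_add_le in \<open>auto intro: order_trans[OF _ abs_ge_self]\<close>)
  have "expectation (\<lambda>s. (f s + g s) ^ 4) \<le> expectation (\<lambda>s. 8 * (f s ^ 4 + g s ^ 4))"
    by (rule integral_mono[OF 1 i]) (rule power4_add_le)
  also have "\<dots> \<le> 8 * (A + B)" using assms by simp
  finally show "expectation (\<lambda>s. (f s + g s) ^ 4) \<le> 8 * (A + B)" .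
qed

lemma (in prob_space) inner_fourth_moment:
  fixes Y :: "'a \<Rightarrow> 'b::euclidean_space"
  assumes Y[measurable]: "Y \<in> borel_measurable M" and B: "(\<integral>\<^sup>+ s. ennreal (norm (Y s) ^ 4) \<partial>M) \<le> ennreal B" "0 \<le> B"
  shows "integrable M (\<lambda>s. (u \<bullet> Y s) ^ 4)" "expectation (\<lambda>s. (u \<bullet> Y s) ^ 4) \<le> norm u ^ 4 * B"
proof -
  have Yi: "integrable M (\<lambda>s. norm (Y s) ^ 4)"
    by (rule integrableI_bounded) (use B in \<open>auto intro: le_less_trans\<close>)
  have "ennreal (expectation (\<lambda>s. norm (Y s) ^ 4)) \<le> ennreal B"
    using B by (subst nn_integral_eq_integral[symmetric, OF Yi]) auto
  then have EY: "expectation (\<lambda>s. norm (Y s) ^ 4) \<le> B" using B(2) by simp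
  have le: "(u \<bullet> y) ^ 4 \<le> norm u ^ 4 * norm y ^ 4" for y
  proof -
    have "\<bar>u \<bullet> y\<bar> ^ 4 \<le> (norm u * norm y) ^ 4" by (intro power_mono Cauchy_Schwarz_ineq2) auto
    then show ?thesis by (simp add: power_mult_distrib)
  qed
  have i: "integrable M (\<lambda>s. norm u ^ 4 * norm (Y s) ^ 4)" using Yi by auto
  show 1: "integrable M (\<lambda>s. (u \<bullet> Y s) ^ 4)"
    by (rule Bochner_Integration.integrable_bound[OF i]) (use le in \<open>auto intro: order_trans[OF _ abs_ge_self]\<close>)
  have "expectation (\<lambda>s. (u \<bullet> Y s) ^ 4) \<le> expectation (\<lambda>s. norm u ^ 4 * norm (Y s) ^ 4)"
    by (rule integral_mono[OF 1 i le])
  also have "\<dots> \<le> norm u ^ 4 * B" using EY by (simp add: mult_left_mono)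
  finally show "expectation (\<lambda>s. (u \<bullet> Y s) ^ 4) \<le> norm u ^ 4 * B" .
qed

text \<open>By Jensen a block mean inherits the bound \<open>B\<close>, so an increment has fourth
  moment at most \<open>8 * (B + B)\<close>. There are fewer than \<open>k\<close> summands, and
  Markov at level \<open>k * p\<close> leaves \<open>16 * B / p\<close>.\<close>

lemma (in prob_space) block_mean_increments_prob:
  fixes S :: "'a \<Rightarrow> nat \<Rightarrow> real"
  assumes S: "\<And>i. i < k * p \<Longrightarrow> (\<lambda>s. S s i) \<in> borel_measurable M"
      "\<And>i. i < k * p \<Longrightarrow> integrable M (\<lambda>s. S s i ^ 4)"
      "\<And>i. i < k * p \<Longrightarrow> expectation (\<lambda>s. S s i ^ 4) \<le> B"
    and B: "0 \<le> B" and p: "0 < p" and k: "0 < k"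
  defines "m \<equiv> \<lambda>s j. 1 / real p * (\<Sum>i<p. S s (j * p + i))"
  shows "prob {s\<in>space M. real (k * p) < (\<Sum>j=1..k-2. (m s (j + 1) - m s j) ^ 4)} \<le> 16 * B / real p"
    and "(\<lambda>s. \<Sum>j=1..k-2. (m s (j + 1) - m s j) ^ 4) \<in> borel_measurable M"
proof -
  have idx: "j * p + i < k * p" if "j < k" "i < p" for i j
  proof -
    have "j * p + i < (j + 1) * p" using that by simp
    also have "\<dots> \<le> k * p" using that by (intro mult_right_mono) auto
    finally show ?thesis .
  qed
  have mM: "(\<lambda>s. m s j) \<in> borel_measurable M" if "j < k" for j
    unfolding m_def using idx[OF that] by (intro borel_measurable_times borel_measurable_sum S borel_measurable_const) auto
  have m4: "integrable M (\<lambda>s. m s j ^ 4) \<and> expectation (\<lambda>s. m s j ^ 4) \<le> B" if j: "j < k" for j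
  proof -
    have i: "integrable M (\<lambda>s. 1 / real p * (\<Sum>i<p. S s (j * p + i) ^ 4))"
      using idx[OF j] by (intro integrable_mult_right Bochner_Integration.integrable_sum S) auto
    have 1: "integrable M (\<lambda>s. m s j ^ 4)"
    proof (rule Bochner_Integration.integrable_bound[OF i])
      show "(\<lambda>s. m s j ^ 4) \<in> borel_measurable M" by (intro borel_measurable_power mM j)
      have "norm (m s j ^ 4) \<le> norm (1 / real p * (\<Sum>i<p. S s (j * p + i) ^ 4))" for s
        using mean_power4_le[OF p, of "\<lambda>i. S s (j * p + i)"]
          abs_ge_self[of "1 / real p * (\<Sum>i<p. S s (j * p + i) ^ 4)"]
        unfolding m_def real_norm_def by simp
      then show "AE s in M. norm (m s j ^ 4) \<le> norm (1 / real p * (\<Sum>i<p. S s (j * p + i) ^ 4))"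
        by simp
    qed
    have "expectation (\<lambda>s. m s j ^ 4) \<le> expectation (\<lambda>s. 1 / real p * (\<Sum>i<p. S s (j * p + i) ^ 4))"
      by (rule integral_mono[OF 1 i]) (unfold m_def, rule mean_power4_le[OF p])
    also have "\<dots> = 1 / real p * (\<Sum>i<p. expectation (\<lambda>s. S s (j * p + i) ^ 4))"
      using idx[OF j] S(2) by (subst integral_mult_right_zero, subst Bochner_Integration.integral_sum) auto
    also have "\<dots> \<le> 1 / real p * (\<Sum>i<p. B)"
      using idx[OF j] by (intro mult_left_mono sum_mono S) auto
    also have "\<dots> = B" using p by simp
    finally show ?thesis using 1 by simp
  qed
  have d4: "integrable M (\<lambda>s. (m s (j + 1) - m s j) ^ 4) \<and> expectation (\<lambda>s. (m s (j + 1) - m s j) ^ 4) \<le> 16 * B"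
    if "j \<in> {1..k - 2}" for j
  proof -
    have "j < k" "j + 1 < k" using that by auto
    then show ?thesis
      using fourth_moment_add[of "\<lambda>s. m s (j + 1)" B "\<lambda>s. - m s j" B] m4[of j] m4[of "j + 1"] mM[of j] mM[of "j + 1"] by simp
  qed
  show "(\<lambda>s. \<Sum>j=1..k-2. (m s (j + 1) - m s j) ^ 4) \<in> borel_measurable M"
    by (intro borel_measurable_sum borel_measurable_integrable d4[THEN conjunct1])
  have i: "integrable M (\<lambda>s. \<Sum>j=1..k-2. (m s (j + 1) - m s j) ^ 4)"
    by (intro Bochner_Integration.integrable_sum d4[THEN conjunct1])
  have "expectation (\<lambda>s. \<Sum>j=1..k-2. (m s (j + 1) - m s j) ^ 4) =
     (\<Sum>j=1..k-2. expectation (\<lambda>s. (m s (j + 1) - m s j) ^ 4))"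
    by (intro Bochner_Integration.integral_sum d4[THEN conjunct1])
  also have "\<dots> \<le> (\<Sum>j=1..k-2. 16 * B)" by (intro sum_mono d4[THEN conjunct2])
  also have "\<dots> = real (k - 2) * (16 * B)" by simp
  also have "\<dots> \<le> real k * (16 * B)" using B by (intro mult_right_mono) auto
  finally have E: "expectation (\<lambda>s. \<Sum>j=1..k-2. (m s (j + 1) - m s j) ^ 4) \<le> real k * (16 * B)" .
  have kp: "0 < real (k * p)" using k p by simp
  have "prob {s\<in>space M. real (k * p) < (\<Sum>j=1..k-2. (m s (j + 1) - m s j) ^ 4)} \<le>
    prob {s\<in>space M. real (k * p) \<le> (\<Sum>j=1..k-2. (m s (j + 1) - m s j) ^ 4)}"
    using borel_measurable_integrable[OF i] by (intro finite_measure_mono) auto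
  also have "\<dots> \<le> expectation (\<lambda>s. \<Sum>j=1..k-2. (m s (j + 1) - m s j) ^ 4) / real (k * p)"
    by (rule integral_Markov_inequality_measure[where A="{}", OF i _ _ kp]) (auto intro!: AE_I2 sum_nonneg)
  also have "\<dots> \<le> real k * (16 * B) / real (k * p)" using kp by (intro divide_right_mono[OF E]) auto
  also have "\<dots> = 16 * B / real p" using k p by simp
  finally show "prob {s\<in>space M. real (k * p) < (\<Sum>j=1..k-2. (m s (j + 1) - m s j) ^ 4)} \<le> 16 * B / real p" .
qed

section \<open>Consistency of the test\<close>

text \<open>A union bound over three bad events: equal block sums (which contains
  \<open>V = 0\<close>), \<open>V > k * p\<close>, and a numerator below \<open>n * v / 2\<close>.
  The constant 128 is \<open>16 * 8\<close>, where 8 comes from the fourth moment of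
  \<open>x + e\<close>.\<close>

lemma (in noise_sequence) statistic_exceeds_prob:
  fixes x :: "nat \<Rightarrow> 'w \<Rightarrow> real" and S :: "'w \<Rightarrow> nat \<Rightarrow> real" and G :: "nat \<Rightarrow> 'w measure"
  assumes n: "n = k * p" and p: "0 < p" and k: "0 < k" and v: "0 < v" and \<theta>: "0 < \<theta>" and \<rho>: "0 \<le> \<rho>"
    and xM: "\<And>i. i \<le> n \<Longrightarrow> x i \<in> borel_measurable M"
    and x4: "\<And>i. i \<le> n \<Longrightarrow> integrable M (\<lambda>s. x i s ^ 4)" "\<And>i. i \<le> n \<Longrightarrow> expectation (\<lambda>s. x i s ^ 4) \<le> A"
    and y: "\<And>i j. i < j \<Longrightarrow> j \<le> i + 2 \<Longrightarrow> j \<le> n \<Longrightarrow>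
        integrable M (\<lambda>s. (x j s - x i s)^2) \<and> expectation (\<lambda>s. (x j s - x i s)^2) \<le> \<rho>"
    and S: "\<And>i s. S s i = x i s + e i s"
    and G: "\<And>i. i \<le> n \<Longrightarrow> space (G i) = space M"
      "\<And>i. i \<le> n \<Longrightarrow> indep_set (gen_events M {()} (\<lambda>_. e i)) (sets (G i))"
      "\<And>i l. i \<le> n \<Longrightarrow> l \<le> n \<Longrightarrow> x l \<in> borel_measurable (G i)"
      "\<And>i l. i \<le> n \<Longrightarrow> l \<le> n \<Longrightarrow> l \<noteq> i \<Longrightarrow> e l \<in> borel_measurable (G i)"
    and q: "\<And>i c. i \<le> n \<Longrightarrow> prob {s\<in>space M. e i s = c} \<le> q" "0 \<le> q"
    and z: "z \<le> sqrt (1 / 6) * real p * v"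
  defines "mn \<equiv> \<lambda>s j. 1 / real p * (\<Sum>i<p. S s (j * p + i))"
  shows "1 - (q ^ (k - 2) + 128 * (A + C) / real p + 1152 * C / (real n * v^2) + 8 * (\<rho> * (1 + 1 / \<theta>) + 2 * \<theta> * v) / v)
    \<le> prob {s\<in>space M. z \<le> sqrt (2 * real p / (3 * (\<Sum>j=1..k-2. (mn s (j + 1) - mn s j) ^ 4))) *
        ((\<Sum>i<n. (S s (i + 1) - S s i)^2) - (\<Sum>i<n div 2. (S s (2 * i + 2) - S s (2 * i))^2))}"
proof -
  have n0: "0 < n" using n p k by simp
  define V where "V s = (\<Sum>j=1..k-2. (mn s (j + 1) - mn s j) ^ 4)" for s
  define D where "D s = (\<Sum>i<n. (S s (i + 1) - S s i)^2) - (\<Sum>i<n div 2. (S s (2 * i + 2) - S s (2 * i))^2)" for s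
  define T where "T s j = (\<Sum>i<p. S s (j * p + i))" for s j
  have SM: "(\<lambda>s. S s i) \<in> borel_measurable M" if "i \<le> n" for i
    unfolding S using xM[OF that] e_measurable[OF that] by (rule borel_measurable_add)
  have S4: "integrable M (\<lambda>s. S s i ^ 4)" "expectation (\<lambda>s. S s i ^ 4) \<le> 8 * (A + C)" if "i \<le> n" for i
    unfolding S using fourth_moment_add[OF xM x4 e_measurable e4] that by auto
  have AC: "0 \<le> 8 * (A + C)" using S4(2)[of 0] by (rule order_trans[rotated]) simp_all
  have VP: "prob {s\<in>space M. real (k * p) < V s} \<le> 16 * (8 * (A + C)) / real p" and VM: "V \<in> borel_measurable M"
  proof -
    have *: "(\<lambda>s. S s i) \<in> borel_measurable M" "integrable M (\<lambda>s. S s i ^ 4)" "expectation (\<lambda>s. S s i ^ 4) \<le> 8 * (A + C)"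
      if "i < k * p" for i
      using SM[of i] S4[of i] that n by auto
    show "prob {s\<in>space M. real (k * p) < V s} \<le> 16 * (8 * (A + C)) / real p"
      unfolding V_def mn_def by (rule block_mean_increments_prob(1)[OF * AC p k])
    show "V \<in> borel_measurable M"
      unfolding V_def mn_def by (rule block_mean_increments_prob(2)[OF * AC p k])
  qed
  have DM: "D \<in> borel_measurable M"
    unfolding D_def by (intro borel_measurable_diff borel_measurable_sum borel_measurable_power SM) auto
  have DP: "prob {s\<in>space M. D s < real n * v / 2} \<le> 1152 * C / (real n * v^2) + 8 * (\<rho> * (1 + 1 / \<theta>) + 2 * \<theta> * v) / v"
    unfolding D_def
    by (rule quadratic_variation_difference_prob[OF n0 v \<theta> \<rho> _ _ _ _ S]) (use y in auto)
  have TP: "prob {s\<in>space M. \<forall>j\<in>{1..k - 2}. T s (j + 1) = T s j} \<le> q ^ (k - 2)"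
  proof (rule equal_block_sums_prob[where G=G and e=e and x=x and p=p])
    fix i assume "i < k * p"
    then have i: "i \<le> n" using n by simp
    show "space (G i) = space M" by (rule G(1)[OF i])
    show "indep_set (gen_events M {()} (\<lambda>_. e i)) (sets (G i))" by (rule G(2)[OF i])
    show "e i \<in> borel_measurable M" by (rule e_measurable[OF i])
    show "prob {s\<in>space M. e i s = c} \<le> q" for c by (rule q(1)[OF i])
    fix l assume "l < k * p"
    then have l: "l \<le> n" using n by simp
    show "x l \<in> borel_measurable (G i)" by (rule G(3)[OF i l])
    show "l \<noteq> i \<Longrightarrow> e l \<in> borel_measurable (G i)" by (rule G(4)[OF i l])
  qed (use q(2) p in \<open>simp_all add: T_def S\<close>)
  have V0: "V s = 0 \<Longrightarrow> \<forall>j\<in>{1..k - 2}. T s (j + 1) = T s j" for s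
    unfolding V_def using p by (subst (asm) sum_nonneg_eq_0_iff) (auto simp: mn_def T_def)
  have Vnn: "0 \<le> V s" for s unfolding V_def by (intro sum_nonneg) auto
  let ?T = "{s\<in>space M. \<forall>j\<in>{1..k - 2}. T s (j + 1) = T s j}"
  let ?V = "{s\<in>space M. real (k * p) < V s}"
  let ?D = "{s\<in>space M. D s < real n * v / 2}"
  have TM: "{s\<in>space M. V s = 0} \<in> events" "?V \<in> events" "?D \<in> events"
    using VM DM by measurable
  have TE: "?T \<in> events"
  proof (intro sets.sets_Collect_finite_All borel_measurable_eq)
    fix j assume j: "j \<in> {1..k - 2}"
    have "T' * p + i \<le> n" if "T' \<le> k - 1" "i < p" for T' i
    proof -
      have "T' * p + i \<le> (T' + 1) * p" using that by simp
      also have "\<dots> \<le> k * p" using that k by (intro mult_right_mono) auto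
      finally show ?thesis using n by simp
    qed
    note idx = this
    have "j \<le> k - 1" "j + 1 \<le> k - 1" using j by auto
    then show "(\<lambda>s. T s j) \<in> borel_measurable M" "(\<lambda>s. T s (j + 1)) \<in> borel_measurable M"
      unfolding T_def by (intro borel_measurable_sum SM idx; simp)+
  qed simp
  define Z where "Z s = sqrt (2 * real p / (3 * V s)) * D s" for s
  have ZM: "{s\<in>space M. z \<le> Z s} \<in> events" unfolding Z_def using VM DM by measurable
  \<comment> \<open>The lower bound with \<open>sqrt (k / 6)\<close> is weakened to
    \<open>sqrt (1 / 6)\<close> by \<open>k \<ge> 1\<close>: growth of \<open>p\<close> alone
    already carries the statistic past any fixed \<open>z\<close>.\<close>
  have good: "z \<le> Z s" if V: "V s \<noteq> 0" "V s \<le> real (k * p)" and D: "real n * v / 2 \<le> D s" for s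
  proof -
    have Vp: "0 < V s" using V(1) Vnn[of s] by simp
    have "sqrt (1 / 6) * real p * v \<le> sqrt (real k / 6) * (real p * v)"
      using k p v by (simp add: mult.assoc)
    also have "\<dots> = sqrt (2 / (3 * real k)) * (real n * v / 2)"
    proof -
      have "sqrt (real k / 6) = sqrt (2 / (3 * real k) * (real k / 2)^2)"
        using k by (intro arg_cong[where f=sqrt]) (simp add: power2_eq_square field_simps)
      also have "\<dots> = sqrt (2 / (3 * real k)) * (real k / 2)" by (simp only: real_sqrt_mult) simp
      finally show ?thesis by (simp add: n)
    qed
    also have "\<dots> \<le> sqrt (2 * real p / (3 * V s)) * D s"
    proof (rule mult_mono)
      have "V s * 2 \<le> 2 * real p * real k" using V(2) by (simp add: mult.commute)
      then show "sqrt (2 / (3 * real k)) \<le> sqrt (2 * real p / (3 * V s))"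
        using Vp k by (intro real_sqrt_le_mono) (simp add: divide_simps mult_ac)
    qed (use D Vp p v n0 in auto)
    finally show ?thesis using z by (simp add: Z_def)
  qed
  have "1 - prob {s\<in>space M. z \<le> Z s} = prob (space M - {s\<in>space M. z \<le> Z s})"
    using ZM by (simp add: prob_compl)
  also have "\<dots> \<le> prob (?T \<union>
      (?V \<union> ?D))"
  proof (rule finite_measure_mono)
    show "space M - {s\<in>space M. z \<le> Z s} \<subseteq> ?T \<union>
      (?V \<union> ?D)"
    proof
      fix s assume "s \<in> space M - {s\<in>space M. z \<le> Z s}"
      then have "s \<in> space M" "V s = 0 \<or> real (k * p) < V s \<or> D s < real n * v / 2"
        using good[of s] by force+
      then show "s \<in> ?T \<union>
        (?V \<union> ?D)"
        using V0[of s] by blast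
    qed
  qed (use TM TE in auto)
  also have "\<dots> \<le> prob ?T +
      prob (?V \<union> ?D)"
    using TM TE by (intro measure_Un_le) auto
  also have "prob (?V \<union> ?D) \<le>
     prob ?V + prob ?D"
    using TM by (intro measure_Un_le) auto
  finally have "1 - prob {s\<in>space M. z \<le> Z s} \<le> q ^ (k - 2) + 16 * (8 * (A + C)) / real p +
     (1152 * C / (real n * v^2) + 8 * (\<rho> * (1 + 1 / \<theta>) + 2 * \<theta> * v) / v)"
    using TP VP DP by linarith
  then show ?thesis unfolding Z_def V_def D_def by simp
qed

section \<open>From the sampled diffusion to the statement about indexed sequences\<close>

lemma Z_stat_index:
  assumes "S' = (\<lambda>i. S (real i * h))" and "m = (\<lambda>j. 1 / real p * (\<Sum>i<p. S' (j * p + i)))"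
  shows "Z_stat S k p h = sqrt (2 * real p / (3 * (\<Sum>j=1..k-2. (m (j + 1) - m j) ^ 4))) *
    ((\<Sum>i<k * p. (S' (i + 1) - S' i)^2) - (\<Sum>i<(k * p) div 2. (S' (2 * i + 2) - S' (2 * i))^2))"
proof -
  \<comment> \<open>For odd \<open>n\<close> the second sum leaves out the last observation, which
    integer division takes into account.\<close>
  have "{i. 2 * i + 2 \<le> k * p} = {..<(k * p) div 2}" by auto
  moreover have "block_mean S p h j = m j" for j
    unfolding block_mean_def assms Let_def
    by (intro arg_cong2[where f="(*)"] sum.cong arg_cong[where f=S] refl) (simp add: algebra_simps)
  ultimately show ?thesis
    unfolding Z_stat_def Let_def assms(1) by simp
qed

lemma linear_growth_norm_le:
  assumes "linear_growth_upto_2 f C" shows "norm (f x) \<le> C * (1 + norm x)"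
proof -
  have "{vs. set vs \<subseteq> (Basis :: 'a set) \<and> length vs = 0} = {[]}" by auto
  then have "deriv_norm 0 f x = norm (f x)" by (simp add: deriv_norm_def)
  moreover have "0 \<le> deriv_norm j f x" for j
    unfolding deriv_norm_def by (intro real_sqrt_ge_zero sum_nonneg) auto
  ultimately show ?thesis using assms unfolding linear_growth_upto_2_def by (smt (verit))
qed

lemma C4_poly_growth_continuous:
  assumes "C4_poly_growth \<Theta> f" "\<theta> \<in> \<Theta>" shows "continuous_on UNIV (\<lambda>x. f x \<theta>)"
proof -
  have "Ck_on 4 (UNIV \<times> \<Theta>) (\<lambda>(x, \<theta>). f x \<theta>)" using assms(1) by (simp add: C4_poly_growth_def)
  then have "continuous_on (UNIV \<times> \<Theta>) (pderivs (UNIV \<times> \<Theta>) [] (\<lambda>(x, \<theta>). f x \<theta>))"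
    unfolding Ck_on_def by (elim conjE allE[of _ "[]"]) auto
  then have "continuous_on (UNIV \<times> \<Theta>) (\<lambda>(x, \<theta>). f x \<theta>)" by simp
  then show ?thesis
    using continuous_on_compose2[of "UNIV \<times> \<Theta>" "\<lambda>(x, \<theta>). f x \<theta>" UNIV "\<lambda>x. (x, \<theta>)",
        OF _ continuous_on_Pair[OF continuous_on_id continuous_on_const]] assms(2)
    by auto
qed

text \<open>The squared norm is the quadratic form of \<open>L\<close> at the all-ones vector, that
  is, the sum of all entries. Entries are inner products of rows of \<open>R\<close>, so a vanishing
  diagonal entry kills its row and column; the sum reduces to the block on which (T1) gives
  positivity, and \<open>L \<noteq> 0\<close> makes that block nonempty.\<close>

lemma psd_sqrt_ones_norm_pos:
  fixes R L :: "real^'d^'d"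
  assumes R: "is_psd_sqrt R L" and L: "L \<noteq> 0"
    and T1: "{i. L $ i $ i > 0} \<noteq> {} \<longrightarrow> pos_def_submatrix {i. L $ i $ i > 0} L"
  shows "0 < (norm ((\<chi> i. 1) v* R))^2"
proof -
  let ?u = "(\<chi> i. 1) :: real^'d" and ?K = "{i. L $ i $ i > 0}"
  have RR: "R ** R = L" and RT: "transpose R = R" using R by (auto simp: is_psd_sqrt_def pos_semidef_def)
  have Rsym: "R $ i $ j = R $ j $ i" for i j using RT by (metis transpose_def vec_lambda_beta)
  have Lij: "L $ i $ j = (\<Sum>k\<in>UNIV. R $ i $ k * R $ j $ k)" for i j
    unfolding RR[symmetric] matrix_matrix_mult_def using Rsym by (simp add: Rsym[of j])
  have zero: "L $ i $ j = 0 \<and> L $ j $ i = 0" if "i \<notin> ?K" for i j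
  proof -
    have "(\<Sum>k\<in>UNIV. (R $ i $ k)^2) \<le> 0" using that Lij[of i i] by (simp add: power2_eq_square)
    then have "R $ i $ k = 0" for k
      using sum_nonneg_eq_0_iff[of UNIV "\<lambda>k. (R $ i $ k)^2"] sum_nonneg[of UNIV "\<lambda>k. (R $ i $ k)^2"] by auto
    then show ?thesis by (simp add: Lij)
  qed
  have "?K \<noteq> {}"
  proof
    assume "?K = {}"
    then have "L $ i $ j = 0" for i j using zero[of i j] by blast
    then show False using L by (simp add: vec_eq_iff)
  qed
  then have K: "0 < (\<Sum>i\<in>?K. \<Sum>j\<in>?K. 1 * L $ i $ j * 1)"
    using T1 unfolding pos_def_submatrix_def by (elim impE conjE allE[of _ "\<lambda>_. 1"]) auto
  have "(norm (?u v* R))^2 = ?u \<bullet> (R *v (?u v* R))"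
    by (simp add: power2_norm_eq_inner dot_lmul_matrix)
  also have "\<dots> = ?u \<bullet> (L *v ?u)"
  proof -
    have "?u v* R = R *v ?u" using RT by (metis transpose_matrix_vector)
    then show ?thesis by (simp only: matrix_vector_mul_assoc RR)
  qed
  also have "?u \<bullet> (L *v ?u) = (\<Sum>i\<in>UNIV. \<Sum>j\<in>UNIV. L $ i $ j)"
    by (simp add: inner_vec_def matrix_vector_mult_def)
  also have "\<dots> = (\<Sum>i\<in>?K. \<Sum>j\<in>UNIV. L $ i $ j)"
  proof (rule sum.mono_neutral_right)
    show "\<forall>i\<in>UNIV - ?K. (\<Sum>j\<in>UNIV. L $ i $ j) = 0" using zero by (intro ballI sum.neutral) blast
  qed simp_all
  also have "\<dots> = (\<Sum>i\<in>?K. \<Sum>j\<in>?K. L $ i $ j)"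
  proof (rule sum.cong)
    fix i
    show "(\<Sum>j\<in>UNIV. L $ i $ j) = (\<Sum>j\<in>?K. L $ i $ j)"
    proof (rule sum.mono_neutral_right)
      show "\<forall>j\<in>UNIV - ?K. L $ i $ j = 0" using zero by blast
    qed simp_all
  qed simp
  finally show ?thesis using K by (simp only: mult_1_left mult_1_right)
qed

lemma (in prob_space) finite_moments_norm4:
  assumes "finite_moments M Y" shows "(\<integral>\<^sup>+ \<omega>. ennreal (norm (Y \<omega>) ^ 4) \<partial>M) < \<infinity>"
proof -
  have "norm (Y \<omega>) powr 4 = norm (Y \<omega>) ^ 4" for \<omega> by (cases "norm (Y \<omega>) = 0") simp_all
  then show ?thesis using assms unfolding finite_moments_def by (elim allE[of _ 4]) simp
qed

lemma (in wiener_space) sde_increment_L2_small: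
  fixes u :: "real^'d" and a :: "real^'d \<Rightarrow> real^'r^'d" and b :: "real^'d \<Rightarrow> real^'d"
  assumes X: "sde_solution M w b a x0 X" and b: "continuous_on UNIV b"
    and C: "0 < C" "\<And>x. norm (b x) \<le> C * (1 + norm x)" "\<And>x. norm (a x) \<le> C * (1 + norm x)"
    and B: "0 \<le> B" "\<And>t. 0 \<le> t \<Longrightarrow> (\<integral>\<^sup>+ \<omega>. ennreal (norm (X t \<omega>) ^ 4) \<partial>M) \<le> ennreal B"
    and \<rho>: "0 < \<rho>"
  shows "\<exists>d>0. \<forall>s t. 0 \<le> s \<longrightarrow> s < t \<longrightarrow> t \<le> s + d \<longrightarrow>
    integrable M (\<lambda>\<omega>. (u \<bullet> X t \<omega> - u \<bullet> X s \<omega>)^2) \<and> expectation (\<lambda>\<omega>. (u \<bullet> X t \<omega> - u \<bullet> X s \<omega>)^2) \<le> \<rho>"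
proof -
  have XM: "X t \<in> borel_measurable M" if "0 \<le> t" for t
    using X \<F>_measurable that unfolding sde_solution_def by blast
  have B2: "(\<integral>\<^sup>+ \<omega>. ennreal ((1 + norm (X t \<omega>))^2) \<partial>M) \<le> ennreal (3 + B)" if t: "0 \<le> t" for t
  proof -
    have [measurable]: "X t \<in> borel_measurable M" by (rule XM[OF t])
    have le: "(1 + y)^2 \<le> 3 + y ^ 4" for y :: real
    proof -
      have "0 \<le> (y - 1)^2 + (y^2 - 1)^2" by simp
      also have "\<dots> = 3 + y ^ 4 - (1 + y)^2" by (simp add: power2_eq_square eval_nat_numeral algebra_simps)
      finally show ?thesis by simp
    qed
    have "(\<integral>\<^sup>+ \<omega>. ennreal ((1 + norm (X t \<omega>))^2) \<partial>M) \<le> (\<integral>\<^sup>+ \<omega>. ennreal 3 + ennreal (norm (X t \<omega>) ^ 4) \<partial>M)"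
      by (intro nn_integral_mono) (simp add: le flip: ennreal_plus del: ennreal_numeral)
    also have "\<dots> = ennreal 3 + (\<integral>\<^sup>+ \<omega>. ennreal (norm (X t \<omega>) ^ 4) \<partial>M)"
      by (subst nn_integral_add) (auto simp: emeasure_space_1)
    also have "\<dots> \<le> ennreal 3 + ennreal B" by (intro add_left_mono B(2) t)
    also have "\<dots> = ennreal (3 + B)" using B by (simp add: ennreal_plus)
    finally show ?thesis .
  qed
  \<comment> \<open>\<open>Q\<close> bounds the fourth moment of the increment, 16 being
    \<open>8 * (1 + 1)\<close>; the summand 1 keeps it positive. The terms
    \<open>\<kappa>^2\<close>, \<open>l * Q\<close> and \<open>\<eta> / (4 * l)\<close> of
    \<open>second_moment_split\<close> are each set to \<open>\<rho> / 3\<close>, and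
    \<open>\<eta>\<close> comes last because it depends on \<open>l\<close>.\<close>
  define Q where "Q = 16 * (norm u ^ 4 * B) + 1"
  have Q: "0 < Q" using B by (simp add: Q_def add_nonneg_pos)
  define l where "l = \<rho> / (3 * Q)"
  have l: "0 < l" "l * Q = \<rho> / 3" using \<rho> Q by (auto simp: l_def)
  define \<kappa> where "\<kappa> = sqrt (\<rho> / 3)"
  have \<kappa>: "0 < \<kappa>" "\<kappa>^2 = \<rho> / 3" using \<rho> by (auto simp: \<kappa>_def)
  define \<eta> where "\<eta> = 4 * l * \<rho> / 3"
  have \<eta>: "0 < \<eta>" "\<eta> / (4 * l) = \<rho> / 3" using l \<rho> by (auto simp: \<eta>_def)
  have B3: "0 \<le> 3 + B" using B by simp
  obtain d where d: "0 < d" "\<And>s t. 0 \<le> s \<Longrightarrow> s < t \<Longrightarrow> t \<le> s + d \<Longrightarrow>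
      prob {\<omega>\<in>space M. \<kappa> < \<bar>u \<bullet> (X t \<omega> - X s \<omega>)\<bar>} \<le> \<eta>"
    using sde_increment_small_prob[OF X b C B3 B2 \<kappa>(1) \<eta>(1), of u] by blast
  show ?thesis
  proof (intro exI conjI allI impI)
    show "0 < d" by (rule d(1))
    fix s t assume st: "0 \<le> s" "s < t" "t \<le> s + d"
    define Y where "Y \<omega> = u \<bullet> X t \<omega> - u \<bullet> X s \<omega>" for \<omega>
    have t0: "0 \<le> t" using st by simp
    have m[measurable]: "X s \<in> borel_measurable M" "X t \<in> borel_measurable M" using XM st by auto
    have YM: "Y \<in> borel_measurable M" unfolding Y_def by measurable
    have Y4: "integrable M (\<lambda>\<omega>. Y \<omega> ^ 4)" "expectation (\<lambda>\<omega>. Y \<omega> ^ 4) \<le> Q"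
      using fourth_moment_add[of "\<lambda>\<omega>. u \<bullet> X t \<omega>" "norm u ^ 4 * B" "\<lambda>\<omega>. - (u \<bullet> X s \<omega>)" "norm u ^ 4 * B"]
        inner_fourth_moment[OF m(1) B(2)[OF st(1)] B(1), of u] inner_fourth_moment[OF m(2) B(2)[OF t0] B(1), of u]
      by (auto simp: Y_def Q_def mult.commute)
    have "prob {\<omega>\<in>space M. \<kappa> < \<bar>Y \<omega>\<bar>} \<le> \<eta>" using d(2)[OF st] by (simp add: Y_def inner_diff_right)
    then have "prob {\<omega>\<in>space M. \<kappa> < \<bar>Y \<omega>\<bar>} / (4 * l) \<le> \<rho> / 3"
      using l(1) unfolding \<eta>(2)[symmetric] by (intro divide_right_mono) auto
    then show "integrable M (\<lambda>\<omega>. (u \<bullet> X t \<omega> - u \<bullet> X s \<omega>)^2)" "expectation (\<lambda>\<omega>. (u \<bullet> X t \<omega> - u \<bullet> X s \<omega>)^2) \<le> \<rho>"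
      using second_moment_split(1)[OF YM Y4 l(1)] second_moment_split(2)[OF YM Y4 l(1), of \<kappa>] \<kappa>(2) l(2)
      unfolding Y_def by auto
  qed
qed

text \<open>Provides for one observation time the sigma-algebra of everything else. It contains
  \<open>\<F> s\<close> for all \<open>s\<close> simultaneously, so the signal is measurable for it
  also after time \<open>t\<close>.\<close>

lemma (in wiener_space) noise_independent_complement:
  fixes \<epsilon> :: "real \<Rightarrow> 'w \<Rightarrow> real^'d"
  assumes iid: "iid_standardized M T \<epsilon>" and ind: "noise_independent M T \<epsilon> x0 w" and t: "t \<in> T"
  shows "\<exists>G. space G = space M \<and> indep_set (gen_events M {()} (\<lambda>_ \<omega>. c \<bullet> \<epsilon> t \<omega>)) (sets G) \<and>
    (\<forall>s\<in>T - {t}. \<epsilon> s \<in> borel_measurable G) \<and>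
    (\<forall>s. \<forall>f :: 'w \<Rightarrow> real^'d. f \<in> borel_measurable (\<F> s) \<longrightarrow> f \<in> borel_measurable G)"
proof -
  define D where "D = sigma_sets (space M) (gen_events M {()} (\<lambda>_. x0) \<union> gen_events M {0..} w)"
  define \<G> where "\<G> = sigma_sets (space M) (gen_events M (T - {t}) \<epsilon> \<union> sigma_sets (space M) (D \<union> null_sets M))"
  have iv: "indep_vars (\<lambda>_. borel) \<epsilon> T" using iid by (simp add: iid_standardized_def)
  have nD: "indep_set (gen_events M T \<epsilon>) D" using ind by (simp add: noise_independent_def D_def)
  have "gen_events M {()} (\<lambda>_. x0) \<union> gen_events M {0..} w \<subseteq> events"
    using gen_events_subset[of "{()}" "\<lambda>_. x0" M] gen_events_subset[of "{0..}" w M] x0 wM by auto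
  then have DS: "sigma_algebra (space M) D"
    unfolding D_def using sets.space_closed[of M] by (intro sigma_algebra_sigma_sets) blast
  have ind0: "indep_set (gen_events M {t} \<epsilon>) \<G>"
    unfolding \<G>_def by (rule noise_value_indep[OF iv t nD DS])
  define G where "G = sigma (space M) \<G>"
  have Gev: "\<G> \<subseteq> events" using indep_setD_ev2[OF ind0] .
  have inner: "gen_events M (T - {t}) \<epsilon> \<union> sigma_sets (space M) (D \<union> null_sets M) \<subseteq> Pow (space M)"
    using Gev sets.space_closed[of M] unfolding \<G>_def by (blast intro: sigma_sets.Basic)
  have sG: "sets G = \<G>"
  proof -
    have "sets G = sigma_sets (space M) \<G>" unfolding G_def using Gev sets.space_closed[of M] by (intro sets_measure_of) blast
    then show ?thesis
      using sigma_algebra.sigma_sets_eq[OF sigma_algebra_sigma_sets[OF inner]] by (simp add: \<G>_def)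
  qed
  have spG: "space G = space M" unfolding G_def by (rule space_measure_of_conv)
  have tM: "\<epsilon> t \<in> borel_measurable M" using iv t unfolding indep_vars_def by auto
  show ?thesis
  proof (intro exI[of _ G] conjI ballI allI impI)
    show "space G = space M" by (rule spG)
    have "gen_events M {()} (\<lambda>_ \<omega>. c \<bullet> \<epsilon> t \<omega>) \<subseteq> gen_events M {t} \<epsilon>"
    proof -
      have "gen_events M {t} \<epsilon> \<subseteq> Pow (space M)"
        using indep_setD_ev1[OF ind0] sets.space_closed[of M] by blast
      then have "sets (sigma (space M) (gen_events M {t} \<epsilon>)) = gen_events M {t} \<epsilon>"
        using sigma_algebra.sigma_sets_eq[OF sigma_algebra_gen_events[of M "{t}" \<epsilon>]] by (simp add: sets_measure_of)
      moreover have "\<epsilon> t \<in> borel_measurable (sigma (space M) (gen_events M {t} \<epsilon>))"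
        using calculation by (intro borel_measurable_gen_events[where I="{t}" and M=M]) (auto simp: space_measure_of_conv)
      ultimately show ?thesis
        using gen_events_subset_sets[of "{()}" "\<lambda>_ \<omega>. c \<bullet> \<epsilon> t \<omega>" "sigma (space M) (gen_events M {t} \<epsilon>)" M]
        by (simp add: space_measure_of_conv)
    qed
    then show "indep_set (gen_events M {()} (\<lambda>_ \<omega>. c \<bullet> \<epsilon> t \<omega>)) (sets G)"
      unfolding sG by (rule indep_set_mono[OF ind0]) simp
    show "\<epsilon> s \<in> borel_measurable G" if "s \<in> T - {t}" for s
      by (rule borel_measurable_gen_events[OF that _ spG]) (auto simp: sG \<G>_def)
    fix s and f :: "'w \<Rightarrow> real^'d" assume f: "f \<in> borel_measurable (\<F> s)"
    have "sets (\<F> s) \<subseteq> sets G"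
      using driving_filtration_subset_all[OF x0 wM, of s] unfolding sG \<G>_def D_def
      by (auto intro: sigma_sets.Basic)
    then show "f \<in> borel_measurable G"
      using measurable_mono[of borel borel "\<F> s" G] f spG by auto
  qed
qed

theorem theorem5:
  fixes M :: "'w measure"
    and w :: "real \<Rightarrow> 'w \<Rightarrow> real^'r"
    and x0 :: "'w \<Rightarrow> real^'d"
    and X :: "real \<Rightarrow> 'w \<Rightarrow> real^'d"
    and \<epsilon> :: "real \<Rightarrow> 'w \<Rightarrow> real^'d"
    and \<Theta>1 :: "(real^'m1) set" and \<Theta>2 :: "(real^'m2) set"
    and \<alpha>s :: "real^'m1" and \<beta>s :: "real^'m2"
    and b :: "real^'d \<Rightarrow> real^'m2 \<Rightarrow> real^'d"
    and a :: "real^'d \<Rightarrow> real^'m1 \<Rightarrow> real^'r^'d"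
    and \<nu>0 :: "(real^'d) measure"
    and \<Lambda> R :: "real^'d^'d"
    and k p :: "nat \<Rightarrow> nat"
    and h :: "nat \<Rightarrow> real"
    and \<tau> \<alpha> :: real
  assumes M: "prob_space M"
    and param: "compact \<Theta>1" "convex \<Theta>1" "compact \<Theta>2" "convex \<Theta>2"
    and true_param: "(\<alpha>s, \<beta>s) \<in> interior (\<Theta>1 \<times> \<Theta>2)"
    and w: "wiener_process M w"
    and x0: "x0 \<in> borel_measurable M"
    and "prob_space.indep_set M (gen_events M {()} (\<lambda>_. x0)) (gen_events M {0..} w)"
    and X: "sde_solution M w (\<lambda>x. b x \<beta>s) (\<lambda>x. a x \<alpha>s) x0 X"
    and Lam: "pos_semidef \<Lambda>" and "is_psd_sqrt R \<Lambda>"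
    and noise: "\<And>m. iid_standardized M (obs_times (k m * p m) (h m)) \<epsilon>"
    and sampling: "\<And>m. k m \<ge> 1" "\<And>m. p m \<ge> 1" "\<And>m. h m > 0"
    and A1_smooth: "C4_poly_growth \<Theta>2 b" "C4_poly_growth \<Theta>1 a"
    and A1_growth: "\<exists>C>0. linear_growth_upto_2 (\<lambda>x. b x \<beta>s) C \<and> linear_growth_upto_2 (\<lambda>x. a x \<alpha>s) C"
    and A2: "invariant_measure M w (\<lambda>x. b x \<beta>s) (\<lambda>x. a x \<alpha>s) \<nu>0"
    and "ergodic_process M X \<nu>0"
    and "finite_moments \<nu>0 (\<lambda>x. x)"
    and A3: "\<And>q::real. q > 0 \<Longrightarrow> (SUP t\<in>{0..}. \<integral>\<^sup>+ \<omega>. ennreal (norm (X t \<omega>) powr q) \<partial>M) < \<infinity>"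
    and A4_moments: "\<And>m t. t \<in> obs_times (k m * p m) (h m) \<Longrightarrow> finite_moments M (\<epsilon> t)"
    and A4_indep: "\<And>m. noise_independent M (obs_times (k m * p m) (h m)) \<epsilon> x0 w"
    and A4_sym: "\<And>m t l. t \<in> obs_times (k m * p m) (h m) \<Longrightarrow>
           distr M borel (\<lambda>\<omega>. \<epsilon> t \<omega> $ l) = distr M borel (\<lambda>\<omega>. - (\<epsilon> t \<omega> $ l))"
    and A5: "\<exists>c>0. \<forall>x. \<forall>\<theta>\<in>\<Theta>1. c \<le> det (a x \<theta> ** transpose (a x \<theta>))"
    and AH: "1 < \<tau>" "\<tau> \<le> 2" and "\<And>m. h m = real (p m) powr (- \<tau>)"
    and "h \<longlonglongrightarrow> 0"
    and "filterlim p at_top sequentially" and "filterlim k at_top sequentially"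
    and "(\<lambda>m. real (p m) * h m) \<longlonglongrightarrow> 0"
    and "filterlim (\<lambda>m. real (k m * p m) * h m) at_top sequentially"
    and T1: "{i. \<Lambda> $ i $ i > 0} \<noteq> {} \<longrightarrow> pos_def_submatrix {i. \<Lambda> $ i $ i > 0} \<Lambda>"
    and H1: "\<Lambda> \<noteq> 0"
    and rate: "(\<lambda>m. real (k m * p m) * (h m)\<^sup>2) \<longlonglongrightarrow> 0"
    and level: "0 < \<alpha>" "\<alpha> < 1"
  shows "(\<lambda>m. measure M {\<omega> \<in> space M.
            Z_stat (comp_sum (observation X R \<epsilon>) \<omega>) (k m) (p m) (h m)
              \<ge> quantile std_normal_distribution (1 - \<alpha>)}) \<longlonglongrightarrow> 1"
proof -
  interpret wiener_space M w x0
    by (intro wiener_space.intro wiener_space_axioms.intro) fact+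
  let ?u = "(\<chi> i. 1) :: real^'d"
  define c where "c = ?u v* R"
  define v where "v = (norm c)^2"
  define x where "x t \<omega> = ?u \<bullet> X t \<omega>" for t \<omega>
  define e where "e t \<omega> = c \<bullet> \<epsilon> t \<omega>" for t \<omega>
  define n where "n m = k m * p m" for m
  define T where "T m = obs_times (n m) (h m)" for m
  define z where "z = quantile std_normal_distribution (1 - \<alpha>)"
  have v: "0 < v"
    unfolding v_def c_def using psd_sqrt_ones_norm_pos[OF \<open>is_psd_sqrt R \<Lambda>\<close> H1 T1] .
  have obs: "comp_sum (observation X R \<epsilon>) \<omega> t = x t \<omega> + e t \<omega>" for \<omega> t
    by (simp add: comp_sum_def observation_def x_def e_def c_def dot_lmul_matrix sum.distrib)
      (simp add: inner_vec_def)
  have XM: "X t \<in> borel_measurable M" if "0 \<le> t" for t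
    using X \<F>_measurable that unfolding sde_solution_def by blast
  have X\<F>: "X t \<in> borel_measurable (\<F> t)" if "0 \<le> t" for t
    using X that unfolding sde_solution_def by blast
  have "\<beta>s \<in> \<Theta>2" using true_param interior_subset[of "\<Theta>1 \<times> \<Theta>2"] by auto
  then have bc: "continuous_on UNIV (\<lambda>y. b y \<beta>s)" by (rule C4_poly_growth_continuous[OF A1_smooth(1)])
  obtain Cg where Cg: "0 < Cg" "\<And>y. norm (b y \<beta>s) \<le> Cg * (1 + norm y)" "\<And>y. norm (a y \<alpha>s) \<le> Cg * (1 + norm y)"
    using A1_growth linear_growth_norm_le by metis
  obtain BX where BX: "0 \<le> BX" "\<And>t. 0 \<le> t \<Longrightarrow> (\<integral>\<^sup>+ \<omega>. ennreal (norm (X t \<omega>) ^ 4) \<partial>M) \<le> ennreal BX"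
  proof -
    define s where "s = (SUP t\<in>{0..}. \<integral>\<^sup>+ \<omega>. ennreal (norm (X t \<omega>) powr 4) \<partial>M)"
    have s: "s < \<infinity>" unfolding s_def by (rule A3) simp
    have "(\<integral>\<^sup>+ \<omega>. ennreal (norm (X t \<omega>) ^ 4) \<partial>M) \<le> ennreal (enn2real s)" if "0 \<le> t" for t
    proof -
      have "(\<integral>\<^sup>+ \<omega>. ennreal (norm (X t \<omega>) ^ 4) \<partial>M) = (\<integral>\<^sup>+ \<omega>. ennreal (norm (X t \<omega>) powr 4) \<partial>M)" by simp
      also have "\<dots> \<le> s" unfolding s_def using that by (intro SUP_upper) simp
      also have "\<dots> = ennreal (enn2real s)" using s by simp
      finally show ?thesis .
    qed
    then show thesis using that[of "enn2real s"] by simp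
  qed
  \<comment> \<open>Time 0 belongs to every design, so all noise variables of all designs have the
    law of \<open>\<epsilon> 0\<close>. The moment bound and the atom bound are read off there and
    are therefore uniform in \<open>m\<close>.\<close>
  have T0: "0 \<in> T m" for m by (auto simp: T_def obs_times_def)
  have iid: "iid_standardized M (T m) \<epsilon>" for m unfolding T_def n_def by (rule noise)
  have \<epsilon>M: "\<epsilon> t \<in> borel_measurable M" if "t \<in> T m" for t m
    using iid[of m] that unfolding iid_standardized_def indep_vars_def by auto
  obtain B\<epsilon> where B\<epsilon>: "0 \<le> B\<epsilon>" "\<And>t m. t \<in> T m \<Longrightarrow> (\<integral>\<^sup>+ \<omega>. ennreal (norm (\<epsilon> t \<omega>) ^ 4) \<partial>M) \<le> ennreal B\<epsilon>"
  proof -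
    define s where "s = (\<integral>\<^sup>+ \<omega>. ennreal (norm (\<epsilon> 0 \<omega>) ^ 4) \<partial>M)"
    have s: "s < \<infinity>"
      unfolding s_def using A4_moments[of 0 0] T0[of 0] by (intro finite_moments_norm4) (simp add: T_def n_def)
    have "(\<integral>\<^sup>+ \<omega>. ennreal (norm (\<epsilon> t \<omega>) ^ 4) \<partial>M) \<le> ennreal (enn2real s)" if t: "t \<in> T m" for t m
    proof -
      have eq: "(\<integral>\<^sup>+ \<omega>. ennreal (norm (\<epsilon> t' \<omega>) ^ 4) \<partial>M) = (\<integral>\<^sup>+ y. ennreal (norm y ^ 4) \<partial>distr M borel (\<epsilon> t'))" if "t' \<in> T m" for t'
        using \<epsilon>M[OF that] by (subst nn_integral_distr) auto
      have "distr M borel (\<epsilon> t) = distr M borel (\<epsilon> 0)"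
        using iid[of m] t T0[of m] unfolding iid_standardized_def by blast
      then have "(\<integral>\<^sup>+ \<omega>. ennreal (norm (\<epsilon> t \<omega>) ^ 4) \<partial>M) = s"
        unfolding s_def eq[OF t] eq[OF T0] by simp
      also have "\<dots> = ennreal (enn2real s)" using s by simp
      finally show ?thesis by simp
    qed
    then show thesis using that[of "enn2real s"] by simp
  qed
  define C where "C = norm c ^ 4 * B\<epsilon>"
  define A where "A = norm ?u ^ 4 * BX"
  have e_moments: "expectation (e t) = 0 \<and> expectation (\<lambda>\<omega>. (e t \<omega>)^2) = v" if t: "t \<in> T m" for t m
  proof -
    have *: "integrable M (\<lambda>\<omega>. \<epsilon> t \<omega> $ i)" "expectation (\<lambda>\<omega>. \<epsilon> t \<omega> $ i) = 0"
      "integrable M (\<lambda>\<omega>. \<epsilon> t \<omega> $ i * \<epsilon> t \<omega> $ j)"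
      "expectation (\<lambda>\<omega>. \<epsilon> t \<omega> $ i * \<epsilon> t \<omega> $ j) = (if i = j then 1 else 0)" for i j
      using iid[of m] t unfolding iid_standardized_def by auto
    have e1: "e t = (\<lambda>\<omega>. \<Sum>i\<in>UNIV. c $ i * \<epsilon> t \<omega> $ i)" by (simp add: e_def[abs_def] inner_vec_def)
    have e2: "(\<lambda>\<omega>. (e t \<omega>)^2) = (\<lambda>\<omega>. \<Sum>i\<in>UNIV. \<Sum>j\<in>UNIV. (c $ i * c $ j) * (\<epsilon> t \<omega> $ i * \<epsilon> t \<omega> $ j))"
      by (simp add: e1 power2_eq_square sum_product algebra_simps)
    have "expectation (e t) = (\<Sum>i\<in>UNIV. expectation (\<lambda>\<omega>. c $ i * \<epsilon> t \<omega> $ i))"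
      unfolding e1 using *(1) by (intro Bochner_Integration.integral_sum integrable_mult_right) auto
    then have "expectation (e t) = 0" using *(2) by simp
    moreover have "expectation (\<lambda>\<omega>. (e t \<omega>)^2) = (\<Sum>i\<in>UNIV. \<Sum>j\<in>UNIV. (c $ i * c $ j) * (if i = j then 1 else 0))"
    proof -
      have "expectation (\<lambda>\<omega>. (e t \<omega>)^2) =
         (\<Sum>i\<in>UNIV. expectation (\<lambda>\<omega>. \<Sum>j\<in>UNIV. (c $ i * c $ j) * (\<epsilon> t \<omega> $ i * \<epsilon> t \<omega> $ j)))"
        unfolding e2 using *(3)
        by (intro Bochner_Integration.integral_sum Bochner_Integration.integrable_sum integrable_mult_right) auto
      also have "\<dots> = (\<Sum>i\<in>UNIV. \<Sum>j\<in>UNIV. expectation (\<lambda>\<omega>. (c $ i * c $ j) * (\<epsilon> t \<omega> $ i * \<epsilon> t \<omega> $ j)))"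
        using *(3) by (intro sum.cong refl Bochner_Integration.integral_sum integrable_mult_right) auto
      finally show ?thesis by (simp only: integral_mult_right_zero *(4))
    qed
    then have "expectation (\<lambda>\<omega>. (e t \<omega>)^2) = v"
      by (simp add: v_def power2_norm_eq_inner inner_vec_def if_distrib cong: if_cong)
    ultimately show ?thesis by simp
  qed
  have eM: "e t \<in> borel_measurable M" if "t \<in> T m" for t m
    unfolding e_def[abs_def] using \<epsilon>M[OF that] by measurable
  have T: "real i * h m \<in> T m" if "i \<le> n m" for i m
    using that by (auto simp: T_def obs_times_def)
  have h_pos: "0 < h m" for m by (rule sampling(3))
  have noise_seq: "noise_sequence M (\<lambda>i. e (real i * h m)) (n m) v C" for m
  proof (unfold_locales)
    have "indep_vars (\<lambda>_. borel) \<epsilon> ((\<lambda>i. real i * h m) ` {..n m})"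
      using iid[of m] unfolding iid_standardized_def T_def obs_times_def by (simp add: atLeast0AtMost)
    then have "indep_vars (\<lambda>_. borel) (\<lambda>i. \<epsilon> (real i * h m)) {..n m}"
      by (rule indep_vars_reindex) (use h_pos[of m] in \<open>auto simp: inj_on_def\<close>)
    then show "indep_vars (\<lambda>_. borel) (\<lambda>i. e (real i * h m)) {..n m}"
      unfolding e_def[abs_def] by (rule indep_vars_compose2) simp
    fix i assume "i \<le> n m"
    note t = T[OF this]
    show "integrable M (\<lambda>\<omega>. e (real i * h m) \<omega> ^ 4)" "expectation (\<lambda>\<omega>. e (real i * h m) \<omega> ^ 4) \<le> C"
      unfolding e_def C_def by (rule inner_fourth_moment[OF \<epsilon>M[OF t] B\<epsilon>(2)[OF t] B\<epsilon>(1)])+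
    show "expectation (e (real i * h m)) = 0" "expectation (\<lambda>\<omega>. (e (real i * h m) \<omega>)^2) = v"
      using e_moments[OF t] by auto
  qed
  obtain q where q: "q < 1" "0 \<le> q" "\<And>y. prob {\<omega>\<in>space M. e 0 \<omega> = y} \<le> q"
    using atoms_bounded_below_one[OF eM[OF T0]] e_moments[OF T0] v by metis
  have q': "prob {\<omega>\<in>space M. e t \<omega> = y} \<le> q" if t: "t \<in> T m" for t m y
  proof -
    have cl: "{w :: real^'d. c \<bullet> w = y} \<in> sets borel" by (intro borel_closed closed_Collect_eq continuous_intros)
    have eq: "prob {\<omega>\<in>space M. e t' \<omega> = y} = measure (distr M borel (\<epsilon> t')) {w. c \<bullet> w = y}" if "t' \<in> T m" for t'
      by (subst measure_distr[OF \<epsilon>M[OF that] cl]) (auto simp: e_def intro!: arg_cong[where f=prob])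
    have "distr M borel (\<epsilon> t) = distr M borel (\<epsilon> 0)"
      using iid[of m] t T0[of m] unfolding iid_standardized_def by blast
    then show ?thesis using q(3)[of y] unfolding eq[OF t] eq[OF T0] by simp
  qed
  define P where "P m = prob {\<omega>\<in>space M. z \<le> Z_stat (comp_sum (observation X R \<epsilon>) \<omega>) (k m) (p m) (h m)}" for m
  \<comment> \<open>All limits are postponed: for fixed \<open>m\<close> the error is explicit. In
    \<open>2 * h m \<le> d\<close> the factor 2 is the largest lag of the squared increments in the
    statistic.\<close>
  have key: "1 - (q ^ (k m - 2) + 128 * (A + C) / real (p m) + 1152 * C / (real (n m) * v^2)
        + 8 * (\<rho> * (1 + 1 / \<theta>) + 2 * \<theta> * v) / v) \<le> P m"
    if \<theta>: "0 < \<theta>" and \<rho>: "0 < \<rho>"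
      and d: "\<And>s t. 0 \<le> s \<Longrightarrow> s < t \<Longrightarrow> t \<le> s + d \<Longrightarrow>
        integrable M (\<lambda>\<omega>. (x t \<omega> - x s \<omega>)^2) \<and> expectation (\<lambda>\<omega>. (x t \<omega> - x s \<omega>)^2) \<le> \<rho>"
      and hd: "2 * h m \<le> d" and z: "z \<le> sqrt (1 / 6) * real (p m) * v" for \<theta> \<rho> d m
  proof -
    interpret N: noise_sequence M "\<lambda>i. e (real i * h m)" "n m" v C by (rule noise_seq)
    have "\<exists>G. space G = space M \<and> indep_set (gen_events M {()} (\<lambda>_ \<omega>. c \<bullet> \<epsilon> (real i * h m) \<omega>)) (sets G) \<and>
      (\<forall>s\<in>T m - {real i * h m}. \<epsilon> s \<in> borel_measurable G) \<and>
      (\<forall>s. \<forall>f :: 'w \<Rightarrow> real^'d. f \<in> borel_measurable (\<F> s) \<longrightarrow> f \<in> borel_measurable G)" if "i \<le> n m" for i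
      by (rule noise_independent_complement[OF iid _ T[OF that]]) (unfold T_def n_def, rule A4_indep)
    then obtain G where G: "\<And>i. i \<le> n m \<Longrightarrow> space (G i) = space M"
      "\<And>i. i \<le> n m \<Longrightarrow> indep_set (gen_events M {()} (\<lambda>_ \<omega>. c \<bullet> \<epsilon> (real i * h m) \<omega>)) (sets (G i))"
      "\<And>i s. i \<le> n m \<Longrightarrow> s \<in> T m - {real i * h m} \<Longrightarrow> \<epsilon> s \<in> borel_measurable (G i)"
      "\<And>i s f. i \<le> n m \<Longrightarrow> (f :: 'w \<Rightarrow> real^'d) \<in> borel_measurable (\<F> s) \<Longrightarrow> f \<in> borel_measurable (G i)"
      by metis
    have t0: "0 \<le> real i * h m" for i using h_pos[of m] by simp
    have eq: "Z_stat (comp_sum (observation X R \<epsilon>) \<omega>) (k m) (p m) (h m) =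
      sqrt (2 * real (p m) / (3 * (\<Sum>j=1..k m-2. (1 / real (p m) * (\<Sum>i<p m. x (real ((j + 1) * p m + i) * h m) \<omega> + e (real ((j + 1) * p m + i) * h m) \<omega>)
        - 1 / real (p m) * (\<Sum>i<p m. x (real (j * p m + i) * h m) \<omega> + e (real (j * p m + i) * h m) \<omega>)) ^ 4))) *
      ((\<Sum>i<n m. ((x (real (i + 1) * h m) \<omega> + e (real (i + 1) * h m) \<omega>) - (x (real i * h m) \<omega> + e (real i * h m) \<omega>))^2) -
       (\<Sum>i<n m div 2. ((x (real (2 * i + 2) * h m) \<omega> + e (real (2 * i + 2) * h m) \<omega>) - (x (real (2 * i) * h m) \<omega> + e (real (2 * i) * h m) \<omega>))^2))" for \<omega>
      unfolding Z_stat_index[OF refl refl] obs n_def ..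
    show ?thesis
      unfolding P_def eq
    proof (rule N.statistic_exceeds_prob[OF n_def _ _ v \<theta>, where x="\<lambda>i. x (real i * h m)" and G=G
          and S="\<lambda>\<omega> i. x (real i * h m) \<omega> + e (real i * h m) \<omega>"])
      show "0 < p m" "0 < k m" using sampling(1)[of m] sampling(2)[of m] by auto
      show "0 \<le> \<rho>" using \<rho> by simp
      show "x (real i * h m) \<in> borel_measurable M" for i
        unfolding x_def[abs_def] using XM[OF t0, of i] by measurable
      show "integrable M (\<lambda>\<omega>. x (real i * h m) \<omega> ^ 4)" "expectation (\<lambda>\<omega>. x (real i * h m) \<omega> ^ 4) \<le> A" for i
        unfolding x_def A_def by (rule inner_fourth_moment[OF XM[OF t0] BX(2)[OF t0] BX(1)])+
      show "integrable M (\<lambda>\<omega>. (x (real j * h m) \<omega> - x (real i * h m) \<omega>)^2) \<and>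
          expectation (\<lambda>\<omega>. (x (real j * h m) \<omega> - x (real i * h m) \<omega>)^2) \<le> \<rho>" if ij: "i < j" "j \<le> i + 2" for i j
      proof (rule d[OF t0])
        show "real i * h m < real j * h m" using ij h_pos[of m] by simp
        have "real j * h m \<le> (real i + 2) * h m" using ij h_pos[of m] by (intro mult_right_mono) auto
        then show "real j * h m \<le> real i * h m + d" using hd by (simp add: distrib_right)
      qed
      fix i assume i: "i \<le> n m"
      show "space (G i) = space M" by (rule G(1)[OF i])
      show "indep_set (gen_events M {()} (\<lambda>_. e (real i * h m))) (sets (G i))"
        using G(2)[OF i] by (simp add: e_def[abs_def])
      show "prob {\<omega>\<in>space M. e (real i * h m) \<omega> = y} \<le> q" for y by (rule q'[OF T[OF i]])
      fix l assume l: "l \<le> n m"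
      have [measurable]: "X (real l * h m) \<in> borel_measurable (G i)" by (rule G(4)[OF i X\<F>[OF t0]])
      show "x (real l * h m) \<in> borel_measurable (G i)" unfolding x_def[abs_def] by measurable
      assume "l \<noteq> i"
      then have [measurable]: "\<epsilon> (real l * h m) \<in> borel_measurable (G i)"
        using T[OF l] h_pos[of m] by (intro G(3)[OF i]) auto
      show "e (real l * h m) \<in> borel_measurable (G i)" unfolding e_def[abs_def] by measurable
    qed (use q(2) z in auto)
  qed
  have "P \<longlonglongrightarrow> 1"
  proof (rule LIMSEQ_I)
    fix r :: real assume r: "0 < r"
    \<comment> \<open>The order of choice matters: \<open>\<theta>\<close> tames the noise part of
      the cross terms, then \<open>\<rho>\<close> is taken small relative to
      \<open>1 + 1 / \<theta>\<close>, and \<open>d\<close> depends on \<open>\<rho>\<close>. Both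
      parts become \<open>r * v / 40\<close>, which gives \<open>2 * r / 5\<close>; the other three
      errors receive \<open>r / 5\<close> each.\<close>
    define \<theta> where "\<theta> = r / 80"
    define l where "l = 1 + 1 / \<theta>"
    define \<rho> where "\<rho> = r * v / (40 * l)"
    have \<theta>: "0 < \<theta>" using r by (simp add: \<theta>_def)
    then have l: "0 < l" by (simp add: l_def add_pos_nonneg)
    then have \<rho>: "0 < \<rho>" using r v by (simp add: \<rho>_def)
    have "\<rho> * l = r * v / 40" using l by (simp add: \<rho>_def)
    then have "\<rho> * (1 + 1 / \<theta>) = r * v / 40" unfolding l_def .
    then have err: "8 * (\<rho> * (1 + 1 / \<theta>) + 2 * \<theta> * v) / v = 2 * r / 5"
      using v by (simp add: \<theta>_def field_simps)
    obtain d where d: "0 < d" "\<And>s t. 0 \<le> s \<Longrightarrow> s < t \<Longrightarrow> t \<le> s + d \<Longrightarrow>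
        integrable M (\<lambda>\<omega>. (x t \<omega> - x s \<omega>)^2) \<and> expectation (\<lambda>\<omega>. (x t \<omega> - x s \<omega>)^2) \<le> \<rho>"
      using sde_increment_L2_small[OF X bc Cg BX \<rho>, of ?u] unfolding x_def by blast
    have p_real: "filterlim (\<lambda>m. real (p m)) at_top sequentially"
      by (rule filterlim_compose[OF filterlim_real_sequentially \<open>filterlim p at_top sequentially\<close>])
    have "eventually (\<lambda>m. 2 * h m < d) sequentially"
      using order_tendstoD(2)[OF tendsto_mult_right_zero[OF \<open>h \<longlonglongrightarrow> 0\<close>, of 2] d(1)] .
    moreover have "eventually (\<lambda>m. z / (sqrt (1 / 6) * v) \<le> real (p m)) sequentially"
      using p_real by (simp add: filterlim_at_top)
    moreover have "eventually (\<lambda>m. q ^ (k m - 2) < r / 5) sequentially"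
    proof (rule order_tendstoD(2))
      have "filterlim (\<lambda>m. k m - 2) at_top sequentially"
        by (rule filterlim_compose[OF filterlim_minus_const_nat_at_top \<open>filterlim k at_top sequentially\<close>])
      then show "(\<lambda>m. q ^ (k m - 2)) \<longlonglongrightarrow> 0"
        using q by (intro filterlim_compose[OF LIMSEQ_power_zero]) auto
    qed (use r in simp)
    moreover have "eventually (\<lambda>m. 128 * (A + C) / real (p m) < r / 5) sequentially"
      by (rule order_tendstoD(2)[OF tendsto_divide_0[OF tendsto_const filterlim_at_top_imp_at_infinity[OF p_real]]])
        (use r in simp)
    moreover have "eventually (\<lambda>m. 1152 * C / (real (n m) * v^2) < r / 5) sequentially"
    proof (rule order_tendstoD(2))
      have "filterlim (\<lambda>m. real (n m)) at_top sequentially"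
      proof (rule filterlim_at_top_mono[OF p_real], intro always_eventually allI)
        fix m
        have "1 * p m \<le> k m * p m" using sampling(1)[of m] by (intro mult_right_mono) auto
        then show "real (p m) \<le> real (n m)" unfolding n_def of_nat_le_iff by simp
      qed
      then have "(\<lambda>m. (1152 * C / v^2) / real (n m)) \<longlonglongrightarrow> 0"
        by (intro tendsto_divide_0[OF tendsto_const] filterlim_at_top_imp_at_infinity)
      then show "(\<lambda>m. 1152 * C / (real (n m) * v^2)) \<longlonglongrightarrow> 0" by (simp add: mult.commute)
    qed (use r in simp)
    ultimately have "eventually (\<lambda>m. norm (P m - 1) < r) sequentially"
    proof eventually_elim
      case (elim m)
      have "z \<le> sqrt (1 / 6) * real (p m) * v"
        using elim(2) v by (simp add: pos_divide_le_eq mult_ac)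
      then have "1 - (q ^ (k m - 2) + 128 * (A + C) / real (p m) + 1152 * C / (real (n m) * v^2) + 2 * r / 5) \<le> P m"
        using key[of \<theta> \<rho> d m, OF \<theta> \<rho> d(2)] elim(1) unfolding err by simp
      then have "1 - P m < r" using elim(3-5) r by linarith
      moreover have "P m \<le> 1" unfolding P_def by simp
      ultimately show ?case by simp
    qed
    then show "\<exists>N. \<forall>m\<ge>N. norm (P m - 1) < r" by (simp add: eventually_sequentially)
  qed
  then show ?thesis unfolding P_def z_def .
qed

end
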